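(* Consider a system $\dot x=f(x)$, with $x\in\mathbb{R}^n$ and $f\in C^2$, which admits a fixed point $x^*$ with basin of attraction $\mathcal{B}(x^* )\subseteq\mathbb{R}^n$. Assume that the eigenvalues $\lambda_j$, $j=1,\dots,n$, of the Jacobian matrix $J=\frac{\partial f}{\partial x}(x^* )$ satisfy $0>\Re\{\lambda_j\}\geq\Re\{\lambda_{j+1}\}$ and that the eigenvectors of $J$ are independent. Then the system is differentially positive in $\mathcal{B}(x^* )$ if and only if $\lambda_1\in\mathbb{R}$. Moreover, it is strictly differentially positive (in $\mathcal{B}(x^* )$) if $\lambda_1>\Re\{\lambda_2\}$ (in particular $\lambda_1\in\mathbb{R}$).
   Context: Setting. The system $\dot x=f(x)$ is assumed forward and backward complete, with flow $\psi^t$ defined for all $t\in\mathbb{R}$. The basin of attraction $\mathcal{B}(x^* )$ is the set of points whose trajectories converge to $x^*$ as $t\to+\infty$. The definitions below are applied with $\mathcal{X}=\mathcal{B}(x^* )$, $T_x\mathcal{X}=\mathbb{R}^n$; $\mathcal{X}$ is endowed with a Riemannian metric and $|\delta x|$ is the associated norm. $\partial\psi^t(x)$ is the differential of $\psi^t$ at $x$, and $\partial\psi^t(x)A=\{\partial\psi^t(x)\delta x:\delta x\in A\}$. Cone fields. A cone field on $\mathcal{X}$ assigns to each $x\in\mathcal{X}$ a closed, solid (nonempty interior) set $\mathcal{K}(x)\subseteq T_x\mathcal{X}$ with $\mathcal{K}(x)+\mathcal{K}(x)\subseteq\mathcal{K}(x)$, $\alpha\mathcal{K}(x)\subseteq\mathcal{K}(x)$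 for all $\alpha\in\mathbb{R}^+$, and $\mathcal{K}(x)\cap-\mathcal{K}(x)=\{0\}$. Differential positivity. The system is differentially positive with respect to $\mathcal{K}$ if $\partial\psi^t(x)\mathcal{K}(x)\subseteq\mathcal{K}(\psi^t(x))$ for all $x\in\mathcal{X}$ and $t>0$. It is (uniformly) strictly differentially positive with respect to $\mathcal{K}$ if in addition there exist a constant $T>0$ and a cone field $\mathcal{R}(x)\subset\mathrm{int}\,\mathcal{K}(x)\cup\{0\}$ such that $\partial\psi^t(x)\mathcal{K}(x)\subseteq\mathcal{R}(\psi^t(x))$ for all $x\in\mathcal{X}$ and $t\geq T$. The system is called (strictly) differentially positive in $\mathcal{B}(x^* )$ if it is so with respect to some cone field on $\mathcal{X}=\mathcal{B}(x^* )$. Standing conventions on cone fields in the paper: to avoid pathological cases, it is assumed that for every $x_1,x_2\in\mathcal{X}$ there is a linear invertible map $\Gamma(x_1,x_2):T_{x_1}\mathcal{X}\to T_{x_2}\mathcal{X}$ with $\Gamma(x_1,x_2)\mathcal{K}(x_1)=\mathcal{K}(x_2)$ and $\Gamma(x_1,x_2)\mathcal{R}(x_1)=\mathcal{R}(x_2)$; and one considers representations $\mathcal{K}(x)=\{\delta x: k_i(x,\delta x)\geq 0,\ i=1,\dots,m\}$, $\mathcal{R}(x)=\{\delta x: k_i(x,\delta x/|\delta x|)\geq\varepsilon,\ i=1,\dots,m\}$ for some $m\in\mathbb{N}$, $\varepsilon>0$ and smooth functions $k_i:T\mathcal{X}\to\mathbb{R}$.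
   Formalization: If several eigenvalues share the largest real part and one of them is real, λ_1 is taken to be real; otherwise "only if" fails, e.g. for a linear system with eigenvalues -1+i, -1-i, -1, which leaves an ice-cream cone invariant. *)

theory Defs
  imports "HOL-Analysis.Analysis"
begin

text \<open>Continuous differentiability on an \<^emph>\<open>open\<close> set \<open>S\<close>: all iterated
  directional derivatives up to the given order exist and are continuous.\<close>

primrec Ck_on :: "nat \<Rightarrow> ('a::euclidean_space \<Rightarrow> 'b::euclidean_space) \<Rightarrow> 'a set \<Rightarrow> bool" where
  "Ck_on 0 f S \<longleftrightarrow> continuous_on S f"
| "Ck_on (Suc k) f S \<longleftrightarrow> (\<forall>x\<in>S. f differentiable (at x)) \<and>
     (\<forall>v. Ck_on k (\<lambda>x. frechet_derivative f (at x) v) S)"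

definition smooth_on :: "('a::euclidean_space \<Rightarrow> 'b::euclidean_space) \<Rightarrow> 'a set \<Rightarrow> bool" where
  "smooth_on f S \<longleftrightarrow> (\<forall>k. Ck_on k f S)"


definition complete_flow ::
    "(real^'n \<Rightarrow> real^'n) \<Rightarrow> (real \<Rightarrow> real^'n \<Rightarrow> real^'n) \<Rightarrow> bool" where
  "complete_flow f \<psi> \<longleftrightarrow>
     (\<forall>x. \<psi> 0 x = x) \<and>
     (\<forall>x t. ((\<lambda>s. \<psi> s x) has_vector_derivative f (\<psi> t x)) (at t))"

definition basin :: "(real \<Rightarrow> real^'n \<Rightarrow> real^'n) \<Rightarrow> real^'n \<Rightarrow> (real^'n) set" where
  "basin \<psi> p = {x. ((\<lambda>t. \<psi> t x) \<longlongrightarrow> p) at_top}"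

definition flow_diff ::
    "(real \<Rightarrow> real^'n \<Rightarrow> real^'n) \<Rightarrow> real \<Rightarrow> real^'n \<Rightarrow> real^'n \<Rightarrow> real^'n" where
  "flow_diff \<psi> t x = frechet_derivative (\<psi> t) (at x)"

definition riemannian_metric_on ::
    "(real^'n) set \<Rightarrow> (real^'n \<Rightarrow> real^'n \<Rightarrow> real^'n \<Rightarrow> real) \<Rightarrow> bool" where
  "riemannian_metric_on X g \<longleftrightarrow>
     (\<forall>x\<in>X. bilinear (g x) \<and> (\<forall>u v. g x u v = g x v u) \<and> (\<forall>u. u \<noteq> 0 \<longrightarrow> 0 < g x u u)) \<and>
     (\<forall>u v. smooth_on (\<lambda>x. g x u v) X)"

definition riemannian_norm ::
    "(real^'n \<Rightarrow> real^'n \<Rightarrow> real^'n \<Rightarrow> real) \<Rightarrow> real^'n \<Rightarrow> real^'n \<Rightarrow> real" where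
  "riemannian_norm g x u = sqrt (g x u u)"


definition cone_field_on :: "(real^'n) set \<Rightarrow> (real^'n \<Rightarrow> (real^'n) set) \<Rightarrow> bool" where
  "cone_field_on X K \<longleftrightarrow> (\<forall>x\<in>X.
     closed (K x) \<and> interior (K x) \<noteq> {} \<and>
     (\<forall>u\<in>K x. \<forall>v\<in>K x. u + v \<in> K x) \<and> cone (K x) \<and>
     K x \<inter> uminus ` K x = {0})"

definition diff_pos_wrt ::
    "(real \<Rightarrow> real^'n \<Rightarrow> real^'n) \<Rightarrow> (real^'n) set \<Rightarrow> (real^'n \<Rightarrow> (real^'n) set) \<Rightarrow> bool" where
  "diff_pos_wrt \<psi> X K \<longleftrightarrow>
     (\<forall>x\<in>X. \<forall>t>0. flow_diff \<psi> t x ` K x \<subseteq> K (\<psi> t x))"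

definition strict_diff_pos_wrt ::
    "(real \<Rightarrow> real^'n \<Rightarrow> real^'n) \<Rightarrow> (real^'n) set \<Rightarrow>
     (real^'n \<Rightarrow> (real^'n) set) \<Rightarrow> (real^'n \<Rightarrow> (real^'n) set) \<Rightarrow> bool" where
  "strict_diff_pos_wrt \<psi> X K R \<longleftrightarrow>
     diff_pos_wrt \<psi> X K \<and>
     (\<forall>x\<in>X. R x \<subseteq> interior (K x) \<union> {0}) \<and>
     (\<exists>T>0. \<forall>x\<in>X. \<forall>t\<ge>T. flow_diff \<psi> t x ` K x \<subseteq> R (\<psi> t x))"

text \<open>The tangent bundle of an open set \<open>X\<close> is \<open>X \<times> UNIV\<close>, and the functions \<open>k i\<close> live on it.\<close>

definition cone_representation ::
    "(real^'n) set \<Rightarrow> nat \<Rightarrow> (nat \<Rightarrow> (real^'n) \<times> (real^'n) \<Rightarrow> real) \<Rightarrow>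
     (real^'n \<Rightarrow> (real^'n) set) \<Rightarrow> bool" where
  "cone_representation X m k K \<longleftrightarrow>
     (\<forall>i\<in>{1..m}. smooth_on (k i) (X \<times> UNIV)) \<and>
     (\<forall>x\<in>X. K x = {u. \<forall>i\<in>{1..m}. 0 \<le> k i (x, u)})"

text \<open>The zero vector cannot be normalised, but every cone contains it, so it is added to the
  set described by the normalised inequalities.\<close>

definition cone_representation_inner ::
    "(real^'n) set \<Rightarrow> (real^'n \<Rightarrow> real^'n \<Rightarrow> real^'n \<Rightarrow> real) \<Rightarrow> nat \<Rightarrow>
     (nat \<Rightarrow> (real^'n) \<times> (real^'n) \<Rightarrow> real) \<Rightarrow> real \<Rightarrow> (real^'n \<Rightarrow> (real^'n) set) \<Rightarrow> bool" where
  "cone_representation_inner X g m k \<epsilon> R \<longleftrightarrow>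
     (\<forall>x\<in>X. R x = {u. u = 0 \<or> (\<forall>i\<in>{1..m}. \<epsilon> \<le> k i (x, u /\<^sub>R riemannian_norm g x u))})"

text \<open>A system is differentially positive on \<open>X\<close> if it is so for some admissible cone field:
  the cones are linearly isomorphic to each other, and cut out by finitely many smooth
  inequalities. Without these regularity requirements one could transport a cone along each
  orbit separately. In the strict case a single family of isomorphisms and a single family of
  functions \<open>k i\<close> serve both cone fields.\<close>

definition differentially_positive_in ::
    "(real \<Rightarrow> real^'n \<Rightarrow> real^'n) \<Rightarrow> (real^'n) set \<Rightarrow> bool" where
  "differentially_positive_in \<psi> X \<longleftrightarrow> (\<exists>K.
     cone_field_on X K \<and>
     (\<forall>x1\<in>X. \<forall>x2\<in>X. \<exists>\<Gamma>. linear \<Gamma> \<and> bij \<Gamma> \<and> \<Gamma> ` K x1 = K x2) \<and>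
     (\<exists>m k. cone_representation X m k K) \<and>
     diff_pos_wrt \<psi> X K)"

definition strictly_differentially_positive_in ::
    "(real \<Rightarrow> real^'n \<Rightarrow> real^'n) \<Rightarrow> (real^'n) set \<Rightarrow>
     (real^'n \<Rightarrow> real^'n \<Rightarrow> real^'n \<Rightarrow> real) \<Rightarrow> bool" where
  "strictly_differentially_positive_in \<psi> X g \<longleftrightarrow> (\<exists>K R.
     cone_field_on X K \<and> cone_field_on X R \<and>
     (\<forall>x1\<in>X. \<forall>x2\<in>X. \<exists>\<Gamma>. linear \<Gamma> \<and> bij \<Gamma> \<and> \<Gamma> ` K x1 = K x2 \<and> \<Gamma> ` R x1 = R x2) \<and>
     (\<exists>m k. \<exists>\<epsilon>>0. cone_representation X m k K \<and> cone_representation_inner X g m k \<epsilon> R) \<and>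
     strict_diff_pos_wrt \<psi> X K R)"


definition complex_jacobian :: "(real^'n \<Rightarrow> real^'n) \<Rightarrow> real^'n \<Rightarrow> complex^'n^'n" where
  "complex_jacobian f p =
     (\<chi> i j. complex_of_real (matrix (frechet_derivative f (at p)) $ i $ j))"

definition eigenvalues_with_mult :: "complex^'n^'n \<Rightarrow> (nat \<Rightarrow> complex) \<Rightarrow> bool" where
  "eigenvalues_with_mult A ev \<longleftrightarrow> (\<forall>z. det (mat z - A) = (\<Prod>j=1..CARD('n). z - ev j))"

definition independent_eigenvectors :: "complex^'n^'n \<Rightarrow> (nat \<Rightarrow> complex) \<Rightarrow> bool" where
  "independent_eigenvectors A ev \<longleftrightarrow> (\<exists>v. (\<forall>j\<in>{1..CARD('n)}. A *v v j = ev j *s v j) \<and>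
     inj_on v {1..CARD('n)} \<and> vec.independent (v ` {1..CARD('n)}))"

text \<open>Decreasing real parts determine \<open>ev 1\<close> only up to ties: for a matrix with eigenvalues
  \<open>a\<close>, \<open>a + \<i>b\<close> and \<open>a - \<i>b\<close> it would be a matter of choice whether \<open>ev 1\<close> is real. By the
  following convention a real eigenvalue of maximal real part, if there is one, comes first.\<close>

definition real_first_among_leading :: "nat \<Rightarrow> (nat \<Rightarrow> complex) \<Rightarrow> bool" where
  "real_first_among_leading n ev \<longleftrightarrow>
     ((\<exists>j\<in>{1..n}. ev j \<in> \<real> \<and> Re (ev j) = Re (ev 1)) \<longrightarrow> ev 1 \<in> \<real>)"

end

theory Submission
  imports Defs
begin

text \<open>Differential positivity on the basin is decided by the linearisation at the fixed point.

  \<^bold>\<open>A real leading eigenvalue is necessary.\<close> At the fixed point the cone is invariant under the linear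
  flow \<open>exp (t J)\<close>. Rescale a trajectory in the cone by \<open>exp (- \<mu> t)\<close>, where \<open>\<mu>\<close> is the largest real part
  of an eigenvalue. If \<open>\<mu>\<close> is not an eigenvalue, the leading components only rotate and their time
  averages tend to zero; but a functional that is positive on the cone stays bounded away from zero
  along the trajectory (\<open>invariant_cone_imp_real_leading_eigenvalue\<close>).

  \<^bold>\<open>It is sufficient.\<close> If the leading eigenvalue is real, tangent vectors split into a leading coordinate
  \<open>\<alpha>\<close> and a complement \<open>T\<close> which the linear flow contracts at least as fast
  (\<open>real_leading_splitting\<close>). Along an orbit close to the fixed point the true differential satisfies
  the linear equation up to a perturbation proportional to the distance \<open>W\<close> from the fixed point. As \<open>W\<close>
  decays exponentially, the perturbation is integrable: the quantity \<open>norm T / \<alpha> + C * W\<close> does not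
  increase, and if the leading eigenvalue is isolated it even decays at a rate \<open>\<gamma> > 0\<close>
  (\<open>cone_estimate\<close>). So the cones \<open>norm T \<le> (1 - C * W) * \<alpha>\<close> are invariant near the fixed point.

  \<^bold>\<open>From the neighbourhood to the basin.\<close> An orbit in the basin enters a small ball around the fixed
  point after a time \<open>\<tau>\<close> that depends continuously on its starting point. Cones far away are pulled back
  along the orbit from the entrance point, after being narrowed by \<open>exp (- \<gamma> \<tau>)\<close>. The narrowing is
  what makes the contraction uniform on the whole basin when the leading eigenvalue is isolated
  (\<open>cone_invariance\<close>).

  \<^bold>\<open>Smooth inequalities.\<close> The vector field is only twice differentiable, so cones constructed from the
  flow are not given by smooth functions. But the union of the cones over all base points is closed
  in the tangent bundle, the unit vectors of the narrower cones form a closed set inside its interior,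
  and by a theorem of Whitney closed sets are zero sets of smooth functions
  (\<open>smooth_function_with_two_superlevel_sets\<close>).\<close>

section \<open>Calculus of \<open>Ck_on\<close>\<close>

lemma Ck_on_cong:
  assumes "open S" "\<And>x. x \<in> S \<Longrightarrow> f x = g x"
  shows "Ck_on k f S \<longleftrightarrow> Ck_on k g S"
  using assms(2)
proof (induction k arbitrary: f g)
  case 0
  then show ?case by (simp cong: continuous_on_cong)
next
  case (Suc k)
  have hd: "(f has_derivative D) (at x) \<longleftrightarrow> (g has_derivative D) (at x)" if "x \<in> S" for x D
    using Suc.prems \<open>open S\<close> that
    by (metis has_derivative_transform_within_open)
  then have d: "f differentiable (at x) \<longleftrightarrow> g differentiable (at x)" if "x \<in> S" for x
    using that by (simp add: differentiable_def)
  have fd: "frechet_derivative f (at x) = frechet_derivative g (at x)" if "x \<in> S" for x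
    using hd[OF that] by (simp add: frechet_derivative_def)
  have "Ck_on k (\<lambda>x. frechet_derivative f (at x) v) S \<longleftrightarrow>
        Ck_on k (\<lambda>x. frechet_derivative g (at x) v) S" for v
    by (rule Suc.IH) (simp add: fd)
  then show ?case using d by simp
qed

lemma Ck_on_subset: "Ck_on k f S \<Longrightarrow> T \<subseteq> S \<Longrightarrow> Ck_on k f T"
  by (induction k arbitrary: f) (auto intro: continuous_on_subset)

lemma Ck_on_imp_continuous_on: "Ck_on k f S \<Longrightarrow> continuous_on S f"
proof (cases k)
  case (Suc j)
  assume "Ck_on k f S"
  then show ?thesis
    using Suc by (auto intro!: continuous_at_imp_continuous_on differentiable_imp_continuous_within)
qed simp

lemma Ck_on_SucD: "Ck_on (Suc k) f S \<Longrightarrow> Ck_on k f S"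
proof (induction k arbitrary: f)
  case 0
  then show ?case by (simp add: Ck_on_imp_continuous_on[of "Suc 0", simplified])
next
  case (Suc k)
  then show ?case by (auto simp del: Ck_on.simps simp add: Ck_on.simps(2))
qed

text \<open>Replaces \<open>frechet_derivative\<close>, which differentiation rules do not compute, by an explicit
  derivative, so that each closure property below reduces to an induction on the order.\<close>

lemma Ck_on_SucI:
  assumes "open S" "\<And>x. x \<in> S \<Longrightarrow> (f has_derivative f' x) (at x)"
    "\<And>v. Ck_on k (\<lambda>x. f' x v) S"
  shows "Ck_on (Suc k) f S"
proof -
  have fd: "frechet_derivative f (at x) = f' x" if "x \<in> S" for x
    using frechet_derivative_at[OF assms(2)[OF that]] by simp
  have "Ck_on k (\<lambda>x. frechet_derivative f (at x) v) S" for v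
    using Ck_on_cong[OF \<open>open S\<close>, of "\<lambda>x. frechet_derivative f (at x) v" "\<lambda>x. f' x v"] fd assms(3)
    by simp
  then show ?thesis
    using assms(2) by (auto simp: differentiable_def)
qed

lemma Ck_on_SucD_has_derivative:
  assumes "Ck_on (Suc k) f S" "x \<in> S"
  shows "(f has_derivative frechet_derivative f (at x)) (at x)"
  using assms by (simp add: frechet_derivative_works)

lemma Ck_on_const: "open S \<Longrightarrow> Ck_on k (\<lambda>x. c) S"
proof (induction k arbitrary: c)
  case (Suc k)
  show ?case
    by (rule Ck_on_SucI[where f' = "\<lambda>x v. 0"]) (use Suc in auto)
qed auto

lemma Ck_on_bounded_linear:
  assumes "open S" "bounded_linear f"
  shows "Ck_on k f S"
proof (cases k)
  case 0
  then show ?thesis by (simp add: assms linear_continuous_on)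
next
  case (Suc j)
  show ?thesis unfolding Suc
    by (rule Ck_on_SucI[where f' = "\<lambda>x. f"])
       (use assms Ck_on_const in \<open>auto intro: bounded_linear_imp_has_derivative\<close>)
qed

lemma Ck_on_add:
  assumes "open S"
  shows "Ck_on k f S \<Longrightarrow> Ck_on k g S \<Longrightarrow> Ck_on k (\<lambda>x. f x + g x) S"
proof (induction k arbitrary: f g)
  case (Suc k)
  show ?case
    by (rule Ck_on_SucI[where f' = "\<lambda>x v. frechet_derivative f (at x) v + frechet_derivative g (at x) v"])
       (use assms Suc in \<open>auto intro!: has_derivative_add simp: frechet_derivative_works\<close>)
qed (auto intro: continuous_on_add)

lemma Ck_on_mult:
  fixes f g :: "'a::euclidean_space \<Rightarrow> real"
  assumes "open S"
  shows "Ck_on k f S \<Longrightarrow> Ck_on k g S \<Longrightarrow> Ck_on k (\<lambda>x. f x * g x) S"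
proof (induction k arbitrary: f g)
  case (Suc k)
  show ?case
  proof (rule Ck_on_SucI[where f' = "\<lambda>x v. f x * frechet_derivative g (at x) v + frechet_derivative f (at x) v * g x"])
    fix x assume "x \<in> S"
    then show "((\<lambda>x. f x * g x) has_derivative
         (\<lambda>v. f x * frechet_derivative g (at x) v + frechet_derivative f (at x) v * g x)) (at x)"
      using Suc.prems Ck_on_SucD_has_derivative by (intro has_derivative_mult) auto
  next
    fix v
    show "Ck_on k (\<lambda>x. f x * frechet_derivative g (at x) v + frechet_derivative f (at x) v * g x) S"
      using Suc.prems Ck_on_SucD[OF Suc.prems(1)] Ck_on_SucD[OF Suc.prems(2)]
      by (intro Ck_on_add[OF assms] Suc.IH) auto
  qed (rule assms)
qed (auto intro: continuous_on_mult)

lemma Ck_on_cmult: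
  fixes f :: "'a::euclidean_space \<Rightarrow> real"
  assumes "open S" "Ck_on k f S"
  shows "Ck_on k (\<lambda>x. c * f x) S"
  using Ck_on_mult[OF assms(1) Ck_on_const[OF assms(1)] assms(2)] .

lemma Ck_on_diff:
  fixes f g :: "'a::euclidean_space \<Rightarrow> real"
  assumes "open S" "Ck_on k f S" "Ck_on k g S"
  shows "Ck_on k (\<lambda>x. f x - g x) S"
  using Ck_on_add[OF assms(1,2) Ck_on_cmult[OF assms(1,3), of "-1"]] by simp

lemma Ck_on_sum:
  assumes "open S" "\<And>i. i \<in> I \<Longrightarrow> Ck_on k (f i) S"
  shows "Ck_on k (\<lambda>x. \<Sum>i\<in>I. f i x) S"
proof (cases "finite I")
  case True
  then show ?thesis
    using assms(2) by (induction I) (auto intro!: Ck_on_add[OF assms(1)] Ck_on_const[OF assms(1)])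
qed (simp add: Ck_on_const[OF assms(1)])

lemma Ck_on_compose_real:
  fixes h :: "real \<Rightarrow> real" and q :: "'a::euclidean_space \<Rightarrow> real"
  assumes "open S" "q ` S \<subseteq> D"
  shows "Ck_on k h D \<Longrightarrow> Ck_on k q S \<Longrightarrow> Ck_on k (\<lambda>x. h (q x)) S"
proof (induction k arbitrary: h)
  case 0
  then show ?case using assms(2) by (auto intro: continuous_on_compose2)
next
  case (Suc k)
  let ?h' = "\<lambda>y. frechet_derivative h (at y) 1"
  have lin: "frechet_derivative h (at y) w = ?h' y * w" if "y \<in> D" for y w
  proof -
    have "linear (frechet_derivative h (at y))"
      using Suc.prems(1) that by (simp add: linear_frechet_derivative)
    from linear_scale[OF this, of w 1] show ?thesis by simp
  qed
  show ?case
  proof (rule Ck_on_SucI[where f' = "\<lambda>x v. ?h' (q x) * frechet_derivative q (at x) v"])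
    fix x assume x: "x \<in> S"
    then have qx: "q x \<in> D" using assms(2) by auto
    have eq: "(\<lambda>v. frechet_derivative h (at (q x)) (frechet_derivative q (at x) v)) =
        (\<lambda>v. ?h' (q x) * frechet_derivative q (at x) v)"
      by (rule ext, rule lin[OF qx])
    have "((\<lambda>x. h (q x)) has_derivative
         (\<lambda>v. frechet_derivative h (at (q x)) (frechet_derivative q (at x) v))) (at x)"
      by (rule has_derivative_compose[OF Ck_on_SucD_has_derivative[OF Suc.prems(2) x]
            Ck_on_SucD_has_derivative[OF Suc.prems(1) qx]])
    then show "((\<lambda>x. h (q x)) has_derivative (\<lambda>v. ?h' (q x) * frechet_derivative q (at x) v)) (at x)"
      unfolding eq .
  next
    fix v
    show "Ck_on k (\<lambda>x. ?h' (q x) * frechet_derivative q (at x) v) S"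
    proof (rule Ck_on_mult[OF assms(1)])
      show "Ck_on k (\<lambda>x. ?h' (q x)) S"
        using Suc.IH[of ?h'] Suc.prems(1) Ck_on_SucD[OF Suc.prems(2)] by simp
    qed (use Suc.prems(2) in simp)
  qed (rule assms)
qed

lemma Ck_on_inverse: "Ck_on k (inverse :: real \<Rightarrow> real) {0<..}"
proof (induction k)
  case 0
  show ?case by (auto intro!: continuous_intros)
next
  case (Suc k)
  show ?case
  proof (rule Ck_on_SucI[where f' = "\<lambda>y v. (- v) * (inverse y * inverse y)"])
    fix y :: real assume "y \<in> {0<..}"
    then show "(inverse has_derivative (\<lambda>v. (- v) * (inverse y * inverse y))) (at y)"
      using has_derivative_inverse'[of y UNIV] by (auto simp: mult_ac)
  next
    fix v :: real
    show "Ck_on k (\<lambda>y. (- v) * (inverse y * inverse y)) {0<..}"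
      using Suc by (intro Ck_on_cmult Ck_on_mult) auto
  qed simp
qed

section \<open>A smooth function positive exactly on a given open set\<close>

text \<open>The classical flat function is \<open>flat 0\<close>. The factor \<open>s\<^sup>-\<^sup>m\<close> makes the family closed under
  differentiation up to linear combinations.\<close>
definition flat :: "nat \<Rightarrow> real \<Rightarrow> real" where
  "flat m s = (if s > 0 then inverse s ^ m * exp (- inverse s) else 0)"

lemma flat_tendsto_0: "((\<lambda>s. inverse s ^ m * exp (- inverse s)) \<longlongrightarrow> (0::real)) (at_right 0)"
proof -
  have "((\<lambda>y. y ^ m / exp y) \<longlongrightarrow> (0::real)) at_top"
    by (rule tendsto_power_div_exp_0)
  then have "((\<lambda>s. inverse s ^ m / exp (inverse s)) \<longlongrightarrow> (0::real)) (at_right 0)"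
    by (rule filterlim_compose[OF _ filterlim_inverse_at_top_right])
  then show ?thesis by (simp add: exp_minus divide_inverse)
qed

lemma flat_has_derivative:
  "(flat m has_real_derivative (flat (m + 2) s - m * flat (m + 1) s)) (at s)"
proof -
  consider "s > 0" | "s < 0" | "s = 0" by linarith
  then show ?thesis
  proof cases
    case 1
    have "((\<lambda>s. inverse s ^ m * exp (- inverse s)) has_real_derivative
        (flat (m + 2) s - m * flat (m + 1) s)) (at s)"
    proof -
      have i: "(inverse has_real_derivative - (inverse s ^ 2)) (at s)"
        using 1 DERIV_inverse[of s UNIV] by (simp add: numeral_2_eq_2)
      have e: "((\<lambda>s. exp (- inverse s)) has_real_derivative exp (- inverse s) * inverse s ^ 2) (at s)"
        using DERIV_chain2[OF DERIV_exp DERIV_minus[OF i]] by simp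
      have "((\<lambda>s. inverse s ^ m * exp (- inverse s)) has_real_derivative
          (of_nat m * (- (inverse s ^ 2) * inverse s ^ (m - Suc 0)) * exp (- inverse s) +
          exp (- inverse s) * inverse s ^ 2 * inverse s ^ m)) (at s)"
        by (rule DERIV_mult[OF DERIV_power[OF i] e])
      moreover have "of_nat m * (- (inverse s ^ 2) * inverse s ^ (m - Suc 0)) * exp (- inverse s) +
          exp (- inverse s) * inverse s ^ 2 * inverse s ^ m
          = flat (m + 2) s - m * flat (m + 1) s"
        using 1 by (cases m) (auto simp: flat_def power2_eq_square)
      ultimately show ?thesis by simp
    qed
    then show ?thesis
      by (rule has_field_derivative_transform_within_open[of _ _ _ "{0<..}"])
         (use 1 in \<open>auto simp: flat_def\<close>)
  next
    case 2
    have "((\<lambda>_. 0) has_real_derivative (flat (m + 2) s - m * flat (m + 1) s)) (at s)"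
      using 2 by (simp add: flat_def)
    then show ?thesis
      by (rule has_field_derivative_transform_within_open[of _ _ _ "{..<0}"])
         (use 2 in \<open>auto simp: flat_def\<close>)
  next
    case 3
    have r: "((\<lambda>h. (flat m (0 + h) - flat m 0) / h) \<longlongrightarrow> 0) (at_right 0)"
    proof (rule Lim_transform_eventually[OF flat_tendsto_0[of "Suc m"]])
      show "\<forall>\<^sub>F s in at_right 0. inverse s ^ Suc m * exp (- inverse s) = (flat m (0 + s) - flat m 0) / s"
        by (auto simp: eventually_at_filter flat_def divide_inverse)
    qed
    have l: "((\<lambda>h. (flat m (0 + h) - flat m 0) / h) \<longlongrightarrow> 0) (at_left 0)"
      by (rule tendsto_eventually) (auto simp: eventually_at_filter flat_def)
    show ?thesis
      using filterlim_split_at_real[OF l r] 3 by (simp add: DERIV_def flat_def)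
  qed
qed

lemma Ck_on_flat: "Ck_on k (flat m) UNIV"
proof (induction k arbitrary: m)
  case 0
  have "isCont (flat m) s" for s using flat_has_derivative by (rule DERIV_isCont)
  then show ?case by (simp add: continuous_at_imp_continuous_on)
next
  case (Suc k)
  show ?case
  proof (rule Ck_on_SucI[where f' = "\<lambda>s v. v * (flat (m + 2) s - m * flat (m + 1) s)"])
    show "(flat m has_derivative (\<lambda>v. v * (flat (m + 2) s - m * flat (m + 1) s))) (at s)" for s
      using flat_has_derivative[of m s] by (simp add: has_field_derivative_def mult.commute[of _ "_ - _"])
  next
    show "Ck_on k (\<lambda>s. v * (flat (m + 2) s - m * flat (m + 1) s)) UNIV" for v
      by (intro Ck_on_cmult Ck_on_diff Suc open_UNIV)
  qed simp
qed

text \<open>Only basis directions are tested. There are finitely many iterated derivatives of this kind,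
  so a smooth function of bounded support has one common bound for all of them, and by linearity
  they control the derivatives in the other directions.\<close>
primrec derivs_le :: "nat \<Rightarrow> ('a::euclidean_space \<Rightarrow> real) \<Rightarrow> real \<Rightarrow> bool" where
  "derivs_le 0 f C \<longleftrightarrow> (\<forall>x. \<bar>f x\<bar> \<le> C)"
| "derivs_le (Suc k) f C \<longleftrightarrow> (\<forall>x. \<bar>f x\<bar> \<le> C) \<and>
     (\<forall>v\<in>Basis. derivs_le k (\<lambda>x. frechet_derivative f (at x) v) C)"

lemma derivs_le_bound: "derivs_le k f C \<Longrightarrow> \<bar>f x\<bar> \<le> C"
  by (cases k) auto

lemma derivs_le_mono: "derivs_le k f C \<Longrightarrow> C \<le> C' \<Longrightarrow> derivs_le k f C'"
proof (induction k arbitrary: f)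
  case 0
  then show ?case using order_trans[OF _ 0(2)] by simp
next
  case (Suc k)
  then show ?case using order_trans[OF _ Suc(3)] by simp
qed

lemma derivs_le_SucD: "derivs_le (Suc k) f C \<Longrightarrow> derivs_le k f C"
  by (induction k arbitrary: f) auto

lemma derivs_le_order_mono: "derivs_le k f C \<Longrightarrow> j \<le> k \<Longrightarrow> derivs_le j f C"
  by (induction k) (auto simp del: derivs_le.simps dest: derivs_le_SucD simp: le_Suc_eq)

lemma frechet_derivative_cmult:
  fixes f :: "'a::euclidean_space \<Rightarrow> real"
  assumes "f differentiable (at x)"
  shows "frechet_derivative (\<lambda>x. c * f x) (at x) v = c * frechet_derivative f (at x) v"
proof -
  have "((\<lambda>x. c * f x) has_derivative (\<lambda>v. c * frechet_derivative f (at x) v)) (at x)"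
    using assms by (auto intro: has_derivative_mult_right simp: frechet_derivative_works)
  from frechet_derivative_at[OF this] show ?thesis by metis
qed

lemma derivs_le_cmult:
  assumes "c \<ge> 0"
  shows "Ck_on k f UNIV \<Longrightarrow> derivs_le k f C \<Longrightarrow> derivs_le k (\<lambda>x. c * f x) (c * C)"
proof (induction k arbitrary: f)
  case 0
  then show ?case using assms by (auto simp: abs_mult intro: mult_left_mono)
next
  case (Suc k)
  then show ?case
    using assms by (auto simp: abs_mult frechet_derivative_cmult intro: mult_left_mono)
qed

lemma derivs_le_of_bounded_support:
  fixes f :: "'a::euclidean_space \<Rightarrow> real"
  shows "Ck_on k f UNIV \<Longrightarrow> (\<And>x. x \<notin> cball a r \<Longrightarrow> f x = 0) \<Longrightarrow> \<exists>C. derivs_le k f C"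
proof (induction k arbitrary: f)
  case 0
  have "bounded (f ` cball a r)"
    using compact_imp_bounded[OF compact_continuous_image[OF
        continuous_on_subset[OF Ck_on_imp_continuous_on[OF 0(1)] subset_UNIV] compact_cball]] .
  then obtain C0 where C0: "\<forall>x\<in>cball a r. \<bar>f x\<bar> \<le> C0"
    unfolding bounded_iff real_norm_def ball_simps(9) by blast
  have "\<bar>f x\<bar> \<le> max 0 C0" for x
  proof (cases "x \<in> cball a r")
    case True
    then show ?thesis using C0 by (simp add: le_max_iff_disj)
  qed (simp add: 0(2))
  then show ?case by auto
next
  case (Suc k)
  have "bounded (f ` cball a r)"
    using compact_imp_bounded[OF compact_continuous_image[OF
        continuous_on_subset[OF Ck_on_imp_continuous_on[OF Suc.prems(1)] subset_UNIV] compact_cball]] .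
  then obtain C0 where C0: "\<forall>x\<in>cball a r. \<bar>f x\<bar> \<le> C0"
    unfolding bounded_iff real_norm_def ball_simps(9) by blast
  have C0: "\<bar>f x\<bar> \<le> max 0 C0" for x
  proof (cases "x \<in> cball a r")
    case True
    then show ?thesis using C0 by (simp add: le_max_iff_disj)
  qed (simp add: Suc.prems(2))
  have "\<exists>C. derivs_le k (\<lambda>x. frechet_derivative f (at x) v) C" for v
  proof (rule Suc.IH)
    show "Ck_on k (\<lambda>x. frechet_derivative f (at x) v) UNIV" using Suc.prems(1) by simp
    fix x assume x: "x \<notin> cball a r"
    have "(f has_derivative (\<lambda>v. 0)) (at x)"
      by (rule has_derivative_transform_within_open[of "\<lambda>x. 0" _ _ UNIV "- cball a r"])
         (use x Suc.prems(2) in auto)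
    from frechet_derivative_at[OF this] show "frechet_derivative f (at x) v = 0" by metis
  qed
  then obtain C where C: "\<And>v. derivs_le k (\<lambda>x. frechet_derivative f (at x) v) (C v)" by metis
  define M where "M = Max (insert (max 0 C0) (C ` Basis))"
  have "max 0 C0 \<le> M" "\<And>v. v \<in> Basis \<Longrightarrow> C v \<le> M"
    unfolding M_def by (rule Max_ge; simp)+
  then have "derivs_le (Suc k) f M"
    using order_trans[OF C0] derivs_le_mono[OF C] by simp
  then show ?case ..
qed


text \<open>The Weierstrass test, applied to every order of differentiation: uniform convergence of the
  derivatives in the basis directions is uniform convergence of the derivatives as linear maps.\<close>

lemma Ck_on_suminf:
  fixes g :: "nat \<Rightarrow> 'a::euclidean_space \<Rightarrow> real"
  assumes "summable M"
  shows "(\<And>i. Ck_on k (g i) UNIV) \<Longrightarrow> (\<And>i. derivs_le k (g i) (M i)) \<Longrightarrow>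
    Ck_on k (\<lambda>x. \<Sum>i. g i x) UNIV"
proof (induction k arbitrary: g)
  case 0
  have "uniform_limit UNIV (\<lambda>n x. \<Sum>i<n. g i x) (\<lambda>x. \<Sum>i. g i x) sequentially"
    using 0 assms by (intro Weierstrass_m_test) auto
  then have "continuous_on UNIV (\<lambda>x. \<Sum>i. g i x)"
    by (rule uniform_limit_theorem[rotated])
       (use 0 in \<open>auto intro!: always_eventually continuous_on_sum\<close>)
  then show ?case by simp
next
  case (Suc k)
  let ?D = "\<lambda>i x v. frechet_derivative (g i) (at x) v"
  define G where "G b x = (\<Sum>i. ?D i x b)" for b x
  define g' where "g' x h = (\<Sum>b\<in>Basis. (h \<bullet> b) * G b x)" for x h
  have der: "(g i has_derivative ?D i x) (at x)" for i x
    using Suc.prems(1)[of i] by (simp add: frechet_derivative_works)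
  have G: "Ck_on k (G b) UNIV" if "b \<in> Basis" for b
    unfolding G_def
    by (rule Suc.IH) (use Suc.prems that in auto)
  have ul: "uniform_limit UNIV (\<lambda>n x. \<Sum>i<n. ?D i x b) (G b) sequentially" if b: "b \<in> Basis" for b
    unfolding G_def[abs_def]
  proof (rule Weierstrass_m_test[OF _ assms])
    fix i x
    have "derivs_le k (\<lambda>x. ?D i x b) (M i)" using Suc.prems(2)[of i] b by simp
    from derivs_le_bound[OF this] show "norm (?D i x b) \<le> M i" by simp
  qed
  have exp: "?D i x h = (\<Sum>b\<in>Basis. (h \<bullet> b) * ?D i x b)" for i x h
  proof -
    have l: "linear (?D i x)" using der has_derivative_linear by blast
    have "?D i x h = ?D i x (\<Sum>b\<in>Basis. (h \<bullet> b) *\<^sub>R b)" by (simp add: euclidean_representation)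
    also have "\<dots> = (\<Sum>b\<in>Basis. (h \<bullet> b) * ?D i x b)"
      by (simp add: linear_sum[OF l] linear_scale[OF l])
    finally show ?thesis .
  qed
  have ev: "\<forall>\<^sub>F n in sequentially. \<forall>x\<in>UNIV. \<forall>h. norm ((\<Sum>i<n. ?D i x h) - g' x h) \<le> e * norm h"
    if e: "e > 0" for e
  proof -
    define d where "d = e / DIM('a)"
    have d: "d > 0" using e by (simp add: d_def)
    have "\<forall>\<^sub>F n in sequentially. \<forall>b\<in>Basis. \<forall>x. \<bar>(\<Sum>i<n. ?D i x b) - G b x\<bar> < d"
      using uniform_limitD[OF ul d] by (auto simp: eventually_ball_finite_distrib dist_real_def)
    then show ?thesis
    proof eventually_elim
      case (elim n)
      have "norm ((\<Sum>i<n. ?D i x h) - g' x h) \<le> e * norm h" for x h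
      proof -
        have "(\<Sum>i<n. ?D i x h) = (\<Sum>i<n. \<Sum>b\<in>Basis. (h \<bullet> b) * ?D i x b)"
          by (rule sum.cong[OF refl]) (rule exp)
        also have "\<dots> = (\<Sum>b\<in>Basis. (h \<bullet> b) * (\<Sum>i<n. ?D i x b))"
          by (subst sum.swap) (simp add: sum_distrib_left)
        finally have "(\<Sum>i<n. ?D i x h) - g' x h = (\<Sum>b\<in>Basis. (h \<bullet> b) * ((\<Sum>i<n. ?D i x b) - G b x))"
          by (simp add: g'_def sum_subtractf right_diff_distrib)
        also have "norm \<dots> \<le> (\<Sum>b\<in>(Basis::'a set). norm h * d)"
        proof (rule sum_norm_le)
          fix b :: 'a assume b: "b \<in> Basis"
          show "norm ((h \<bullet> b) * ((\<Sum>i<n. ?D i x b) - G b x)) \<le> norm h * d"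
            unfolding norm_mult using elim b
            by (intro mult_mono) (auto simp: Basis_le_norm intro: less_imp_le)
        qed
        also have "\<dots> = e * norm h" by (simp add: d_def)
        finally show ?thesis .
      qed
      then show ?case by blast
    qed
  qed
  have sm: "summable (\<lambda>i. g i x)" for x
    using assms by (rule summable_comparison_test') (use derivs_le_bound[OF Suc.prems(2)] in auto)
  have "\<exists>s. \<forall>x\<in>UNIV. (\<lambda>i. g i x) sums s x \<and> (s has_derivative g' x) (at x within UNIV)"
    by (rule has_derivative_series[where f = g and f' = ?D and x = 0, OF convex_UNIV _ ev _ summable_sums[OF sm]])
       (use der in auto)
  then obtain s where s: "\<And>x. (\<lambda>i. g i x) sums s x" "\<And>x. (s has_derivative g' x) (at x)" by auto
  have "(\<lambda>x. \<Sum>i. g i x) = s"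
    by (rule ext, rule sums_unique[OF s(1), symmetric])
  then have "((\<lambda>x. \<Sum>i. g i x) has_derivative g' x) (at x)" for x using s(2) by simp
  then show ?case
    by (rule Ck_on_SucI[OF open_UNIV])
       (use G in \<open>auto simp: g'_def intro!: Ck_on_sum Ck_on_cmult\<close>)
qed

lemma smooth_bump_on_ball:
  fixes a :: "'a::euclidean_space"
  assumes "r > 0"
  obtains f :: "'a \<Rightarrow> real" where "smooth_on f UNIV" "\<And>x. f x \<ge> 0" "\<And>x. f x > 0 \<longleftrightarrow> x \<in> ball a r"
proof
  let ?q = "\<lambda>x. r\<^sup>2 - (x - a) \<bullet> (x - a)"
  let ?f = "\<lambda>x. flat 0 (?q x)"
  have "Ck_on k ?q UNIV" for k
  proof -
    have "Ck_on k (\<lambda>x. r\<^sup>2 - (\<Sum>b\<in>Basis. (x \<bullet> b - a \<bullet> b) * (x \<bullet> b - a \<bullet> b))) UNIV"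
      by (intro Ck_on_diff Ck_on_sum Ck_on_mult Ck_on_const Ck_on_bounded_linear open_UNIV bounded_linear_inner_left)
    moreover have "(x - a) \<bullet> (x - a) = (\<Sum>b\<in>Basis. (x \<bullet> b - a \<bullet> b) * (x \<bullet> b - a \<bullet> b))" for x
      by (subst euclidean_inner) (simp only: inner_diff_left)
    ultimately show ?thesis by simp
  qed
  then show "smooth_on ?f UNIV"
    unfolding smooth_on_def using Ck_on_compose_real[OF open_UNIV subset_UNIV Ck_on_flat] by blast
  show "?f x \<ge> 0" for x by (simp add: flat_def)
  have "(x - a) \<bullet> (x - a) < r\<^sup>2 \<longleftrightarrow> x \<in> ball a r" for x
    unfolding mem_ball dist_commute[of a x] dist_norm norm_lt_square
    using assms by (simp add: inner_diff_left inner_diff_right inner_commute add.commute)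
  then show "?f x > 0 \<longleftrightarrow> x \<in> ball a r" for x
    by (simp add: flat_def)
qed

text \<open>A theorem of Whitney: an open set is a countable union of balls, and the sum of bump
  functions on these balls is smooth once the \<open>i\<close>-th summand is scaled so that its derivatives up
  to order \<open>i\<close> are at most \<open>2\<^sup>-\<^sup>i\<close>.\<close>

lemma smooth_positive_exactly_on_open:
  fixes U :: "'a::euclidean_space set"
  assumes "open U"
  obtains h :: "'a \<Rightarrow> real" where "smooth_on h UNIV" "\<And>x. h x \<ge> 0" "\<And>x. h x > 0 \<longleftrightarrow> x \<in> U"
proof -
  \<comment> \<open>The empty set is included so that a countable subcover can be enumerated even if \<open>U\<close> is empty.\<close>
  define \<B> where "\<B> = {B. B \<subseteq> U \<and> (\<exists>a r. r > 0 \<and> B = ball a r)} \<union> {{}}"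
  have op: "open B" if "B \<in> \<B>" for B using that by (auto simp: \<B>_def)
  obtain \<C> where C: "\<C> \<subseteq> \<B>" "countable \<C>" "\<Union>\<C> = \<Union>\<B>"
    using Lindelof[of \<B>] op by blast
  have UB: "\<Union>\<B> = U"
  proof
    show "U \<subseteq> \<Union>\<B>"
    proof
      fix x assume "x \<in> U"
      then obtain e where "e > 0" "ball x e \<subseteq> U" using assms open_contains_ball by blast
      then have "ball x e \<in> \<B>" "x \<in> ball x e" by (auto simp: \<B>_def)
      then show "x \<in> \<Union>\<B>" by blast
    qed
  qed (auto simp: \<B>_def)
  define B where "B = from_nat_into (insert {} \<C>)"
  have rB: "range B = insert {} \<C>"
    unfolding B_def using C(2) by (intro range_from_nat_into) auto
  then have BB: "B i \<in> \<B>" for i using C(1) rangeI[of B i] by (auto simp: \<B>_def)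
  have BU: "(\<Union>i. B i) = U" using rB C(3) UB by simp
  have "\<exists>f a r. smooth_on f UNIV \<and> (\<forall>x. f x \<ge> (0::real)) \<and> (\<forall>x. f x > 0 \<longleftrightarrow> x \<in> B i) \<and> B i \<subseteq> cball a r" for i
  proof (cases "B i = {}")
    case True
    then show ?thesis
      by (intro exI[of _ "\<lambda>x. 0"] exI[of _ 0]) (simp add: smooth_on_def Ck_on_const)
  next
    case False
    then obtain a r where r: "r > 0" "B i = ball a r" using BB[of i] by (auto simp: \<B>_def)
    from smooth_bump_on_ball[OF r(1), of a] show ?thesis
      unfolding r(2) using ball_subset_cball by metis
  qed
  then obtain f a r where f: "\<And>i. smooth_on (f i) UNIV" "\<And>i x. f i x \<ge> (0::real)"
    "\<And>i x. f i x > 0 \<longleftrightarrow> x \<in> B i" "\<And>i. B i \<subseteq> cball (a i) (r i)" by metis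
  have f0: "f i x = 0" if "x \<notin> cball (a i) (r i)" for i x
    using f(2,3)[of i x] f(4)[of i] that by force
  have fk: "Ck_on k (f i) UNIV" for i k using f(1) by (simp add: smooth_on_def)
  have bd: "\<exists>C. derivs_le k (f i) C" for i k
    using derivs_le_of_bounded_support[OF fk f0] .
  then obtain C where Ci: "\<And>i. derivs_le i (f i) (C i)"
    using choice[of "\<lambda>i C. derivs_le i (f i) C"] by blast
  have C0: "C i \<ge> 0" for i using derivs_le_bound[OF Ci[of i], of 0] by linarith
  define c where "c i = (1/2) ^ i / (1 + C i)" for i
  have c: "c i > 0" "c i * C i \<le> (1/2) ^ i" for i
  proof -
    show "c i > 0" using C0[of i] by (simp add: c_def)
    have "c i * C i = (1/2) ^ i * (C i / (1 + C i))" by (simp add: c_def)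
    also have "\<dots> \<le> (1/2) ^ i * 1" using C0[of i] by (intro mult_left_mono) auto
    finally show "c i * C i \<le> (1/2) ^ i" by simp
  qed
  define h where "h x = (\<Sum>i. c i * f i x)" for x
  have ck: "Ck_on k (\<lambda>x. c i * f i x) UNIV" for i k by (intro Ck_on_cmult fk open_UNIV)
  have di: "derivs_le k (\<lambda>x. c i * f i x) ((1/2)^i)" if "k \<le> i" for i k
    using derivs_le_order_mono[OF derivs_le_mono[OF derivs_le_cmult[OF less_imp_le[OF c(1)] fk Ci] c(2)] that] .
  have "Ck_on k h UNIV" for k
  proof -
    have "\<exists>M. derivs_le k (\<lambda>x. c i * f i x) M" for i
      using derivs_le_cmult[OF less_imp_le[OF c(1)] fk] bd by blast
    then obtain M where M: "\<And>i. derivs_le k (\<lambda>x. c i * f i x) (M i)"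
      using choice[of "\<lambda>i M. derivs_le k (\<lambda>x. c i * f i x) M"] by blast
    define M' where "M' i = (if k \<le> i then (1/2)^i else M i)" for i
    have "summable M'"
    proof (subst summable_cong)
      show "\<forall>\<^sub>F i in sequentially. M' i = (1/2)^i"
        using eventually_ge_at_top[of k] by eventually_elim (simp add: M'_def)
    qed (simp add: summable_geometric)
    moreover have "derivs_le k (\<lambda>x. c i * f i x) (M' i)" for i
      using di M by (simp add: M'_def)
    ultimately have "Ck_on k (\<lambda>x. \<Sum>i. c i * f i x) UNIV" by (intro Ck_on_suminf ck)
    moreover have "h = (\<lambda>x. \<Sum>i. c i * f i x)" by (rule ext) (rule h_def)
    ultimately show ?thesis by simp
  qed
  then have "smooth_on h UNIV" by (simp add: smooth_on_def)
  moreover have sm: "summable (\<lambda>i. c i * f i x)" for x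
  proof (rule summable_comparison_test'[OF summable_geometric[of "1/2::real"]])
    show "norm (c i * f i x) \<le> (1/2)^i" for i using derivs_le_bound[OF di[of 0 i]] by simp
  qed simp
  moreover have nn: "c i * f i x \<ge> 0" for i x using c(1)[of i] f(2) by simp
  then have "h x \<ge> 0" for x unfolding h_def by (intro suminf_nonneg sm)
  moreover have "h x > 0 \<longleftrightarrow> x \<in> U" for x
  proof -
    have "0 < c i * f i x \<longleftrightarrow> x \<in> B i" for i
      using c(1)[of i] f(3)[of i x] by (metis mult_pos_pos zero_less_mult_pos)
    then show ?thesis
      unfolding h_def suminf_pos_iff[OF sm nn] using BU by auto
  qed
  ultimately show thesis using that by blast
qed


text \<open>Normalising by \<open>s + \<phi>\<close> gives a function with values in \<open>[0,1]\<close> that equals \<open>1\<close> exactly where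
  \<open>\<phi>\<close> vanishes; subtracting \<open>z\<close> makes the sum negative exactly off \<open>A\<close>.\<close>

lemma smooth_function_with_two_superlevel_sets:
  fixes S A B U :: "'a::euclidean_space set"
  assumes "open S" "open (S - A)" "open (S - B)" "open U" "S \<inter> B \<subseteq> U" "S \<inter> U \<subseteq> A"
  shows "\<exists>k :: 'a \<Rightarrow> real. smooth_on k S \<and>
    (\<forall>x\<in>S. 0 \<le> k x \<longleftrightarrow> x \<in> A) \<and> (\<forall>x\<in>S. 1 \<le> k x \<longleftrightarrow> x \<in> B)"
proof -
  obtain s :: "'a \<Rightarrow> real" where s: "smooth_on s UNIV" "\<And>x. s x \<ge> 0" "\<And>x. s x > 0 \<longleftrightarrow> x \<in> U"
    using smooth_positive_exactly_on_open[OF assms(4)] by blast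
  obtain \<phi> :: "'a \<Rightarrow> real" where \<phi>: "smooth_on \<phi> UNIV" "\<And>x. \<phi> x \<ge> 0" "\<And>x. \<phi> x > 0 \<longleftrightarrow> x \<in> S - B"
    using smooth_positive_exactly_on_open[OF assms(3)] by blast
  obtain z :: "'a \<Rightarrow> real" where z: "smooth_on z UNIV" "\<And>x. z x \<ge> 0" "\<And>x. z x > 0 \<longleftrightarrow> x \<in> S - A"
    using smooth_positive_exactly_on_open[OF assms(2)] by blast
  have pos: "s x + \<phi> x > 0" if "x \<in> S" for x
  proof (cases "x \<in> B")
    case True
    then have "s x > 0" using s(3) assms(5) that by blast
    then show ?thesis using \<phi>(2)[of x] by linarith
  next
    case False
    then have "\<phi> x > 0" using \<phi>(3) that by blast
    then show ?thesis using s(2)[of x] by linarith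
  qed
  define k where "k x = s x * inverse (s x + \<phi> x) - z x" for x
  have cS: "Ck_on n s S" "Ck_on n \<phi> S" "Ck_on n z S" for n
    using s(1) \<phi>(1) z(1) by (auto simp: smooth_on_def intro: Ck_on_subset[OF _ subset_UNIV])
  have "Ck_on n (\<lambda>x. inverse (s x + \<phi> x)) S" for n
    by (rule Ck_on_compose_real[OF assms(1) _ Ck_on_inverse Ck_on_add[OF assms(1) cS(1,2)]])
       (use pos in auto)
  then have "Ck_on n k S" for n
    unfolding k_def[abs_def] by (intro Ck_on_diff Ck_on_mult assms(1) cS)
  then have "smooth_on k S" by (simp add: smooth_on_def)
  moreover have "0 \<le> k x \<longleftrightarrow> x \<in> A" if x: "x \<in> S" for x
  proof (cases "x \<in> A")
    case True
    then have "z x = 0" using z(2,3)[of x] by auto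
    then have "0 \<le> k x" using s(2)[of x] pos[OF x] by (simp add: k_def)
    then show ?thesis using True by simp
  next
    case False
    then have "z x > 0" using z(3) x by blast
    moreover have "s x = 0" using s(2,3)[of x] False assms(6) x by force
    ultimately have "k x < 0" by (simp add: k_def)
    then show ?thesis using False by simp
  qed
  moreover have "1 \<le> k x \<longleftrightarrow> x \<in> B" if x: "x \<in> S" for x
  proof (cases "x \<in> B")
    case True
    then have "\<phi> x = 0" using \<phi>(2,3)[of x] by auto
    moreover have "z x = 0" using z(2,3)[of x] True assms(5,6) x by force
    ultimately have "k x = 1" using pos[OF x] by (simp add: k_def)
    then show ?thesis using True by simp
  next
    case False
    then have "\<phi> x > 0" using \<phi>(3) x by blast
    then have "s x * inverse (s x + \<phi> x) < 1"
      using pos[OF x] by (simp flip: divide_inverse)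
    then have "k x < 1" using z(2)[of x] unfolding k_def by linarith
    then show ?thesis using False by simp
  qed
  ultimately show ?thesis by blast
qed

section \<open>Differential inequalities\<close>

text \<open>At a first zero a function that was positive before cannot have a positive derivative. All
  comparison arguments below have this form, with a function \<open>\<phi>\<close> whose derivative has to be computed
  only at points where it vanishes; there the norms involved are nonzero, hence differentiable.\<close>

lemma positive_until_first_zero:
  fixes \<phi> :: "real \<Rightarrow> real"
  assumes cont: "continuous_on {0..T} \<phi>" and init: "\<phi> 0 > 0"
    and barrier: "\<And>t. \<lbrakk>0 < t; t \<le> T; \<phi> t = 0; \<And>s. 0 \<le> s \<Longrightarrow> s < t \<Longrightarrow> \<phi> s > 0\<rbrakk>
      \<Longrightarrow> \<exists>D>0. (\<phi> has_real_derivative D) (at t)"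
    and t: "0 \<le> t" "t \<le> T"
  shows "\<phi> t > 0"
proof (rule ccontr)
  assume "\<not> \<phi> t > 0"
  define Z where "Z = {s\<in>{0..T}. \<phi> s \<le> 0}"
  have "t \<in> Z" using t \<open>\<not> \<phi> t > 0\<close> by (simp add: Z_def)
  have "closed Z"
    unfolding Z_def using continuous_on_closed_Collect_le[OF cont continuous_on_const] by simp
  have bdd: "bdd_below Z" by (auto simp: Z_def bdd_below_def)
  define u where "u = Inf Z"
  have "u \<in> Z" unfolding u_def
    using closed_contains_Inf[OF _ bdd \<open>closed Z\<close>] \<open>t \<in> Z\<close> by blast
  have before: "\<phi> s > 0" if "0 \<le> s" "s < u" for s
  proof (rule ccontr)
    assume "\<not> \<phi> s > 0"
    then have "s \<in> Z" using that \<open>u \<in> Z\<close> by (simp add: Z_def)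
    then show False using cInf_lower[OF _ bdd] that unfolding u_def by fastforce
  qed
  have u: "0 < u" "u \<le> T"
    using \<open>u \<in> Z\<close> init by (auto simp: Z_def less_le)
  have "\<phi> u = 0"
  proof (rule ccontr)
    assume "\<phi> u \<noteq> 0"
    then have "\<phi> u < 0" using \<open>u \<in> Z\<close> by (simp add: Z_def)
    have "continuous_on {0..u} \<phi>" using cont u(2) by (auto intro: continuous_on_subset)
    then obtain s where "0 \<le> s" "s \<le> u" "\<phi> s = 0"
      using IVT2'[of \<phi> u 0 0] \<open>\<phi> u < 0\<close> init u(1) by auto
    then show False using before[of s] \<open>\<phi> u \<noteq> 0\<close> by (cases "s = u") auto
  qed
  obtain D where D: "D > 0" "(\<phi> has_real_derivative D) (at u)"
    using barrier[OF u \<open>\<phi> u = 0\<close> before] by blast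
  obtain d where d: "d > 0" "\<And>h. 0 < h \<Longrightarrow> h < d \<Longrightarrow> \<phi> (u - h) < \<phi> u"
    using DERIV_pos_inc_left[OF D(2,1)] by blast
  define h where "h = min (d / 2) u"
  have "\<phi> (u - h) < 0" using d u \<open>\<phi> u = 0\<close> by (simp add: h_def min_def)
  moreover have "\<phi> (u - h) > 0" using before[of "u - h"] d(1) u by (simp add: h_def)
  ultimately show False by simp
qed

lemma norm_has_real_derivative:
  fixes e :: "real \<Rightarrow> 'a::real_inner"
  assumes "(e has_vector_derivative e') (at t)" "e t \<noteq> 0"
  shows "((\<lambda>s. norm (e s)) has_real_derivative (e' \<bullet> e t / norm (e t))) (at t)"
proof -
  have "((\<lambda>s. norm (e s)) has_derivative (\<lambda>h. (h *\<^sub>R e') \<bullet> sgn (e t))) (at t)"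
    using has_derivative_compose[OF assms(1)[unfolded has_vector_derivative_def] has_derivative_norm[OF assms(2)]]
    by simp
  moreover have "(\<lambda>h. (h *\<^sub>R e') \<bullet> sgn (e t)) = (*) (e' \<bullet> e t / norm (e t))"
    by (rule ext) (simp add: sgn_div_norm divide_inverse mult_ac)
  ultimately show ?thesis by (simp add: has_field_derivative_def)
qed

text \<open>The differential inequality is needed only as long as the solution stays below \<open>B\<close>; this is
  what makes the estimate applicable to vector fields that are only locally Lipschitz.\<close>

lemma gronwall_local:
  fixes e e' :: "real \<Rightarrow> 'a::real_inner"
  assumes cont: "continuous_on {0..T} e"
    and der: "\<And>t. 0 < t \<Longrightarrow> t \<le> T \<Longrightarrow> (e has_vector_derivative e' t) (at t)"
    and ineq: "\<And>t. 0 < t \<Longrightarrow> t \<le> T \<Longrightarrow> norm (e t) \<le> B \<Longrightarrow> norm (e' t) \<le> L * norm (e t) + \<kappa>"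
    and L: "L \<ge> 0" and init: "norm (e 0) < c" and \<kappa>: "\<kappa> \<le> c" and B: "c * exp ((L + 2) * T) \<le> B"
    and t: "0 \<le> t" "t \<le> T"
  shows "norm (e t) < c * exp ((L + 2) * t)"
proof -
  define \<phi> where "\<phi> s = c * exp ((L + 2) * s) - norm (e s)" for s
  have c: "c > 0" using init norm_ge_zero[of "e 0"] by linarith
  have "\<phi> t > 0"
  proof (rule positive_until_first_zero[where \<phi> = \<phi> and T = T])
    show "continuous_on {0..T} \<phi>" unfolding \<phi>_def using cont by (intro continuous_intros)
    show "\<phi> 0 > 0" using init by (simp add: \<phi>_def)
    fix s assume s: "0 < s" "s \<le> T" "\<phi> s = 0"
    then have ne: "norm (e s) = c * exp ((L + 2) * s)" by (simp add: \<phi>_def)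
    then have ge: "norm (e s) \<ge> c"
      using c L s by (simp add: mult_le_cancel_left1)
    have "norm (e s) \<le> c * exp ((L + 2) * T)"
      unfolding ne using c L s by (intro mult_left_mono) (auto intro: mult_left_mono)
    then have le: "norm (e' s) \<le> L * norm (e s) + \<kappa>" using ineq s B by simp
    have e0: "e s \<noteq> 0" using ge c by auto
    have "((\<lambda>s. norm (e s)) has_real_derivative (e' s \<bullet> e s / norm (e s))) (at s)"
      using norm_has_real_derivative[OF der e0] s by simp
    then have D: "(\<phi> has_real_derivative (c * ((L + 2) * exp ((L + 2) * s)) - e' s \<bullet> e s / norm (e s))) (at s)"
      unfolding \<phi>_def by (auto intro!: derivative_eq_intros)
    have "e' s \<bullet> e s / norm (e s) \<le> norm (e' s)"
      using norm_cauchy_schwarz[of "e' s" "e s"] e0 by (simp add: divide_le_eq)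
    \<comment> \<open>One unit of the exponent \<open>L + 2\<close> absorbs \<open>\<kappa>\<close>, the other makes the inequality strict.\<close>
    also have "\<dots> \<le> (L + 1) * norm (e s)" using le ge \<kappa> by (simp add: algebra_simps)
    also have "\<dots> < (L + 2) * norm (e s)" using e0 by (intro mult_strict_right_mono) auto
    finally have "c * ((L + 2) * exp ((L + 2) * s)) - e' s \<bullet> e s / norm (e s) > 0"
      unfolding ne by (simp add: mult_ac)
    then show "\<exists>D>0. (\<phi> has_real_derivative D) (at s)" using D by blast
  qed (use t in auto)
  then show ?thesis by (simp add: \<phi>_def)
qed

lemma gronwall:
  fixes e e' :: "real \<Rightarrow> 'a::real_inner"
  assumes cont: "continuous_on {0..T} e"
    and der: "\<And>t. 0 < t \<Longrightarrow> t \<le> T \<Longrightarrow> (e has_vector_derivative e' t) (at t)"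
    and ineq: "\<And>t. 0 < t \<Longrightarrow> t \<le> T \<Longrightarrow> norm (e' t) \<le> L * norm (e t) + \<kappa>"
    and L: "L \<ge> 0" and \<kappa>: "\<kappa> \<ge> 0" and t: "0 \<le> t" "t \<le> T"
  shows "norm (e t) \<le> (norm (e 0) + \<kappa>) * exp ((L + 2) * t)"
proof (rule field_le_epsilon)
  fix \<epsilon> :: real assume "\<epsilon> > 0"
  define c where "c = norm (e 0) + \<kappa> + \<epsilon> / exp ((L + 2) * t)"
  have "norm (e t) < c * exp ((L + 2) * t)"
    by (rule gronwall_local[where T = T and \<kappa> = \<kappa> and B = "c * exp ((L + 2) * T)" and e' = e'])
       (use assms \<open>\<epsilon> > 0\<close> in \<open>auto simp: c_def add_nonneg_pos\<close>)
  also have "\<dots> = (norm (e 0) + \<kappa>) * exp ((L + 2) * t) + \<epsilon>"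
    by (simp add: c_def ring_distribs)
  finally show "norm (e t) \<le> (norm (e 0) + \<kappa>) * exp ((L + 2) * t) + \<epsilon>" by simp
qed


section \<open>Differentiability of the flow\<close>

locale C1_flow =
  fixes f :: "'a::euclidean_space \<Rightarrow> 'a" and F :: "'a \<Rightarrow> 'a \<Rightarrow>\<^sub>L 'a" and \<psi> :: "real \<Rightarrow> 'a \<Rightarrow> 'a"
  assumes f_deriv: "(f has_derivative blinfun_apply (F x)) (at x)"
    and F_cont: "continuous_on UNIV F"
    and flow_0: "\<psi> 0 x = x"
    and flow_ode: "((\<lambda>s. \<psi> s x) has_vector_derivative f (\<psi> t x)) (at t)"
begin

lemma F_bounded_on_cball: obtains L where "L \<ge> 0" "\<And>x. norm x \<le> R \<Longrightarrow> norm (F x) \<le> L"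
proof -
  have "bounded (F ` cball 0 R)"
    using compact_imp_bounded[OF compact_continuous_image[OF continuous_on_subset[OF F_cont subset_UNIV] compact_cball]] .
  then obtain L where "\<forall>x\<in>cball 0 R. norm (F x) \<le> L"
    unfolding bounded_iff ball_simps(9) by blast
  then show thesis using that[of "max 0 L"] by (simp add: le_max_iff_disj)
qed

lemma f_lipschitz_on_cball:
  assumes L: "\<And>x. norm x \<le> R \<Longrightarrow> norm (F x) \<le> L" and "norm x \<le> R" "norm y \<le> R"
  shows "norm (f x - f y) \<le> L * norm (x - y)"
proof (rule differentiable_bound[of "cball 0 R" f "\<lambda>x. blinfun_apply (F x)"])
  show "(f has_derivative blinfun_apply (F z)) (at z within cball 0 R)" for z
    using f_deriv has_derivative_at_withinI by blast
  show "onorm (blinfun_apply (F z)) \<le> L" if "z \<in> cball 0 R" for z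
    using L[of z] that by (simp add: norm_blinfun.rep_eq)
qed (use assms in auto)

lemma f_linearization_on_cball:
  assumes "\<epsilon> > 0"
  obtains \<eta> where "\<eta> > 0"
    "\<And>p d. norm p \<le> R \<Longrightarrow> norm d < \<eta> \<Longrightarrow> norm (f (p + d) - f p - F p d) \<le> \<epsilon> * norm d"
proof -
  have "uniformly_continuous_on (cball 0 (R + 1)) F"
    by (intro compact_uniformly_continuous continuous_on_subset[OF F_cont]) auto
  then obtain \<eta> where \<eta>: "\<eta> > 0"
    "\<And>x y. x \<in> cball 0 (R + 1) \<Longrightarrow> y \<in> cball 0 (R + 1) \<Longrightarrow> dist y x < \<eta> \<Longrightarrow> dist (F y) (F x) < \<epsilon>"
    using assms unfolding uniformly_continuous_on_def by metis
  have "norm (f (p + d) - f p - F p d) \<le> \<epsilon> * norm d" if p: "norm p \<le> R" and d: "norm d < min \<eta> 1" for p d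
  proof -
    let ?g = "\<lambda>d. f (p + d) - F p d"
    have "norm (?g d - ?g 0) \<le> \<epsilon> * norm (d - 0)"
    proof (rule differentiable_bound[of "ball 0 (min \<eta> 1)" ?g "\<lambda>d. blinfun_apply (F (p + d) - F p)"])
      fix z :: 'a assume z: "z \<in> ball 0 (min \<eta> 1)"
      have "((\<lambda>d. f (p + d)) has_derivative blinfun_apply (F (p + z))) (at z within ball 0 (min \<eta> 1))"
        using has_derivative_compose[of "\<lambda>d. p + d" "\<lambda>h. h" z "ball 0 (min \<eta> 1)" f, OF _ f_deriv]
        by (simp add: has_derivative_add_const has_derivative_ident has_derivative_const
            has_derivative_eq_rhs[OF has_derivative_add[OF has_derivative_const has_derivative_ident]])
      then show "(?g has_derivative blinfun_apply (F (p + z) - F p)) (at z within ball 0 (min \<eta> 1))"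
        by (auto intro!: derivative_eq_intros simp: blinfun.diff_left)
      have "norm (p + z) \<le> R + 1" using norm_triangle_ineq[of p z] p z by auto
      then have "dist (F (p + z)) (F p) < \<epsilon>" using \<eta>(2)[of p "p + z", unfolded mem_cball_0] p z
        by (simp add: dist_norm)
      then show "onorm (blinfun_apply (F (p + z) - F p)) \<le> \<epsilon>"
        by (simp add: dist_norm flip: norm_blinfun.rep_eq)
    qed (use d \<eta>(1) in auto)
    then show ?thesis by (simp add: algebra_simps)
  qed
  then show thesis using that[of "min \<eta> 1"] \<eta>(1) by simp
qed

lemma flow_continuous_time: "continuous_on S (\<lambda>t. \<psi> t x)"
  using flow_ode by (auto intro!: continuous_at_imp_continuous_on has_vector_derivative_continuous)

lemma orbit_bounded: obtains R where "\<And>t. 0 \<le> t \<Longrightarrow> t \<le> T \<Longrightarrow> norm (\<psi> t x) \<le> R"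
proof -
  have "bounded ((\<lambda>t. \<psi> t x) ` {0..T})"
    using compact_imp_bounded[OF compact_continuous_image[OF flow_continuous_time compact_Icc]] .
  then obtain R where "\<forall>t\<in>{0..T}. norm (\<psi> t x) \<le> R"
    unfolding bounded_iff ball_simps(9) by blast
  then show thesis using that[of R] by simp
qed

text \<open>The vector field is Lipschitz on the unit neighbourhood of a compact piece of orbit. Nearby
  solutions do not leave this tube as long as their Gronwall bound stays below \<open>1\<close>.\<close>

lemma flow_locally_lipschitz:
  obtains \<delta> C where "\<delta> > 0" "C > 0"
    "\<And>y t. norm (y - x) < \<delta> \<Longrightarrow> 0 \<le> t \<Longrightarrow> t \<le> T \<Longrightarrow> norm (\<psi> t y - \<psi> t x) \<le> C * norm (y - x)"
    "\<And>y t. norm (y - x) < \<delta> \<Longrightarrow> 0 \<le> t \<Longrightarrow> t \<le> T \<Longrightarrow> norm (\<psi> t y - \<psi> t x) \<le> 1"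
proof -
  obtain R where R: "\<And>t. 0 \<le> t \<Longrightarrow> t \<le> T \<Longrightarrow> norm (\<psi> t x) \<le> R" using orbit_bounded by blast
  obtain L where L: "L \<ge> 0" "\<And>x. norm x \<le> R + 1 \<Longrightarrow> norm (F x) \<le> L" using F_bounded_on_cball by blast
  define C where "C = 2 * exp ((L + 2) * T)"
  have C: "C > 0" by (simp add: C_def)
  have main: "norm (\<psi> t y - \<psi> t x) \<le> C * norm (y - x) \<and> norm (\<psi> t y - \<psi> t x) \<le> 1"
    if y: "norm (y - x) < 1 / C" and t: "0 \<le> t" "t \<le> T" for y t
  proof (cases "y = x")
    case False
    have le1: "C * norm (y - x) \<le> 1" using y C by (simp add: field_simps)
    have "norm (\<psi> t y - \<psi> t x) < (2 * norm (y - x)) * exp ((L + 2) * t)"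
    proof (rule gronwall_local[where T = T and B = 1 and \<kappa> = 0 and e' = "\<lambda>t. f (\<psi> t y) - f (\<psi> t x)"])
      show "norm (f (\<psi> s y) - f (\<psi> s x)) \<le> L * norm (\<psi> s y - \<psi> s x) + 0"
        if "0 < s" "s \<le> T" "norm (\<psi> s y - \<psi> s x) \<le> 1" for s
      proof -
        have "norm (\<psi> s x) \<le> R" using R that by simp
        moreover have "norm (\<psi> s y) \<le> R + 1"
          using norm_triangle_sub[of "\<psi> s y" "\<psi> s x"] that(3) \<open>norm (\<psi> s x) \<le> R\<close> by linarith
        ultimately show ?thesis using f_lipschitz_on_cball[OF L(2)] by simp
      qed
      show "continuous_on {0..T} (\<lambda>t. \<psi> t y - \<psi> t x)"
        by (intro continuous_on_diff flow_continuous_time)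
      show "((\<lambda>t. \<psi> t y - \<psi> t x) has_vector_derivative f (\<psi> s y) - f (\<psi> s x)) (at s)" for s
        by (intro has_vector_derivative_diff flow_ode)
    qed (use t L False le1 in \<open>auto simp: flow_0 C_def mult_ac\<close>)
    also have "\<dots> \<le> (2 * norm (y - x)) * exp ((L + 2) * T)"
      using t L by (intro mult_left_mono) (auto intro: mult_left_mono)
    also have "\<dots> = C * norm (y - x)" by (simp add: C_def)
    finally show ?thesis using le1 by simp
  qed (use C in simp)
  show thesis by (rule that[of "1 / C" C]) (use main C in auto)
qed

lemma flow_semigroup:
  assumes "0 \<le> t" "0 \<le> s"
  shows "\<psi> (t + s) x = \<psi> t (\<psi> s x)"
proof -
  obtain R1 where R1: "\<And>r. 0 \<le> r \<Longrightarrow> r \<le> t + s \<Longrightarrow> norm (\<psi> r x) \<le> R1" using orbit_bounded by blast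
  obtain R2 where R2: "\<And>r. 0 \<le> r \<Longrightarrow> r \<le> t \<Longrightarrow> norm (\<psi> r (\<psi> s x)) \<le> R2" using orbit_bounded by blast
  obtain L where L: "L \<ge> 0" "\<And>x. norm x \<le> max R1 R2 \<Longrightarrow> norm (F x) \<le> L" using F_bounded_on_cball by blast
  let ?e = "\<lambda>r. \<psi> (r + s) x - \<psi> r (\<psi> s x)"
  have "norm (?e t) \<le> (norm (?e 0) + 0) * exp ((L + 2) * t)"
  proof (rule gronwall[where T = t and e' = "\<lambda>r. f (\<psi> (r + s) x) - f (\<psi> r (\<psi> s x))"])
    show "continuous_on {0..t} ?e"
      by (intro continuous_intros flow_continuous_time
            continuous_on_compose2[OF flow_continuous_time[of UNIV x]]) auto
    have "((\<lambda>r. r + s) has_vector_derivative 1) (at r)" for r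
      unfolding has_real_derivative_iff_has_vector_derivative[symmetric]
      by (auto intro!: derivative_eq_intros)
    from vector_diff_chain_at[OF this flow_ode]
    have "((\<lambda>r. \<psi> (r + s) x) has_vector_derivative f (\<psi> (r + s) x)) (at r)" for r
      by (simp add: o_def)
    then show "(?e has_vector_derivative f (\<psi> (r + s) x) - f (\<psi> r (\<psi> s x))) (at r)" for r
      by (intro has_vector_derivative_diff flow_ode)
    show "norm (f (\<psi> (r + s) x) - f (\<psi> r (\<psi> s x))) \<le> L * norm (?e r) + 0" if "0 < r" "r \<le> t" for r
      using f_lipschitz_on_cball[where R = "max R1 R2" and L = L, of "\<psi> (r + s) x" "\<psi> r (\<psi> s x)"]
        L(2) R1[of "r + s"] R2[of r] that assms by (simp add: le_max_iff_disj)
  qed (use assms L in auto)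
  then show ?thesis by (simp add: flow_0)
qed

lemma flow_equilibrium:
  assumes "f p = 0" "0 \<le> t"
  shows "\<psi> t p = p"
proof -
  obtain R where R: "\<And>s. 0 \<le> s \<Longrightarrow> s \<le> t \<Longrightarrow> norm (\<psi> s p) \<le> R" using orbit_bounded by blast
  obtain L where L: "L \<ge> 0" "\<And>x. norm x \<le> R \<Longrightarrow> norm (F x) \<le> L" using F_bounded_on_cball by blast
  have "norm (\<psi> t p - p) \<le> (norm (\<psi> 0 p - p) + 0) * exp ((L + 2) * t)"
  proof (rule gronwall[where T = t and e' = "\<lambda>s. f (\<psi> s p)"])
    show "continuous_on {0..t} (\<lambda>s. \<psi> s p - p)" by (intro continuous_intros flow_continuous_time)
    show "((\<lambda>s. \<psi> s p - p) has_vector_derivative f (\<psi> s p)) (at s)" for s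
      using has_vector_derivative_diff[OF flow_ode has_vector_derivative_const] by simp
    show "norm (f (\<psi> s p)) \<le> L * norm (\<psi> s p - p) + 0" if "0 < s" "s \<le> t" for s
      using f_lipschitz_on_cball[where R = R and L = L, of "\<psi> s p" p] L(2) R[of s] R[of 0] that assms
      by (simp add: flow_0)
  qed (use assms L in auto)
  then show ?thesis by (simp add: flow_0)
qed

lemma continuous_on_flow: "continuous_on ({0..} \<times> UNIV) (\<lambda>(t, x). \<psi> t x)"
  unfolding continuous_on_iff
proof (intro ballI allI impI)
  fix p :: "real \<times> 'a" and e :: real
  assume p: "p \<in> {0..} \<times> UNIV" and e: "e > 0"
  obtain t x where [simp]: "p = (t, x)" by fastforce
  then have t: "0 \<le> t" using p by simp
  obtain \<delta> C where d: "\<delta> > 0" "C > 0"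
    "\<And>y s. norm (y - x) < \<delta> \<Longrightarrow> 0 \<le> s \<Longrightarrow> s \<le> t + 1 \<Longrightarrow> norm (\<psi> s y - \<psi> s x) \<le> C * norm (y - x)"
    using flow_locally_lipschitz[of x "t + 1"] by metis
  have "isCont (\<lambda>s. \<psi> s x) t" using flow_ode by (rule has_vector_derivative_continuous)
  then obtain r where r: "r > 0" "\<And>s. dist s t < r \<Longrightarrow> dist (\<psi> s x) (\<psi> t x) < e / 2"
    using e unfolding continuous_at_eps_delta by (metis half_gt_zero)
  define D where "D = min (min r 1) (min \<delta> (e / (2 * C)))"
  have "dist (\<psi> s y) (\<psi> t x) < e" if "0 \<le> s" "dist (s, y) (t, x) < D" for s y
  proof -
    have ds: "dist s t < D" "dist y x < D"
      using that(2) dist_fst_le[of "(s,y)" "(t,x)"] dist_snd_le[of "(s,y)" "(t,x)"] by auto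
    have "norm (\<psi> s y - \<psi> s x) \<le> C * norm (y - x)"
      using ds that(1) by (intro d(3)) (auto simp: D_def dist_norm)
    also have "\<dots> < e / 2" using ds(2) d(2) by (auto simp: D_def dist_norm field_simps)
    finally have "dist (\<psi> s y) (\<psi> s x) < e / 2" by (simp add: dist_norm)
    moreover have "dist (\<psi> s x) (\<psi> t x) < e / 2" using r(2) ds(1) by (simp add: D_def)
    ultimately show ?thesis using dist_triangle[of "\<psi> s y" "\<psi> t x" "\<psi> s x"] by linarith
  qed
  moreover have "D > 0" using r d e by (simp add: D_def)
  ultimately show "\<exists>d>0. \<forall>q\<in>{0..} \<times> UNIV. dist q p < d \<longrightarrow>
      dist (case q of (t, x) \<Rightarrow> \<psi> t x) (case p of (t, x) \<Rightarrow> \<psi> t x) < e"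
    by (intro exI[of _ D]) auto
qed

text \<open>Differences of solutions satisfy the variational equation up to a small error, uniformly on
  compact time intervals. This yields both the existence of its solutions and the differentiability
  of the flow.\<close>

lemma difference_nearly_variational:
  assumes "\<epsilon> > 0"
  obtains \<delta> where "\<delta> > 0" "\<And>h t. norm h < \<delta> \<Longrightarrow> 0 \<le> t \<Longrightarrow> t \<le> T \<Longrightarrow>
    norm (f (\<psi> t (x + h)) - f (\<psi> t x) - F (\<psi> t x) (\<psi> t (x + h) - \<psi> t x)) \<le> \<epsilon> * norm h"
proof -
  obtain R where R: "\<And>t. 0 \<le> t \<Longrightarrow> t \<le> T \<Longrightarrow> norm (\<psi> t x) \<le> R" using orbit_bounded by blast
  obtain \<delta> C where d: "\<delta> > 0" "C > 0"
    "\<And>y t. norm (y - x) < \<delta> \<Longrightarrow> 0 \<le> t \<Longrightarrow> t \<le> T \<Longrightarrow> norm (\<psi> t y - \<psi> t x) \<le> C * norm (y - x)"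
    using flow_locally_lipschitz[of x T] by metis
  obtain \<eta> where e: "\<eta> > 0"
    "\<And>p d. norm p \<le> R \<Longrightarrow> norm d < \<eta> \<Longrightarrow> norm (f (p + d) - f p - F p d) \<le> (\<epsilon> / C) * norm d"
    using f_linearization_on_cball[of "\<epsilon> / C" R] assms d(2) by (metis divide_pos_pos)
  have "norm (f (\<psi> t (x + h)) - f (\<psi> t x) - F (\<psi> t x) (\<psi> t (x + h) - \<psi> t x)) \<le> \<epsilon> * norm h"
    if h: "norm h < min \<delta> (\<eta> / C)" and t: "0 \<le> t" "t \<le> T" for h t
  proof -
    let ?d = "\<psi> t (x + h) - \<psi> t x"
    have le: "norm ?d \<le> C * norm h" using d(3)[of "x + h" t] h t by simp
    also have "\<dots> < \<eta>" using h d(2) by (simp add: field_simps)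
    finally have "norm (f (\<psi> t x + ?d) - f (\<psi> t x) - F (\<psi> t x) ?d) \<le> (\<epsilon> / C) * norm ?d"
      using e(2) R t by blast
    also have "\<dots> \<le> (\<epsilon> / C) * (C * norm h)" using le assms d(2) by (intro mult_left_mono) auto
    finally show ?thesis using d(2) by simp
  qed
  then show thesis using that[of "min \<delta> (\<eta> / C)"] d e by simp
qed

text \<open>The difference quotients satisfy the variational equation up to a uniformly small error,
  so by Gronwall's inequality they form a uniform Cauchy sequence. Their limit solves the equation.\<close>

lemma variational_solution_exists:
  obtains Y where "Y 0 = v" "continuous_on {0..} Y"
    "\<And>t. 0 < t \<Longrightarrow> (Y has_vector_derivative F (\<psi> t x) (Y t)) (at t)"
proof -
  define q where "q n t = real (Suc n) *\<^sub>R (\<psi> t (x + inverse (real (Suc n)) *\<^sub>R v) - \<psi> t x)" for n t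
  define q' where "q' n t = real (Suc n) *\<^sub>R (f (\<psi> t (x + inverse (real (Suc n)) *\<^sub>R v)) - f (\<psi> t x))" for n t
  have q_der: "(q n has_vector_derivative q' n t) (at t)" for n t
    unfolding q_def[abs_def] q'_def by (auto intro!: derivative_eq_intros flow_ode)
  have q0: "q n 0 = v" for n by (simp add: q_def flow_0)
  have near: "\<exists>N. \<forall>n\<ge>N. \<forall>t. 0 \<le> t \<longrightarrow> t \<le> T \<longrightarrow> norm (q' n t - F (\<psi> t x) (q n t)) \<le> \<epsilon>"
    if e: "\<epsilon> > 0" for \<epsilon> T
  proof -
    define \<epsilon>' where "\<epsilon>' = \<epsilon> / (1 + norm v)"
    have e': "\<epsilon>' > 0" "\<epsilon>' * norm v \<le> \<epsilon>"
      using e by (auto simp: \<epsilon>'_def add_pos_nonneg divide_le_eq distrib_left)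
    obtain \<delta> where d: "\<delta> > 0" "\<And>h t. norm h < \<delta> \<Longrightarrow> 0 \<le> t \<Longrightarrow> t \<le> T \<Longrightarrow>
        norm (f (\<psi> t (x + h)) - f (\<psi> t x) - F (\<psi> t x) (\<psi> t (x + h) - \<psi> t x)) \<le> \<epsilon>' * norm h"
      using difference_nearly_variational[OF e'(1)] by blast
    have "(\<lambda>n. inverse (real (Suc n)) *\<^sub>R v) \<longlonglongrightarrow> 0 *\<^sub>R v"
      by (intro tendsto_intros LIMSEQ_inverse_real_of_nat)
    then obtain N where N: "\<And>n. n \<ge> N \<Longrightarrow> norm (inverse (real (Suc n)) *\<^sub>R v) < \<delta>"
      using d(1) by (auto simp: lim_sequentially dist_norm simp del: norm_scaleR)
    have "norm (q' n t - F (\<psi> t x) (q n t)) \<le> \<epsilon>" if n: "n \<ge> N" and t: "0 \<le> t" "t \<le> T" for n t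
    proof -
      define h where "h = inverse (real (Suc n)) *\<^sub>R v"
      have "q' n t - F (\<psi> t x) (q n t) =
          real (Suc n) *\<^sub>R (f (\<psi> t (x + h)) - f (\<psi> t x) - F (\<psi> t x) (\<psi> t (x + h) - \<psi> t x))"
        by (simp only: q_def q'_def h_def blinfun.scaleR_right blinfun.diff_right scaleR_diff_right)
      also have "norm \<dots> \<le> real (Suc n) * (\<epsilon>' * norm h)"
        unfolding norm_scaleR using d(2)[OF N[OF n, folded h_def] t] by (intro mult_mono) auto
      also have "\<dots> = \<epsilon>' * norm v" by (simp add: h_def)
      finally show ?thesis using e'(2) by simp
    qed
    then show ?thesis by blast
  qed
  have bound: "\<exists>L\<ge>0. \<forall>t. 0 \<le> t \<longrightarrow> t \<le> T \<longrightarrow> norm (F (\<psi> t x)) \<le> L" for T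
  proof -
    obtain R where "\<And>t. 0 \<le> t \<Longrightarrow> t \<le> T \<Longrightarrow> norm (\<psi> t x) \<le> R" using orbit_bounded by blast
    moreover obtain L where "L \<ge> 0" "\<And>x. norm x \<le> R \<Longrightarrow> norm (F x) \<le> L" using F_bounded_on_cball by blast
    ultimately show ?thesis by blast
  qed
  have cauchy: "\<exists>N. \<forall>m\<ge>N. \<forall>n\<ge>N. \<forall>t. 0 \<le> t \<longrightarrow> t \<le> T \<longrightarrow> norm (q m t - q n t) \<le> \<epsilon>"
    if e: "\<epsilon> > 0" for \<epsilon> T
  proof -
    obtain L where L: "L \<ge> 0" "\<And>t. 0 \<le> t \<Longrightarrow> t \<le> T \<Longrightarrow> norm (F (\<psi> t x)) \<le> L" using bound by blast
    define E where "E = exp ((L + 2) * T)"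
    have E: "E > 0" by (simp add: E_def)
    obtain N where N: "\<And>n t. n \<ge> N \<Longrightarrow> 0 \<le> t \<Longrightarrow> t \<le> T \<Longrightarrow> norm (q' n t - F (\<psi> t x) (q n t)) \<le> \<epsilon> / (2 * E)"
      using near[of "\<epsilon> / (2 * E)" T] e E by auto
    have "norm (q m t - q n t) \<le> \<epsilon>" if mn: "m \<ge> N" "n \<ge> N" and t: "0 \<le> t" "t \<le> T" for m n t
    proof -
      have "norm (q m t - q n t) \<le> (norm (q m 0 - q n 0) + \<epsilon> / E) * exp ((L + 2) * t)"
      proof (rule gronwall[where T = T and e' = "\<lambda>t. q' m t - q' n t"])
        show "((\<lambda>t. q m t - q n t) has_vector_derivative q' m s - q' n s) (at s)" for s
          by (intro has_vector_derivative_diff q_der)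
        show "continuous_on {0..T} (\<lambda>t. q m t - q n t)"
          using q_der by (intro continuous_on_diff continuous_at_imp_continuous_on ballI)
            (auto intro: has_vector_derivative_continuous)
        fix s assume s: "0 < s" "s \<le> T"
        have "q' m s - q' n s = F (\<psi> s x) (q m s - q n s) +
            ((q' m s - F (\<psi> s x) (q m s)) - (q' n s - F (\<psi> s x) (q n s)))"
          by (simp add: blinfun.diff_right)
        also have "norm \<dots> \<le> norm (F (\<psi> s x) (q m s - q n s)) +
            (norm (q' m s - F (\<psi> s x) (q m s)) + norm (q' n s - F (\<psi> s x) (q n s)))"
          by (intro norm_triangle_mono norm_triangle_ineq4 order_refl)
        also have "\<dots> \<le> L * norm (q m s - q n s) + (\<epsilon> / (2 * E) + \<epsilon> / (2 * E))"
        proof (intro add_mono N mn)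
          show "norm (F (\<psi> s x) (q m s - q n s)) \<le> L * norm (q m s - q n s)"
            using norm_blinfun[of "F (\<psi> s x)" "q m s - q n s"] L(2)[of s] s
            by (meson less_imp_le mult_right_mono norm_ge_zero order_trans)
        qed (use s in auto)
        finally show "norm (q' m s - q' n s) \<le> L * norm (q m s - q n s) + \<epsilon> / E"
          using E by (simp add: field_simps)
      qed (use t L e E in auto)
      also have "\<dots> \<le> (norm (q m 0 - q n 0) + \<epsilon> / E) * E"
        unfolding E_def using t L e by (intro mult_left_mono) (auto intro: mult_left_mono)
      finally show ?thesis using E by (simp add: q0)
    qed
    then show ?thesis by blast
  qed
  define Y where "Y t = lim (\<lambda>n. q n t)" for t
  have lim: "(\<lambda>n. q n t) \<longlonglongrightarrow> Y t" if t: "0 \<le> t" for t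
  proof -
    have "Cauchy (\<lambda>n. q n t)"
    proof (rule metric_CauchyI)
      fix e :: real assume "e > 0"
      then obtain N where "\<And>m n. m \<ge> N \<Longrightarrow> n \<ge> N \<Longrightarrow> norm (q m t - q n t) \<le> e / 2"
        using cauchy[of "e / 2" t] t by auto
      then show "\<exists>M. \<forall>m\<ge>M. \<forall>n\<ge>M. dist (q m t) (q n t) < e"
        using \<open>e > 0\<close> by (intro exI[of _ N]) (fastforce simp: dist_norm)
    qed
    then show ?thesis unfolding Y_def using Cauchy_convergent convergent_LIMSEQ_iff by blast
  qed
  have Y_der: "(Y has_vector_derivative F (\<psi> t x) (Y t)) (at t within {0..T})"
    if t: "0 \<le> t" "t \<le> T" for t T
  proof -
    obtain L where L: "L \<ge> 0" "\<And>t. 0 \<le> t \<Longrightarrow> t \<le> T \<Longrightarrow> norm (F (\<psi> t x)) \<le> L" using bound by blast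
    have "\<exists>g. \<forall>s\<in>{0..T}. (\<lambda>n. q n s) \<longlonglongrightarrow> g s \<and>
        (g has_derivative (\<lambda>h. h *\<^sub>R F (\<psi> s x) (Y s))) (at s within {0..T})"
    proof (rule has_derivative_sequence[where f' = "\<lambda>n s h. h *\<^sub>R q' n s" and ?x0.0 = 0 and ?l = v])
      show "(q n has_derivative (\<lambda>h. h *\<^sub>R q' n s)) (at s within {0..T})" for n s
        using q_der[of n s] has_derivative_at_withinI unfolding has_vector_derivative_def by blast
      fix e :: real assume e: "e > 0"
      define d where "d = e / (2 * (L + 1))"
      have d: "d > 0" "L * d \<le> e / 2"
        using e L by (auto simp: d_def field_simps)
      obtain N1 where N1: "\<And>n t. n \<ge> N1 \<Longrightarrow> 0 \<le> t \<Longrightarrow> t \<le> T \<Longrightarrow> norm (q' n t - F (\<psi> t x) (q n t)) \<le> e / 2"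
        using near[of "e / 2" T] e by auto
      obtain N2 where N2: "\<And>m n t. m \<ge> N2 \<Longrightarrow> n \<ge> N2 \<Longrightarrow> 0 \<le> t \<Longrightarrow> t \<le> T \<Longrightarrow> norm (q m t - q n t) \<le> d"
        using cauchy[OF d(1), of T] by blast
      have "norm (h *\<^sub>R q' n s - h *\<^sub>R F (\<psi> s x) (Y s)) \<le> e * norm h"
        if n: "n \<ge> max N1 N2" and s: "s \<in> {0..T}" for n s h
      proof -
        have "(\<lambda>m. norm (q n s - q m s)) \<longlonglongrightarrow> norm (q n s - Y s)"
          using s by (intro tendsto_intros lim) auto
        then have "norm (q n s - Y s) \<le> d"
          by (rule tendsto_upperbound) (use N2 n s in \<open>auto intro!: eventually_sequentiallyI[of N2]\<close>)
        then have n1: "norm (F (\<psi> s x) (q n s - Y s)) \<le> L * d"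
          using norm_blinfun[of "F (\<psi> s x)" "q n s - Y s"] L(2)[of s] L(1) s
          by (meson atLeastAtMost_iff mult_mono norm_ge_zero order_trans)
        have n2: "norm (q' n s - F (\<psi> s x) (q n s)) \<le> e / 2" using N1 n s by simp
        have eq: "q' n s - F (\<psi> s x) (Y s) = (q' n s - F (\<psi> s x) (q n s)) + F (\<psi> s x) (q n s - Y s)"
          by (simp add: blinfun.diff_right)
        have "norm (q' n s - F (\<psi> s x) (Y s)) \<le> e"
          unfolding eq using n1 n2 d(2)
            norm_triangle_ineq[of "q' n s - F (\<psi> s x) (q n s)" "F (\<psi> s x) (q n s - Y s)"] by linarith
        then have "norm (q' n s - F (\<psi> s x) (Y s)) * norm h \<le> e * norm h" by (rule mult_right_mono) simp
        moreover have "h *\<^sub>R q' n s - h *\<^sub>R F (\<psi> s x) (Y s) = h *\<^sub>R (q' n s - F (\<psi> s x) (Y s))"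
          by (simp add: scaleR_diff_right)
        ultimately show ?thesis by (simp add: mult.commute)
      qed
      then show "\<forall>\<^sub>F n in sequentially. \<forall>s\<in>{0..T}. \<forall>h. norm (h *\<^sub>R q' n s - h *\<^sub>R F (\<psi> s x) (Y s)) \<le> e * norm h"
        by (intro eventually_sequentiallyI[of "max N1 N2"]) blast
    qed (use t in \<open>auto simp: q0\<close>)
    then obtain g where g: "\<And>s. s \<in> {0..T} \<Longrightarrow> (\<lambda>n. q n s) \<longlonglongrightarrow> g s"
      "\<And>s. s \<in> {0..T} \<Longrightarrow> (g has_derivative (\<lambda>h. h *\<^sub>R F (\<psi> s x) (Y s))) (at s within {0..T})" by blast
    have "g s = Y s" if "s \<in> {0..T}" for s
      using LIMSEQ_unique[OF g(1)[OF that] lim] that by simp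
    then show ?thesis
      unfolding has_vector_derivative_def using g(2)[of t] t
      by (auto intro: has_derivative_transform[of t "{0..T}" Y g])
  qed
  show thesis
  proof
    show "Y 0 = v" using LIMSEQ_unique[OF lim[of 0]] by (simp add: q0)
    show der: "(Y has_vector_derivative F (\<psi> t x) (Y t)) (at t)" if "0 < t" for t
      using Y_der[of t "t + 1"] that at_within_interior[of t "{0..t + 1}"] by simp
    have "continuous (at t within {0..}) Y" if "t \<ge> 0" for t
    proof (cases "t = 0")
      case True
      have "continuous (at 0 within {0..1}) Y"
        using Y_der[of 0 1] by (auto intro: has_vector_derivative_continuous)
      moreover have "at 0 within {0..1} = at 0 within {0..(1::real)} " by simp
      ultimately have "continuous (at 0 within {0..}) Y"
        unfolding continuous_within
        using at_within_nhd[of "0::real" "{..<1}" "{0..1}" "{0..}"] by fastforce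
      then show ?thesis using True by simp
    next
      case False
      then show ?thesis
        using der[of t] that has_vector_derivative_continuous continuous_at_imp_continuous_at_within by fastforce
    qed
    then show "continuous_on {0..} Y" by (simp add: continuous_on_eq_continuous_within)
  qed
qed

lemma variational_bound:
  obtains E where "E > 0"
    "\<And>e e' \<kappa> t. continuous_on {0..} e \<Longrightarrow> (\<And>t. 0 < t \<Longrightarrow> (e has_vector_derivative e' t) (at t)) \<Longrightarrow>
      (\<And>t. 0 < t \<Longrightarrow> t \<le> T \<Longrightarrow> norm (e' t - F (\<psi> t x) (e t)) \<le> \<kappa>) \<Longrightarrow> 0 \<le> \<kappa> \<Longrightarrow> 0 \<le> t \<Longrightarrow> t \<le> T \<Longrightarrow>
      norm (e t) \<le> (norm (e 0) + \<kappa>) * E"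
proof -
  obtain R where R: "\<And>t. 0 \<le> t \<Longrightarrow> t \<le> T \<Longrightarrow> norm (\<psi> t x) \<le> R" using orbit_bounded by blast
  obtain L where L: "L \<ge> 0" "\<And>x. norm x \<le> R \<Longrightarrow> norm (F x) \<le> L" using F_bounded_on_cball by blast
  show thesis
  proof (rule that[of "exp ((L + 2) * T)"])
    fix e e' :: "real \<Rightarrow> 'a" and \<kappa> t :: real
    assume cont: "continuous_on {0..} e"
      and der: "\<And>t. 0 < t \<Longrightarrow> (e has_vector_derivative e' t) (at t)"
      and le: "\<And>t. 0 < t \<Longrightarrow> t \<le> T \<Longrightarrow> norm (e' t - F (\<psi> t x) (e t)) \<le> \<kappa>"
      and \<kappa>: "0 \<le> \<kappa>" and t: "0 \<le> t" "t \<le> T"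
    have "norm (e t) \<le> (norm (e 0) + \<kappa>) * exp ((L + 2) * t)"
    proof (rule gronwall[where T = T and e' = e'])
      show "continuous_on {0..T} e" using cont by (rule continuous_on_subset) auto
      fix s assume s: "0 < s" "s \<le> T"
      have "norm (e' s) \<le> norm (F (\<psi> s x) (e s)) + norm (e' s - F (\<psi> s x) (e s))"
        by (rule norm_triangle_sub)
      also have "\<dots> \<le> L * norm (e s) + \<kappa>"
      proof (intro add_mono le s)
        show "norm (F (\<psi> s x) (e s)) \<le> L * norm (e s)"
          using norm_blinfun[of "F (\<psi> s x)" "e s"] L(2)[OF R[of s]] s
          by (meson less_imp_le mult_right_mono norm_ge_zero order_trans)
      qed
      finally show "norm (e' s) \<le> L * norm (e s) + \<kappa>" .
    qed (use der L \<kappa> t in auto)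
    also have "\<dots> \<le> (norm (e 0) + \<kappa>) * exp ((L + 2) * T)"
      using \<kappa> t L(1) by (intro mult_left_mono) (auto intro: mult_left_mono)
    finally show "norm (e t) \<le> (norm (e 0) + \<kappa>) * exp ((L + 2) * T)" .
  qed simp
qed

text \<open>Linearity in the initial vector is uniqueness for the variational equation. The remainder
  \<open>\<psi> t (x + h) - \<psi> t x - Y t h\<close> starts at zero and solves that equation up to an error of order
  \<open>o(norm h)\<close>, so it is itself of this order.\<close>

lemma flow_fundamental_solution:
  obtains Y where "\<And>t. 0 \<le> t \<Longrightarrow> (\<psi> t has_derivative Y t) (at x)" "\<And>v. Y 0 v = v"
    "\<And>v. continuous_on {0..} (\<lambda>t. Y t v)"
    "\<And>t v. 0 < t \<Longrightarrow> ((\<lambda>s. Y s v) has_vector_derivative F (\<psi> t x) (Y t v)) (at t)"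
proof -
  have "\<exists>Y. Y 0 = v \<and> continuous_on {0..} Y \<and>
      (\<forall>t>0. (Y has_vector_derivative F (\<psi> t x) (Y t)) (at t))" for v
    by (rule variational_solution_exists[of v x]) blast
  then obtain Z where Z: "\<And>v. Z v 0 = v" "\<And>v. continuous_on {0..} (Z v)"
    "\<And>v t. 0 < t \<Longrightarrow> (Z v has_vector_derivative F (\<psi> t x) (Z v t)) (at t)" by metis
  have zero: "e t = 0" if "continuous_on {0..} e" "e 0 = 0" "0 \<le> t"
    "\<And>t. 0 < t \<Longrightarrow> (e has_vector_derivative F (\<psi> t x) (e t)) (at t)" for e t
  proof -
    obtain E where "E > 0"
      "\<And>e e' \<kappa> r. continuous_on {0..} e \<Longrightarrow> (\<And>t. 0 < t \<Longrightarrow> (e has_vector_derivative e' t) (at t)) \<Longrightarrow>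
      (\<And>r. 0 < r \<Longrightarrow> r \<le> t \<Longrightarrow> norm (e' r - F (\<psi> r x) (e r)) \<le> \<kappa>) \<Longrightarrow> 0 \<le> \<kappa> \<Longrightarrow> 0 \<le> r \<Longrightarrow> r \<le> t \<Longrightarrow>
      norm (e r) \<le> (norm (e 0) + \<kappa>) * E" using variational_bound[of t x] by blast
    from this(2)[OF that(1,4), of 0 t] show ?thesis using that(2,3) by simp
  qed
  have lin: "linear (\<lambda>v. Z v t)" if t: "0 \<le> t" for t
  proof (rule linearI)
    fix v w and c :: real
    have "Z (v + w) t - (Z v t + Z w t) = 0"
      by (rule zero[of "\<lambda>t. Z (v + w) t - (Z v t + Z w t)", OF _ _ t])
         (auto intro!: continuous_intros Z(2) derivative_eq_intros Z(3)
           simp: Z(1) blinfun.diff_right blinfun.add_right)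
    then show "Z (v + w) t = Z v t + Z w t" by simp
    have "Z (c *\<^sub>R v) t - c *\<^sub>R Z v t = 0"
      by (rule zero[of "\<lambda>t. Z (c *\<^sub>R v) t - c *\<^sub>R Z v t", OF _ _ t])
         (auto intro!: continuous_intros Z(2) derivative_eq_intros Z(3)
           simp: Z(1) blinfun.diff_right blinfun.scaleR_right)
    then show "Z (c *\<^sub>R v) t = c *\<^sub>R Z v t" by simp
  qed
  have der: "(\<psi> t has_derivative (\<lambda>v. Z v t)) (at x)" if t: "0 \<le> t" for t
    unfolding has_derivative_at_alt
  proof (intro conjI allI impI)
    show "bounded_linear (\<lambda>v. Z v t)" using lin[OF t] linear_conv_bounded_linear by blast
    fix e :: real assume e: "e > 0"
    obtain E where E: "E > 0"
      "\<And>e e' \<kappa> r. continuous_on {0..} e \<Longrightarrow> (\<And>t. 0 < t \<Longrightarrow> (e has_vector_derivative e' t) (at t)) \<Longrightarrow>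
      (\<And>r. 0 < r \<Longrightarrow> r \<le> t \<Longrightarrow> norm (e' r - F (\<psi> r x) (e r)) \<le> \<kappa>) \<Longrightarrow> 0 \<le> \<kappa> \<Longrightarrow> 0 \<le> r \<Longrightarrow> r \<le> t \<Longrightarrow>
      norm (e r) \<le> (norm (e 0) + \<kappa>) * E" using variational_bound[of t x] by blast
    obtain \<delta> where d: "\<delta> > 0" "\<And>h r. norm h < \<delta> \<Longrightarrow> 0 \<le> r \<Longrightarrow> r \<le> t \<Longrightarrow>
      norm (f (\<psi> r (x + h)) - f (\<psi> r x) - F (\<psi> r x) (\<psi> r (x + h) - \<psi> r x)) \<le> (e / E) * norm h"
      using difference_nearly_variational[of "e / E" t x] e E(1) by (metis divide_pos_pos)
    have "norm (\<psi> t y - \<psi> t x - Z (y - x) t) \<le> e * norm (y - x)" if y: "norm (y - x) < \<delta>" for y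
    proof -
      define h where "h = y - x"
      let ?e = "\<lambda>r. \<psi> r (x + h) - \<psi> r x - Z h r"
      let ?e' = "\<lambda>r. f (\<psi> r (x + h)) - f (\<psi> r x) - F (\<psi> r x) (Z h r)"
      have "norm (?e t) \<le> (norm (?e 0) + (e / E) * norm h) * E"
      proof (rule E(2)[where e' = ?e'])
        show "continuous_on {0..} ?e" by (intro continuous_intros flow_continuous_time Z(2))
        show "(?e has_vector_derivative ?e' r) (at r)" if "0 < r" for r
          by (intro has_vector_derivative_diff flow_ode Z(3) that)
        show "norm (?e' r - F (\<psi> r x) (?e r)) \<le> (e / E) * norm h" if "0 < r" "r \<le> t" for r
          using d(2)[of h r] y that by (simp add: h_def blinfun.diff_right)
      qed (use t e E in auto)
      also have "\<dots> = e * norm h" using E(1) by (simp add: flow_0 Z(1))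
      finally show ?thesis by (simp add: h_def)
    qed
    then show "\<exists>d>0. \<forall>y. norm (y - x) < d \<longrightarrow> norm (\<psi> t y - \<psi> t x - Z (y - x) t) \<le> e * norm (y - x)"
      using d(1) by blast
  qed
  show thesis by (rule that[of "\<lambda>t v. Z v t"]) (use der Z in auto)
qed

definition D\<psi> :: "real \<Rightarrow> 'a \<Rightarrow> 'a \<Rightarrow> 'a" where "D\<psi> t x = frechet_derivative (\<psi> t) (at x)"

lemma D\<psi>:
  shows D\<psi>_has_derivative: "0 \<le> t \<Longrightarrow> (\<psi> t has_derivative D\<psi> t x) (at x)"
    and D\<psi>_0: "D\<psi> 0 x v = v"
    and D\<psi>_continuous_time: "continuous_on {0..} (\<lambda>t. D\<psi> t x v)"
    and D\<psi>_ode: "0 < t \<Longrightarrow> ((\<lambda>s. D\<psi> s x v) has_vector_derivative F (\<psi> t x) (D\<psi> t x v)) (at t)"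
proof -
  obtain Y where Y: "\<And>t. 0 \<le> t \<Longrightarrow> (\<psi> t has_derivative Y t) (at x)" "\<And>v. Y 0 v = v"
    "\<And>v. continuous_on {0..} (\<lambda>t. Y t v)"
    "\<And>t v. 0 < t \<Longrightarrow> ((\<lambda>s. Y s v) has_vector_derivative F (\<psi> t x) (Y t v)) (at t)"
    using flow_fundamental_solution by blast
  have eq: "D\<psi> t x = Y t" if "0 \<le> t" for t
    unfolding D\<psi>_def using frechet_derivative_at[OF Y(1)[OF that]] by simp
  show "0 \<le> t \<Longrightarrow> (\<psi> t has_derivative D\<psi> t x) (at x)" using Y(1) eq by simp
  show "D\<psi> 0 x v = v" using Y(2) eq by simp
  show "continuous_on {0..} (\<lambda>t. D\<psi> t x v)"
    using Y(3)[of v] by (rule continuous_on_eq) (simp add: eq)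
  show "((\<lambda>s. D\<psi> s x v) has_vector_derivative F (\<psi> t x) (D\<psi> t x v)) (at t)" if "0 < t"
  proof (rule has_vector_derivative_transform_within_open[where S = "{0<..}"])
    show "((\<lambda>s. Y s v) has_vector_derivative F (\<psi> t x) (D\<psi> t x v)) (at t)"
      using Y(4)[OF that] that by (simp add: eq)
  qed (use that in \<open>auto simp: eq\<close>)
qed

lemma D\<psi>_linear: "0 \<le> t \<Longrightarrow> linear (D\<psi> t x)"
  using D\<psi>_has_derivative has_derivative_linear by blast

lemma D\<psi>_semigroup:
  assumes "0 \<le> t" "0 \<le> s"
  shows "D\<psi> (t + s) x v = D\<psi> t (\<psi> s x) (D\<psi> s x v)"
proof -
  have "\<psi> (t + s) = (\<lambda>x. \<psi> t (\<psi> s x))" using flow_semigroup[OF assms] by blast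
  moreover have "((\<lambda>x. \<psi> t (\<psi> s x)) has_derivative (\<lambda>v. D\<psi> t (\<psi> s x) (D\<psi> s x v))) (at x)"
    using has_derivative_compose[OF D\<psi>_has_derivative[OF assms(2)] D\<psi>_has_derivative[OF assms(1)]] .
  ultimately have "(\<psi> (t + s) has_derivative (\<lambda>v. D\<psi> t (\<psi> s x) (D\<psi> s x v))) (at x)" by simp
  then have "D\<psi> (t + s) x = (\<lambda>v. D\<psi> t (\<psi> s x) (D\<psi> s x v))"
    using has_derivative_unique D\<psi>_has_derivative assms by (metis add_nonneg_nonneg)
  then show ?thesis by simp
qed

text \<open>Solutions of the variational equation decay at most exponentially on compact time intervals.\<close>

lemma D\<psi>_nonzero:
  assumes v: "v \<noteq> 0" and t: "0 \<le> t"
  shows "D\<psi> t x v \<noteq> 0"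
proof -
  obtain R where R: "\<And>s. 0 \<le> s \<Longrightarrow> s \<le> t \<Longrightarrow> norm (\<psi> s x) \<le> R" using orbit_bounded by blast
  obtain L where L: "L \<ge> 0" "\<And>x. norm x \<le> R \<Longrightarrow> norm (F x) \<le> L" using F_bounded_on_cball by blast
  let ?y = "\<lambda>s. D\<psi> s x v"
  define k where "k = norm v / 2"
  have k: "k > 0" using v by (simp add: k_def)
  define \<phi> where "\<phi> s = norm (?y s) - k * exp (- (L + 1) * s)" for s
  have "\<phi> t > 0"
  proof (rule positive_until_first_zero[where \<phi> = \<phi> and T = t])
    show "continuous_on {0..t} \<phi>" unfolding \<phi>_def
      by (intro continuous_intros continuous_on_subset[OF D\<psi>_continuous_time]) auto
    show "\<phi> 0 > 0" using v by (simp add: \<phi>_def D\<psi>_0 k_def)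
    fix s assume s: "0 < s" "s \<le> t" "\<phi> s = 0"
    then have ne: "norm (?y s) = k * exp (- (L + 1) * s)" by (simp add: \<phi>_def)
    then have pos: "norm (?y s) > 0" using k by simp
    then have y0: "?y s \<noteq> 0" by simp
    have "((\<lambda>s. norm (?y s)) has_real_derivative (F (\<psi> s x) (?y s) \<bullet> ?y s / norm (?y s))) (at s)"
      using norm_has_real_derivative[OF D\<psi>_ode y0] s by simp
    then have D: "(\<phi> has_real_derivative
        (F (\<psi> s x) (?y s) \<bullet> ?y s / norm (?y s) + k * ((L + 1) * exp (- (L + 1) * s)))) (at s)"
      unfolding \<phi>_def by (auto intro!: derivative_eq_intros simp: algebra_simps)
    have "\<bar>F (\<psi> s x) (?y s) \<bullet> ?y s\<bar> \<le> norm (F (\<psi> s x) (?y s)) * norm (?y s)"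
      by (rule Cauchy_Schwarz_ineq2)
    also have "\<dots> \<le> (L * norm (?y s)) * norm (?y s)"
    proof (rule mult_right_mono)
      show "norm (F (\<psi> s x) (?y s)) \<le> L * norm (?y s)"
        using norm_blinfun[of "F (\<psi> s x)" "?y s"] L(2)[OF R[of s]] s
        by (meson less_imp_le mult_right_mono norm_ge_zero order_trans)
    qed simp
    finally have "F (\<psi> s x) (?y s) \<bullet> ?y s / norm (?y s) \<ge> - (L * norm (?y s))"
      using pos by (simp add: le_divide_eq)
    then have "F (\<psi> s x) (?y s) \<bullet> ?y s / norm (?y s) + (L + 1) * norm (?y s) > 0"
      unfolding distrib_right mult_1 using pos by linarith
    then show "\<exists>D>0. (\<phi> has_real_derivative D) (at s)"
      using D unfolding ne by (auto simp: mult_ac)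
  qed (use t in auto)
  moreover have "k * exp (- (L + 1) * t) > 0" using k by simp
  ultimately show ?thesis unfolding \<phi>_def by (smt (verit) norm_zero)
qed

text \<open>Joint continuity is what will make the union of the cones over all base points a closed set.\<close>

lemma continuous_on_D\<psi>: "continuous_on ({0..} \<times> UNIV \<times> UNIV) (\<lambda>(t, x, v). D\<psi> t x v)"
  unfolding continuous_on_iff
proof (intro ballI allI impI)
  fix p :: "real \<times> 'a \<times> 'a" and e :: real
  assume p: "p \<in> {0..} \<times> UNIV \<times> UNIV" and e: "e > 0"
  obtain t x v where [simp]: "p = (t, x, v)" using prod_cases3 by blast
  then have t: "0 \<le> t" using p by simp
  define T where "T = t + 1"
  have "bounded ((\<lambda>t. D\<psi> t x v) ` {0..T})"
    by (intro compact_imp_bounded compact_continuous_image continuous_on_subset[OF D\<psi>_continuous_time]) auto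
  then obtain M where "\<forall>s\<in>{0..T}. norm (D\<psi> s x v) \<le> M"
    unfolding bounded_iff ball_simps(9) by blast
  then have M: "\<And>s. 0 \<le> s \<Longrightarrow> s \<le> T \<Longrightarrow> norm (D\<psi> s x v) \<le> M" by simp
  have M0: "M \<ge> 0" using M[of 0] t norm_ge_zero[of "D\<psi> 0 x v"] unfolding T_def by linarith
  obtain R where R: "\<And>t. 0 \<le> t \<Longrightarrow> t \<le> T \<Longrightarrow> norm (\<psi> t x) \<le> R" using orbit_bounded by blast
  obtain L where L: "L \<ge> 0" "\<And>x. norm x \<le> R + 1 \<Longrightarrow> norm (F x) \<le> L" using F_bounded_on_cball by blast
  obtain \<delta> C where d: "\<delta> > 0" "C > 0"
    "\<And>y t. norm (y - x) < \<delta> \<Longrightarrow> 0 \<le> t \<Longrightarrow> t \<le> T \<Longrightarrow> norm (\<psi> t y - \<psi> t x) \<le> C * norm (y - x)"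
    "\<And>y t. norm (y - x) < \<delta> \<Longrightarrow> 0 \<le> t \<Longrightarrow> t \<le> T \<Longrightarrow> norm (\<psi> t y - \<psi> t x) \<le> 1"
    using flow_locally_lipschitz[of x T] by metis
  define E where "E = exp ((L + 2) * T)"
  have E: "E > 0" by (simp add: E_def)
  define \<epsilon> where "\<epsilon> = e / (4 * E * (M + 1))"
  have \<epsilon>: "\<epsilon> > 0" "(\<epsilon> * M) * E \<le> e / 4"
  proof -
    show "\<epsilon> > 0" using e E M0 by (simp add: \<epsilon>_def)
    have "\<epsilon> * M * E = (e / 4) * (M / (M + 1))" using E M0 by (simp add: \<epsilon>_def)
    also have "\<dots> \<le> (e / 4) * 1" using e M0 by (intro mult_left_mono) auto
    finally show "(\<epsilon> * M) * E \<le> e / 4" by simp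
  qed
  have "uniformly_continuous_on (cball 0 (R + 1)) F"
    by (intro compact_uniformly_continuous continuous_on_subset[OF F_cont]) auto
  then obtain \<eta> where \<eta>: "\<eta> > 0"
    "\<And>x y. norm x \<le> R + 1 \<Longrightarrow> norm y \<le> R + 1 \<Longrightarrow> dist y x < \<eta> \<Longrightarrow> dist (F y) (F x) < \<epsilon>"
    using \<epsilon>(1) unfolding uniformly_continuous_on_def mem_cball_0[symmetric] by metis
  have "continuous (at t within {0..}) (\<lambda>s. D\<psi> s x v)"
    using D\<psi>_continuous_time t by (auto simp: continuous_on_eq_continuous_within)
  then obtain r where r: "r > 0" "\<And>s. 0 \<le> s \<Longrightarrow> dist s t < r \<Longrightarrow> dist (D\<psi> s x v) (D\<psi> t x v) < e / 2"
    using e unfolding continuous_within_eps_delta by (metis atLeast_iff half_gt_zero)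
  define d0 where "d0 = min (min r 1) (min (min \<delta> (\<eta> / C)) (e / (4 * E)))"
  have "dist (D\<psi> s y w) (D\<psi> t x v) < e" if s: "0 \<le> s" and dd: "dist (s, y, w) (t, x, v) < d0" for s y w
  proof -
    have ds: "dist s t < d0" "dist y x < d0" "dist w v < d0"
      using dd dist_fst_le[of "(s,y,w)" "(t,x,v)"] dist_snd_le[of "(s,y,w)" "(t,x,v)"]
        dist_fst_le[of "(y,w)" "(x,v)"] dist_snd_le[of "(y,w)" "(x,v)"] by auto
    have sT: "s \<le> T" using ds(1) by (auto simp: T_def d0_def dist_real_def)
    let ?e = "\<lambda>s. D\<psi> s y w - D\<psi> s x v"
    have "norm (?e s) \<le> (norm (?e 0) + \<epsilon> * M) * exp ((L + 2) * s)"
    proof (rule gronwall[where T = T and e' = "\<lambda>s. F (\<psi> s y) (D\<psi> s y w) - F (\<psi> s x) (D\<psi> s x v)"])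
      show "continuous_on {0..T} ?e"
        by (intro continuous_intros continuous_on_subset[OF D\<psi>_continuous_time]) auto
      fix u assume u: "0 < u" "u \<le> T"
      show "(?e has_vector_derivative F (\<psi> u y) (D\<psi> u y w) - F (\<psi> u x) (D\<psi> u x v)) (at u)"
        by (intro has_vector_derivative_diff D\<psi>_ode u)
      have xR: "norm (\<psi> u x) \<le> R" using R u by simp
      have yx: "norm (\<psi> u y - \<psi> u x) \<le> C * norm (y - x)" "norm (\<psi> u y - \<psi> u x) \<le> 1"
        using d(3,4)[of y u] ds(2) u by (auto simp: d0_def dist_norm)
      have yR: "norm (\<psi> u y) \<le> R + 1" using norm_triangle_sub[of "\<psi> u y" "\<psi> u x"] yx(2) xR by linarith
      have "C * norm (y - x) < \<eta>" using ds(2) d(2) by (simp add: d0_def dist_norm field_simps)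
      then have "dist (F (\<psi> u y)) (F (\<psi> u x)) < \<epsilon>"
        using \<eta>(2)[of "\<psi> u x" "\<psi> u y"] yx(1) xR yR by (simp add: dist_norm)
      then have n1: "norm ((F (\<psi> u y) - F (\<psi> u x)) (D\<psi> u x v)) \<le> \<epsilon> * M"
        using norm_blinfun[of "F (\<psi> u y) - F (\<psi> u x)" "D\<psi> u x v"] M[of u] u M0
        by (smt (verit) dist_norm mult_mono norm_ge_zero)
      have n2: "norm (F (\<psi> u y) (?e u)) \<le> L * norm (?e u)"
        using norm_blinfun[of "F (\<psi> u y)" "?e u"] L(2)[OF yR] by (meson mult_right_mono norm_ge_zero order_trans)
      have eq: "F (\<psi> u y) (D\<psi> u y w) - F (\<psi> u x) (D\<psi> u x v) =
          F (\<psi> u y) (?e u) + (F (\<psi> u y) - F (\<psi> u x)) (D\<psi> u x v)"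
        by (simp add: blinfun.diff_right blinfun.diff_left)
      show "norm (F (\<psi> u y) (D\<psi> u y w) - F (\<psi> u x) (D\<psi> u x v)) \<le> L * norm (?e u) + \<epsilon> * M"
        unfolding eq by (rule order_trans[OF norm_triangle_ineq add_mono[OF n2 n1]])
    qed (use s sT L M0 \<epsilon> in auto)
    also have "\<dots> \<le> (norm (?e 0) + \<epsilon> * M) * E"
      unfolding E_def using s sT L(1) \<epsilon>(1) M0 by (intro mult_left_mono) (auto intro: mult_left_mono)
    also have "\<dots> = norm (w - v) * E + (\<epsilon> * M) * E" by (simp add: D\<psi>_0 distrib_right)
    also have "\<dots> < e / 4 + e / 4"
    proof (intro add_less_le_mono \<epsilon>(2))
      have "norm (w - v) < e / (4 * E)" using ds(3) by (simp add: d0_def dist_norm)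
      then show "norm (w - v) * E < e / 4" using E by (simp add: less_divide_eq)
    qed
    finally have "dist (D\<psi> s y w) (D\<psi> s x v) < e / 2" by (simp add: dist_norm)
    moreover have "dist (D\<psi> s x v) (D\<psi> t x v) < e / 2" using r(2) s ds(1) by (simp add: d0_def)
    ultimately show ?thesis using dist_triangle[of "D\<psi> s y w" "D\<psi> t x v" "D\<psi> s x v"] by linarith
  qed
  moreover have "d0 > 0" using r d e E \<eta> by (simp add: d0_def)
  ultimately show "\<exists>d>0. \<forall>q\<in>{0..} \<times> UNIV \<times> UNIV. dist q p < d \<longrightarrow>
      dist (case q of (t, x, v) \<Rightarrow> D\<psi> t x v) (case p of (t, x, v) \<Rightarrow> D\<psi> t x v) < e"
    by (intro exI[of _ d0]) auto
qed

end

section \<open>Eigenvector coordinates of a real matrix\<close>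

definition cvec :: "real^'n \<Rightarrow> complex^'n" where "cvec u = (\<chi> i. complex_of_real (u $ i))"

definition cmat :: "real^'n^'n \<Rightarrow> complex^'n^'n" where
  "cmat M = (\<chi> i j. complex_of_real (M $ i $ j))"

lemma cvec_nth [simp]: "cvec u $ i = complex_of_real (u $ i)"
  by (simp add: cvec_def)

lemma cmat_cvec: "cmat M *v cvec u = cvec (M *v u)"
  by (simp add: vec_eq_iff cmat_def matrix_vector_mult_def)

lemma linear_cvec: "linear cvec"
  by (rule linearI) (simp_all add: vec_eq_iff complex_eq_iff)

lemma linear_complex_matrix: "linear ((*v) (B :: complex^'n^'m))"
  by (rule linearI)
     (simp_all add: vec_eq_iff matrix_vector_mult_def sum.distrib distrib_left sum_distrib_left
       scaleR_sum_right)

definition Re_vec :: "complex^'n \<Rightarrow> real^'n" where "Re_vec w = (\<chi> i. Re (w $ i))"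
definition Im_vec :: "complex^'n \<Rightarrow> real^'n" where "Im_vec w = (\<chi> i. Im (w $ i))"

lemma cvec_Re_Im: "w = cvec (Re_vec w) + \<i> *s cvec (Im_vec w)"
  by (simp add: vec_eq_iff Re_vec_def Im_vec_def complex_eq[symmetric])

lemma matrix_add_smult: "A *v (x + c *s y) = A *v x + c *s (A *v (y :: complex^'n))"
  by (simp add: matrix_vector_right_distrib matrix_vector_mult_scaleR vector_scalar_commute)

lemma cvec_combination_eq_iff:
  "cvec a + \<i> *s cvec b = cvec c + \<i> *s cvec d \<longleftrightarrow> a = c \<and> b = d"
  by (auto simp: vec_eq_iff complex_eq_iff)

text \<open>Here \<open>B\<close> is the inverse of the matrix of eigenvectors; it turns the given matrix into a
  diagonal one. The map \<open>idx\<close> translates the numbering of the eigenvalues into the index type.\<close>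

lemma eigen_coordinates:
  fixes A :: "complex^'n^'n"
  assumes "independent_eigenvectors A ev"
  shows "\<exists>idx B v. bij_betw idx (UNIV :: 'n set) {1..CARD('n)} \<and> (\<forall>w. B *v w = 0 \<longrightarrow> w = 0) \<and>
    (\<forall>w i. ((B :: complex^'n^'n) *v (A *v w)) $ i = ev (idx i) * (B *v w) $ i) \<and>
    (\<forall>j. A *v v j = ev (idx j) *s v j) \<and> (\<forall>j. B *v v j = axis j 1)"
proof -
  obtain v0 where v0: "\<forall>j\<in>{1..CARD('n)}. A *v v0 j = ev j *s v0 j"
    "inj_on v0 {1..CARD('n)}" "vec.independent (v0 ` {1..CARD('n)})"
    using assms by (auto simp: independent_eigenvectors_def)
  obtain idx :: "'n \<Rightarrow> nat" where idx: "bij_betw idx UNIV {1..CARD('n)}"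
    using finite_same_card_bij[of "UNIV :: 'n set" "{1..CARD('n)}"] by auto
  define v where "v i = v0 (idx i)" for i
  have rng: "idx i \<in> {1..CARD('n)}" for i using idx by (auto simp: bij_betw_def)
  have inj_v: "inj v"
    using comp_inj_on[of idx UNIV v0] idx v0(2) by (simp add: v_def[abs_def] bij_betw_def o_def)
  have "range v = v0 ` range idx" by (auto simp: v_def)
  then have range_v: "range v = v0 ` {1..CARD('n)}" using bij_betw_imp_surj_on[OF idx] by simp
  define P :: "complex^'n^'n" where "P = (\<chi> r c. v c $ r)"
  have col: "column c P = v c" for c by (simp add: column_def P_def)
  have "\<exists>B. B ** P = mat 1"
    unfolding matrix_left_invertible_independent_columns
  proof (intro allI impI)
    fix c :: "'n \<Rightarrow> complex" and i
    assume "(\<Sum>i\<in>UNIV. c i *s column i P) = 0"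
    then have "(\<Sum>i\<in>UNIV. c i *s v i) = 0" by (simp add: col)
    then have "(\<Sum>x\<in>range v. c (inv v x) *s x) = 0"
      using inj_v by (simp add: sum.reindex)
    moreover have "\<forall>u. (\<Sum>x\<in>range v. u x *s x) = 0 \<longrightarrow> (\<forall>x\<in>range v. u x = 0)"
      using v0(3) unfolding range_v[symmetric] vec.dependent_finite[OF finite_imageI[OF finite]]
      by auto
    ultimately have "\<forall>x\<in>range v. c (inv v x) = 0" by (elim allE[of _ "\<lambda>x. c (inv v x)"]) simp
    then have "c (inv v (v i)) = 0" by blast
    then show "c i = 0" using inj_v by simp
  qed
  then obtain B where BP: "B ** P = mat 1" by blast
  then have PB: "P ** B = mat 1" using matrix_left_right_inverse by blast
  have Bv: "B *v v j = axis j 1" for j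
  proof -
    have "v j = P *v axis j 1" 
      by (simp add: vec_eq_iff P_def matrix_vector_mult_def axis_def mult_delta_right)
    then have "B *v v j = (B ** P) *v axis j 1" by (simp only: matrix_vector_mul_assoc)
    then show ?thesis by (simp add: BP)
  qed
  have Av: "A *v v j = ev (idx j) *s v j" for j using v0(1) rng by (simp add: v_def)
  define D :: "complex^'n^'n" where "D = (\<chi> i j. if i = j then ev (idx i) else 0)"
  have D: "(D *v w) $ i = ev (idx i) * w $ i" for w i
    by (simp add: D_def matrix_vector_mult_def mult_delta_left)
  have "A ** P = P ** D"
  proof -
    have "(A ** P) $ r $ c = (P ** D) $ r $ c" for r c
    proof -
      have "(A ** P) $ r $ c = (A *v v c) $ r"
        by (simp add: matrix_matrix_mult_def matrix_vector_mult_def P_def)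
      also have "\<dots> = ev (idx c) * v c $ r" by (simp add: Av)
      also have "\<dots> = (P ** D) $ r $ c"
        by (simp add: matrix_matrix_mult_def P_def D_def mult_delta_right)
      finally show ?thesis .
    qed
    then show ?thesis by (simp add: vec_eq_iff)
  qed
  then have "B ** A = D ** B"
    by (metis BP PB matrix_mul_assoc matrix_mul_lid matrix_mul_rid)
  then have BA: "(B *v (A *v w)) $ i = ev (idx i) * (B *v w) $ i" for w i
    by (simp add: matrix_vector_mul_assoc flip: D)
  have "w = 0" if "B *v w = 0" for w
    using that PB by (metis matrix_vector_mul_assoc matrix_vector_mul_lid matrix_vector_mult_0_right)
  then show ?thesis using idx BA Av Bv by blast
qed

text \<open>The conjugate of a leading eigenvector is an eigenvector for the conjugate eigenvalue, which
  has the same real part and therefore is the same eigenvalue.\<close>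

lemma strictly_leading_eigenvalue_real:
  fixes M :: "real^'n^'n"
  assumes ind: "independent_eigenvectors (cmat M) ev"
    and gap: "\<And>j. 2 \<le> j \<Longrightarrow> j \<le> CARD('n) \<Longrightarrow> Re (ev j) < Re (ev 1)"
  shows "ev 1 \<in> \<real>"
proof -
  obtain idx :: "'n \<Rightarrow> nat" and B :: "complex^'n^'n" and v :: "'n \<Rightarrow> complex^'n" where B:
    "bij_betw idx UNIV {1..CARD('n)}" "\<And>w. B *v w = 0 \<Longrightarrow> w = 0"
    "\<And>w i. (B *v (cmat M *v w)) $ i = ev (idx i) * (B *v w) $ i"
    "\<And>j. cmat M *v v j = ev (idx j) *s v j" "\<And>j. B *v v j = axis j 1"
    using eigen_coordinates[OF ind] by (elim exE conjE) metis
  have "(1::nat) \<in> range idx" unfolding bij_betw_imp_surj_on[OF B(1)] by simp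
  then obtain i1 where i1: "idx i1 = 1" by force
  define w where "w = (\<chi> i. cnj (v i1 $ i))"
  have Mw: "cmat M *v w = cnj (ev 1) *s w"
  proof -
    have "(cmat M *v w) $ i = cnj ((cmat M *v v i1) $ i)" for i
      by (simp add: matrix_vector_mult_def cmat_def w_def)
    then show ?thesis by (simp add: vec_eq_iff B(4) i1 w_def)
  qed
  have "v i1 \<noteq> 0"
  proof
    assume "v i1 = 0"
    then have "axis i1 (1::complex) = 0" using B(5)[of i1] by simp
    then show False by (simp add: axis_eq_0_iff)
  qed
  then have "w \<noteq> 0" by (auto simp: w_def vec_eq_iff)
  then obtain i where i: "(B *v w) $ i \<noteq> 0" using B(2)[of w] by (auto simp: vec_eq_iff)
  have "ev (idx i) * (B *v w) $ i = cnj (ev 1) * (B *v w) $ i"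
    using B(3)[of w i] Mw by (auto simp: vector_scalar_commute)
  then have eq: "ev (idx i) = cnj (ev 1)" using i by simp
  have "idx i \<in> {1..CARD('n)}" using B(1) by (auto simp: bij_betw_def)
  moreover have "\<not> Re (ev (idx i)) < Re (ev 1)" using eq by simp
  ultimately have "idx i = 1" using gap[of "idx i"] by fastforce
  then show ?thesis using eq by (simp add: Reals_cnj_iff)
qed

section \<open>Splitting off the leading real eigenvalue\<close>

text \<open>The functional \<open>\<alpha>\<close> is a real left eigenvector for the leading eigenvalue, normalised on a real
  right eigenvector \<open>r\<close>, and \<open>T u\<close> consists of the eigenvector coordinates of the complementary part
  \<open>u - \<alpha> u *\<^sub>R r\<close>. In these coordinates the linear flow contracts \<open>T\<close> at least as fast as it contracts
  \<open>\<alpha>\<close>, and by \<open>gap\<close> faster if the leading eigenvalue is isolated. In that case the leading coordinate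
  is removed from \<open>T\<close>, since it would not decay fast enough; no information is lost, because a vector
  all of whose other coordinates vanish is a complex, hence a real, multiple of \<open>r\<close>.\<close>

lemma real_leading_splitting:
  fixes M :: "real^'n^'n"
  assumes ind: "independent_eigenvectors (cmat M) ev"
    and real: "ev 1 \<in> \<real>" and \<mu>: "\<mu> = Re (ev 1)"
    and gap: "gap \<ge> 0" "\<And>j. 2 \<le> j \<Longrightarrow> j \<le> CARD('n) \<Longrightarrow> Re (ev j) \<le> \<mu> - gap"
  obtains \<alpha> :: "real^'n \<Rightarrow> real" and T :: "real^'n \<Rightarrow> complex^'n" and r where
    "linear \<alpha>" "linear T" "\<And>u. \<alpha> (M *v u) = \<mu> * \<alpha> u"
    "\<And>u. T u \<bullet> T (M *v u) \<le> (\<mu> - gap) * (norm (T u))\<^sup>2"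
    "\<And>u. \<alpha> u = 0 \<Longrightarrow> T u = 0 \<Longrightarrow> u = 0" "\<alpha> r = 1" "T r = 0"
proof -
  obtain idx :: "'n \<Rightarrow> nat" and B :: "complex^'n^'n" and v :: "'n \<Rightarrow> complex^'n" where B:
    "bij_betw idx UNIV {1..CARD('n)}" "\<And>w. B *v w = 0 \<Longrightarrow> w = 0"
    "\<And>w i. (B *v (cmat M *v w)) $ i = ev (idx i) * (B *v w) $ i"
    "\<And>j. cmat M *v v j = ev (idx j) *s v j" "\<And>j. B *v v j = axis j 1"
    using eigen_coordinates[OF ind] by (elim exE conjE) metis
  have idx_rng: "idx i \<in> {1..CARD('n)}" for i using B(1) by (auto simp: bij_betw_def)
  have "(1::nat) \<in> range idx" unfolding bij_betw_imp_surj_on[OF B(1)] by simp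
  then obtain i1 where i1: "idx i1 = 1" by force
  have other: "Re (ev (idx i)) \<le> \<mu> - gap" if "i \<noteq> i1" for i
  proof -
    have "idx i \<noteq> 1" using B(1) i1 that by (metis bij_betw_imp_inj_on injD)
    then show ?thesis using gap(2)[of "idx i"] idx_rng[of i] by simp
  qed
  have ev1: "ev 1 = complex_of_real \<mu>" using real \<mu> by (simp add: complex_is_Real_iff complex_eq_iff)
  define c where "c i u = (B *v cvec u) $ i" for i u
  have lin_c: "linear (c i)" for i
    unfolding c_def[abs_def]
    by (rule linearI)
       (simp_all add: linear_add[OF linear_cvec] linear_scale[OF linear_cvec]
         linear_add[OF linear_complex_matrix] linear_scale[OF linear_complex_matrix])
  have cM: "c i (M *v u) = ev (idx i) * c i u" for i u
    unfolding c_def using B(3)[of "cvec u" i] by (simp add: cmat_cvec)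
  have c_inj: "u = 0" if "\<And>i. c i u = 0" for u
  proof -
    have "cvec u = 0" by (rule B(2)) (use that in \<open>simp add: vec_eq_iff c_def\<close>)
    then show ?thesis by (simp add: vec_eq_iff)
  qed
  obtain r0 where r0: "M *v r0 = \<mu> *\<^sub>R r0" "c i1 r0 \<noteq> 0"
  proof -
    let ?a = "Re_vec (v i1)" and ?b = "Im_vec (v i1)"
    have "cmat M *v v i1 = cvec (M *v ?a) + \<i> *s cvec (M *v ?b)"
      by (subst cvec_Re_Im) (simp add: matrix_add_smult cmat_cvec)
    moreover have "ev (idx i1) *s v i1 = cvec (\<mu> *\<^sub>R ?a) + \<i> *s cvec (\<mu> *\<^sub>R ?b)"
      unfolding i1 ev1 by (simp add: vec_eq_iff Re_vec_def Im_vec_def complex_eq_iff)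
    ultimately have eig: "M *v ?a = \<mu> *\<^sub>R ?a" "M *v ?b = \<mu> *\<^sub>R ?b"
      using B(4)[of i1] by (simp_all add: cvec_combination_eq_iff)
    have "(B *v v i1) $ i1 = c i1 ?a + \<i> * c i1 ?b"
      unfolding c_def by (subst cvec_Re_Im) (simp add: matrix_add_smult)
    then have "c i1 ?a + \<i> * c i1 ?b = 1" by (simp add: B(5) axis_def)
    then have "c i1 ?a \<noteq> 0 \<or> c i1 ?b \<noteq> 0" by auto
    then show thesis using that eig by blast
  qed
  define \<alpha> where "\<alpha> u = Re (c i1 u / c i1 r0)" for u
  have sc: "Re ((s *\<^sub>R z) / w) = s * Re (z / w)" for s and z w :: complex
    by (simp add: scaleR_conv_of_real flip: times_divide_eq_right)
  have lin_\<alpha>: "linear \<alpha>"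
    by (rule linearI)
       (simp_all add: \<alpha>_def linear_add[OF lin_c] linear_scale[OF lin_c] add_divide_distrib sc)
  have \<alpha>M: "\<alpha> (M *v u) = \<mu> * \<alpha> u" for u
    unfolding \<alpha>_def cM i1 ev1 by (simp flip: times_divide_eq_right)
  have \<alpha>r: "\<alpha> r0 = 1" using r0(2) by (simp add: \<alpha>_def)
  define b where "b u = u - \<alpha> u *\<^sub>R r0" for u
  have lin_b: "linear b"
    by (rule linearI) (simp_all add: b_def linear_add[OF lin_\<alpha>] linear_scale[OF lin_\<alpha>] algebra_simps)
  have bM: "b (M *v u) = M *v b u" for u
    by (simp add: b_def \<alpha>M matrix_vector_mult_diff_distrib matrix_vector_mult_scaleR r0(1) mult.commute)
  define T :: "real^'n \<Rightarrow> complex^'n" where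
    "T u = (\<chi> i. if i = i1 \<and> gap > 0 then 0 else c i (b u))" for u
  have lin_T: "linear T"
    by (rule linearI)
       (simp_all add: T_def vec_eq_iff linear_add[OF lin_b] linear_scale[OF lin_b] linear_add[OF lin_c]
         linear_scale[OF lin_c])
  have "T u \<bullet> T (M *v u) \<le> (\<mu> - gap) * (norm (T u))\<^sup>2" for u
  proof -
    have inner_mult: "z \<bullet> (l * z) = Re l * (z \<bullet> z)" for z l :: complex
      by (simp add: inner_complex_def algebra_simps)
    have "T u \<bullet> T (M *v u) = (\<Sum>i\<in>UNIV. T u $ i \<bullet> T (M *v u) $ i)" by (simp add: inner_vec_def)
    also have "\<dots> = (\<Sum>i\<in>UNIV. Re (ev (idx i)) * (T u $ i \<bullet> T u $ i))"
      by (rule sum.cong) (auto simp: T_def bM cM inner_mult)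
    also have "\<dots> \<le> (\<Sum>i\<in>UNIV. (\<mu> - gap) * (T u $ i \<bullet> T u $ i))"
    proof (rule sum_mono)
      fix i
      show "Re (ev (idx i)) * (T u $ i \<bullet> T u $ i) \<le> (\<mu> - gap) * (T u $ i \<bullet> T u $ i)"
      proof (cases "i = i1")
        case True
        then show ?thesis using gap(1) by (cases "gap > 0") (simp_all add: T_def i1 \<mu>)
      next
        case False
        then show ?thesis using other by (intro mult_right_mono) auto
      qed
    qed
    also have "\<dots> = (\<mu> - gap) * (norm (T u))\<^sup>2"
      by (simp add: power2_norm_eq_inner inner_vec_def sum_distrib_left)
    finally show ?thesis .
  qed
  moreover have "u = 0" if u: "\<alpha> u = 0" "T u = 0" for u
  proof (cases "gap > 0")
    case False
    then have "c i u = 0" for i using u by (simp add: T_def vec_eq_iff b_def)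
    then show ?thesis by (rule c_inj)
  next
    case True
    have cr: "c i r0 = 0" if "i \<noteq> i1" for i
    proof -
      have "ev (idx i) * c i r0 = complex_of_real \<mu> * c i r0"
        using cM[of i r0] r0(1) by (auto simp: linear_scale[OF lin_c] scaleR_conv_of_real[where 'a = complex])
      moreover have "ev (idx i) \<noteq> complex_of_real \<mu>" using other[OF that] True by auto
      ultimately show ?thesis by simp
    qed
    have cu: "c i u = 0" if "i \<noteq> i1" for i
    proof -
      have "T u $ i = 0" using u(2) by simp
      then show ?thesis using u(1) that by (simp add: T_def b_def)
    qed
    have "B *v (cvec u + (- (c i1 u / c i1 r0)) *s cvec r0) = 0"
    proof -
      have "(B *v (cvec u + (- (c i1 u / c i1 r0)) *s cvec r0)) $ i = 0" for i
      proof -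
        have "(B *v (cvec u + (- (c i1 u / c i1 r0)) *s cvec r0)) $ i = c i u - (c i1 u / c i1 r0) * c i r0"
          unfolding matrix_add_smult by (simp add: c_def)
        also have "\<dots> = 0" using cr cu r0(2) by (cases "i = i1") auto
        finally show ?thesis .
      qed
      then show ?thesis unfolding vec_eq_iff zero_index by blast
    qed
    then have "cvec u + (- (c i1 u / c i1 r0)) *s cvec r0 = 0" by (rule B(2))
    then have "complex_of_real (u $ k) = (c i1 u / c i1 r0) * complex_of_real (r0 $ k)" for k
      by (simp add: vec_eq_iff)
    then have "u $ k = Re ((c i1 u / c i1 r0) * complex_of_real (r0 $ k))" for k
      by (metis Re_complex_of_real)
    then have "u $ k = \<alpha> u * r0 $ k" for k
      by (simp only: \<alpha>_def times_complex.sel Re_complex_of_real Im_complex_of_real mult_zero_right diff_zero)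
    then show ?thesis using u(1) by (simp add: vec_eq_iff)
  qed
  moreover have "T r0 = 0"
    by (simp add: T_def b_def \<alpha>r vec_eq_iff linear_0[OF lin_c])
  ultimately show thesis using that[OF lin_\<alpha> lin_T \<alpha>M] \<alpha>r by blast
qed


section \<open>A cone forces a real leading eigenvalue\<close>

text \<open>Removing the apex leaves a convex set, because the cone contains no line. Hence the convex
  hull of its unit vectors misses the origin and can be separated from it.\<close>

lemma pointed_cone_strictly_positive_functional:
  fixes K :: "'a::euclidean_space set"
  assumes "closed K" "\<And>u v. u \<in> K \<Longrightarrow> v \<in> K \<Longrightarrow> u + v \<in> K" "cone K" "K \<inter> uminus ` K = {0}"
  obtains a b where "b > 0" "\<And>u. u \<in> K \<Longrightarrow> a \<bullet> u \<ge> b * norm u"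
proof -
  have scale: "c *\<^sub>R u \<in> K" if "u \<in> K" "c \<ge> 0" for u c
    using assms(3) that by (simp add: cone_def)
  have "convex (K - {0})"
  proof (rule convexI)
    fix x y :: 'a and u v :: real
    assume xy: "x \<in> K - {0}" "y \<in> K - {0}" and uv: "0 \<le> u" "0 \<le> v" "u + v = 1"
    have k: "u *\<^sub>R x \<in> K" "v *\<^sub>R y \<in> K" using scale xy uv by auto
    have "u *\<^sub>R x + v *\<^sub>R y \<noteq> 0"
    proof
      assume eq: "u *\<^sub>R x + v *\<^sub>R y = 0"
      then have "u *\<^sub>R x = - (v *\<^sub>R y)" by (simp add: eq_neg_iff_add_eq_0)
      then have "u *\<^sub>R x \<in> K \<inter> uminus ` K" using k by auto
      then have "u *\<^sub>R x = 0" using assms(4) by auto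
      then show False using eq xy uv by auto
    qed
    then show "u *\<^sub>R x + v *\<^sub>R y \<in> K - {0}" using assms(2) k by simp
  qed
  moreover have "K \<inter> sphere 0 1 \<subseteq> K - {0}" by auto
  ultimately have hull: "convex hull (K \<inter> sphere 0 1) \<subseteq> K - {0}" by (metis hull_minimal)
  have "compact (K \<inter> sphere 0 1)" using assms(1) by (simp add: closed_Int_compact)
  then have "closed (convex hull (K \<inter> sphere 0 1))"
    by (intro compact_imp_closed compact_convex_hull)
  moreover have "0 \<notin> convex hull (K \<inter> sphere 0 1)" using hull by blast
  ultimately obtain a b where ab: "0 < b" "\<And>x. x \<in> convex hull (K \<inter> sphere 0 1) \<Longrightarrow> a \<bullet> x > b"
    using separating_hyperplane_closed_0[OF convex_convex_hull] by metis
  have "a \<bullet> u \<ge> b * norm u" if u: "u \<in> K" for u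
  proof (cases "u = 0")
    case False
    have "inverse (norm u) *\<^sub>R u \<in> K \<inter> sphere 0 1" using scale[OF u] False by simp
    then have "a \<bullet> (inverse (norm u) *\<^sub>R u) > b" using ab(2) hull_inc by metis
    then have "(a \<bullet> u) / norm u > b" by (simp add: divide_inverse mult.commute)
    then show ?thesis using False by (simp add: less_divide_eq)
  qed simp
  then show thesis using that ab(1) by blast
qed

text \<open>Suppose \<open>\<mu>\<close> is not an eigenvalue. A generic trajectory \<open>y\<close> in the cone is of exact order
  \<open>e\<^sup>\<mu>\<^sup>t\<close>, so \<open>z t = exp (- \<mu> t) y t\<close> is bounded and a functional positive on the cone is
  bounded below along it. On the other hand \<open>z\<close> is the derivative of the bounded curve
  \<open>(M - \<mu>)\<^sup>-\<^sup>1 z\<close>, so its averages tend to zero: leading components that only rotate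
  cannot stay in a pointed cone.\<close>

lemma invariant_cone_imp_real_leading_eigenvalue:
  fixes M :: "real^'n^'n" and K :: "(real^'n) set"
  assumes ind: "independent_eigenvectors (cmat M) ev"
    and lead: "\<And>j. 1 \<le> j \<Longrightarrow> j \<le> CARD('n) \<Longrightarrow> Re (ev j) \<le> Re (ev 1)"
    and K: "closed K" "\<And>u v. u \<in> K \<Longrightarrow> v \<in> K \<Longrightarrow> u + v \<in> K" "cone K" "K \<inter> uminus ` K = {0}"
      "interior K \<noteq> {}"
    and Y: "\<And>u. Y 0 u = u" "\<And>u. continuous_on {0..} (\<lambda>t. Y t u)"
      "\<And>t u. 0 < t \<Longrightarrow> ((\<lambda>t. Y t u) has_vector_derivative (M *v Y t u)) (at t)"
      "\<And>t u. 0 < t \<Longrightarrow> u \<in> K \<Longrightarrow> Y t u \<in> K"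
  shows "\<exists>j\<in>{1..CARD('n)}. ev j \<in> \<real> \<and> Re (ev j) = Re (ev 1)"
proof (rule ccontr)
  assume no_real: "\<not> ?thesis"
  define \<mu> where "\<mu> = Re (ev 1)"
  obtain idx :: "'n \<Rightarrow> nat" and B :: "complex^'n^'n" and v :: "'n \<Rightarrow> complex^'n" where B:
    "bij_betw idx UNIV {1..CARD('n)}" "\<And>w. B *v w = 0 \<Longrightarrow> w = 0"
    "\<And>w i. (B *v (cmat M *v w)) $ i = ev (idx i) * (B *v w) $ i"
    "\<And>j. cmat M *v v j = ev (idx j) *s v j" "\<And>j. B *v v j = axis j 1"
    using eigen_coordinates[OF ind] by (elim exE conjE) metis
  have idx_rng: "idx i \<in> {1..CARD('n)}" for i using B(1) by (auto simp: bij_betw_def)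
  have "(1::nat) \<in> range idx" unfolding bij_betw_imp_surj_on[OF B(1)] by simp
  then obtain i1 where i1: "idx i1 = 1" by force
  define c where "c u = B *v cvec u" for u
  have lin_c: "linear c"
    unfolding c_def[abs_def] by (intro linear_compose[OF linear_cvec linear_complex_matrix, unfolded o_def])
  have cM: "c (M *v u) $ i = ev (idx i) * c u $ i" for i u
    unfolding c_def using B(3)[of "cvec u" i] by (simp add: cmat_cvec)
  have c0: "u = 0" if "c u = 0" for u
    using B(2)[of "cvec u"] that by (simp add: c_def vec_eq_iff)
  have c_der: "((\<lambda>t. c (Y t u)) has_vector_derivative c (M *v Y t u)) (at t)" if "0 < t" for t u
    using bounded_linear.has_vector_derivative[OF linear_conv_bounded_linear[THEN iffD1, OF lin_c] Y(3)[OF that]] .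
  have c_cont: "continuous_on {0..} (\<lambda>t. c (Y t u))" for u
    using linear_continuous_on_compose[OF Y(2) lin_c] .
  have c_Y: "c (Y t u) $ i = exp (ev (idx i) * of_real t) * c u $ i" if t: "0 \<le> t" for t u i
  proof -
    let ?l = "ev (idx i)"
    let ?e = "\<lambda>t. exp (- ?l * of_real t) * c (Y t u) $ i - c u $ i"
    have "norm (?e t) \<le> (norm (?e 0) + 0) * exp ((0 + 2) * t)"
    proof (rule gronwall[where T = t and e' = "\<lambda>t. 0"])
      show "continuous_on {0..t} ?e"
        by (intro continuous_intros continuous_on_subset[OF c_cont]) auto
      fix s assume s: "0 < s" "s \<le> t"
      have d1: "((\<lambda>t. c (Y t u) $ i) has_vector_derivative ?l * c (Y s u) $ i) (at s)"
        using bounded_linear.has_vector_derivative[OF bounded_linear_vec_nth c_der[OF s(1)]] by (simp add: cM)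
      have d2: "((\<lambda>t. exp (- ?l * of_real t)) has_vector_derivative - ?l * exp (- ?l * of_real s)) (at s)"
        by (rule has_vector_derivative_real_field) (auto intro!: derivative_eq_intros)
      show "(?e has_vector_derivative 0) (at s)"
        using has_vector_derivative_diff[OF has_vector_derivative_mult[OF d2 d1] has_vector_derivative_const[of "c u $ i"]]
        by simp
    qed (use t in auto)
    then have "exp (- ?l * of_real t) * c (Y t u) $ i = c u $ i" by (simp add: Y(1))
    then show ?thesis by (simp add: exp_minus field_simps)
  qed
  obtain d where d: "c d $ i1 \<noteq> 0"
  proof -
    have "(B *v v i1) $ i1 = c (Re_vec (v i1)) $ i1 + \<i> * c (Im_vec (v i1)) $ i1"
      unfolding c_def by (subst cvec_Re_Im) (simp add: matrix_add_smult)
    then have "c (Re_vec (v i1)) $ i1 \<noteq> 0 \<or> c (Im_vec (v i1)) $ i1 \<noteq> 0"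
      by (auto simp: B(5) axis_def)
    then show thesis using that by blast
  qed
  obtain u where u: "u \<in> K" "c u $ i1 \<noteq> 0"
  proof -
    obtain u0 e where e: "e > 0" "ball u0 e \<subseteq> K" using K(5) mem_interior by blast
    show thesis
    proof (cases "c u0 $ i1 = 0")
      case False
      then show thesis using that[of u0] subsetD[OF e(2), of u0] e(1) by simp
    next
      case True
      have d0: "d \<noteq> 0" using d linear_0[OF lin_c] by auto
      define s where "s = e / (2 * norm d)"
      have s: "s > 0" using e(1) d0 by (simp add: s_def)
      have "u0 + s *\<^sub>R d \<in> K"
        by (rule subsetD[OF e(2)]) (use e(1) d0 in \<open>simp add: dist_norm s_def\<close>)
      moreover have "c (u0 + s *\<^sub>R d) $ i1 \<noteq> 0"
        using True d s by (simp add: linear_add[OF lin_c] linear_scale[OF lin_c])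
      ultimately show thesis using that by blast
    qed
  qed
  obtain a b where ab: "b > 0" "\<And>u. u \<in> K \<Longrightarrow> a \<bullet> u \<ge> b * norm u"
    using pointed_cone_strictly_positive_functional[OF K(1-4)] by metis
  define z where "z t = exp (- \<mu> * t) *\<^sub>R Y t u" for t
  have c_z: "norm (c (z t) $ i) = exp ((Re (ev (idx i)) - \<mu>) * t) * norm (c u $ i)" if "0 \<le> t" for t i
    using c_Y[OF that, of u i]
    by (simp add: z_def linear_scale[OF lin_c] norm_mult exp_diff exp_minus left_diff_distrib field_simps)
  obtain C where C: "C > 0" "\<And>x. norm (c x) \<le> C * norm x"
    using linear_bounded_pos[OF lin_c] by blast
  define \<kappa> where "\<kappa> = b * norm (c u $ i1) / C"
  have \<kappa>: "\<kappa> > 0" using ab(1) u(2) C(1) by (simp add: \<kappa>_def)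
  have lower: "a \<bullet> z t \<ge> \<kappa>" if t: "0 \<le> t" for t
  proof -
    have "Y t u \<in> K" using Y(4)[of t u] Y(1)[of u] u(1) t by (cases "t = 0") auto
    then have "z t \<in> K" using K(3) by (simp add: z_def cone_def)
    then have "a \<bullet> z t \<ge> b * norm (z t)" by (rule ab(2))
    moreover have "norm (c u $ i1) \<le> C * norm (z t)"
      using c_z[OF t, of i1] C(2)[of "z t"] Finite_Cartesian_Product.norm_nth_le[of "c (z t)" i1] by (simp add: i1 \<mu>_def)
    then have "norm (c u $ i1) / C \<le> norm (z t)" using C(1) by (simp add: divide_le_eq mult.commute)
    then have "\<kappa> \<le> b * norm (z t)" using ab(1) mult_left_mono[of _ _ b] by (fastforce simp: \<kappa>_def)
    ultimately show ?thesis by linarith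
  qed
  have "inj c" using c0 linear_injective_0[OF lin_c] by blast
  then obtain b' where b': "b' > 0" "\<And>x. b' * norm x \<le> norm (c x)"
    using linear_inj_bounded_below_pos[OF lin_c] by blast
  define Z where "Z = (\<Sum>i\<in>UNIV. norm (c u $ i)) / b'"
  have z_bdd: "norm (z t) \<le> Z" if t: "0 \<le> t" for t
  proof -
    have "b' * norm (z t) \<le> norm (c (z t))" by (rule b'(2))
    also have "\<dots> \<le> (\<Sum>i\<in>UNIV. norm (c (z t) $ i))" by (simp add: norm_vec_def L2_set_le_sum)
    also have "\<dots> \<le> (\<Sum>i\<in>UNIV. norm (c u $ i))"
    proof (rule sum_mono)
      fix i
      have "(Re (ev (idx i)) - \<mu>) * t \<le> 0"
        using lead[of "idx i"] idx_rng[of i] t by (auto simp: \<mu>_def mult_nonpos_nonneg)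
      then show "norm (c (z t) $ i) \<le> norm (c u $ i)"
        unfolding c_z[OF t] by (simp add: mult_left_le_one_le)
    qed
    finally show ?thesis using b'(1) by (simp add: Z_def le_divide_eq mult.commute)
  qed
  \<comment> \<open>Since \<open>\<mu>\<close> is not an eigenvalue, \<open>Q = M - \<mu>\<close> is invertible and \<open>z\<close>, which solves
    \<open>z' = Q z\<close>, is the derivative of \<open>N z\<close> with \<open>N = Q\<^sup>-\<^sup>1\<close>.\<close>
  define Q where "Q x = M *v x - \<mu> *\<^sub>R x" for x
  have lin_Q: "linear Q"
    by (rule linearI) (simp_all add: Q_def matrix_vector_right_distrib algebra_simps matrix_vector_mult_scaleR)
  have "x = 0" if "Q x = 0" for x
  proof (rule c0)
    have "M *v x = \<mu> *\<^sub>R x" using that by (simp add: Q_def)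
    then have "ev (idx i) * c x $ i = \<mu> * c x $ i" for i
      using cM[of x i] by (auto simp: linear_scale[OF lin_c] scaleR_conv_of_real[where 'a = complex])
    moreover have "ev (idx i) \<noteq> \<mu>" for i
      using no_real idx_rng[of i] by (metis Re_complex_of_real Reals_of_real \<mu>_def)
    ultimately show "c x = 0" by (simp add: vec_eq_iff)
  qed
  then have "inj Q" using linear_injective_0[OF lin_Q] by blast
  then obtain N where N: "linear N" "N \<circ> Q = id" using linear_injective_left_inverse[OF lin_Q] by blast
  define G where "G t = a \<bullet> N (z t)" for t
  obtain CN where CN: "CN > 0" "\<And>x. norm (N x) \<le> CN * norm x" using linear_bounded_pos[OF N(1)] by blast
  have G_bdd: "\<bar>G t\<bar> \<le> norm a * (CN * Z)" if t: "0 \<le> t" for t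
  proof -
    have "\<bar>G t\<bar> \<le> norm a * norm (N (z t))" unfolding G_def by (rule Cauchy_Schwarz_ineq2)
    also have "\<dots> \<le> norm a * (CN * Z)"
      using CN(2)[of "z t"] z_bdd[OF t] CN(1)
      by (intro mult_left_mono) (auto intro: order_trans mult_left_mono)
    finally show ?thesis .
  qed
  have G_der: "(G has_real_derivative a \<bullet> z t) (at t)" if t: "0 < t" for t
  proof -
    have "(z has_vector_derivative (- \<mu> * exp (- \<mu> * t)) *\<^sub>R Y t u + exp (- \<mu> * t) *\<^sub>R (M *v Y t u)) (at t)"
      unfolding z_def[abs_def]
      by (rule has_vector_derivative_eq_rhs[OF has_vector_derivative_scaleR[OF _ Y(3)[OF t]]])
         (auto intro!: derivative_eq_intros)
    moreover have "(- \<mu> * exp (- \<mu> * t)) *\<^sub>R Y t u + exp (- \<mu> * t) *\<^sub>R (M *v Y t u) = Q (z t)"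
      by (simp add: Q_def z_def matrix_vector_mult_scaleR)
    ultimately have "(z has_vector_derivative Q (z t)) (at t)" by simp
    from bounded_linear.has_vector_derivative[OF linear_conv_bounded_linear[THEN iffD1, OF N(1)] this]
    have "((\<lambda>t. N (z t)) has_vector_derivative z t) (at t)"
      using fun_cong[OF N(2), of "z t"] by simp
    from bounded_linear.has_vector_derivative[OF bounded_linear_inner_right this]
    show ?thesis unfolding G_def[abs_def] has_real_derivative_iff_has_vector_derivative .
  qed
  have G_cont: "continuous_on {0..} G"
  proof -
    have "continuous_on {0..} z" unfolding z_def[abs_def] by (intro continuous_intros Y(2))
    then have "continuous_on {0..} (\<lambda>t. N (z t))" using linear_continuous_on_compose N(1) by blast
    then show ?thesis unfolding G_def[abs_def] by (intro continuous_intros)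
  qed
  define t where "t = (2 * norm a * (CN * Z) + 1) / \<kappa>"
  have "Z \<ge> 0" using z_bdd[of 0] norm_ge_zero[of "z 0"] by linarith
  then have t: "t > 0" using \<kappa> CN(1) by (simp add: t_def add_nonneg_pos)
  have "G 0 - \<kappa> * 0 \<le> G t - \<kappa> * t"
  proof (rule DERIV_nonneg_imp_increasing_open[of 0 t "\<lambda>t. G t - \<kappa> * t"])
    show "\<exists>y. ((\<lambda>t. G t - \<kappa> * t) has_real_derivative y) (at x) \<and> 0 \<le> y" if "0 < x" "x < t" for x
      using lower[of x] that
      by (intro exI[of _ "a \<bullet> z x - \<kappa>"] conjI DERIV_diff G_der) (auto intro!: derivative_eq_intros)
    show "continuous_on {0..t} (\<lambda>t. G t - \<kappa> * t)"
      by (intro continuous_intros continuous_on_subset[OF G_cont]) auto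
  qed (use t in simp)
  then have "\<kappa> * t \<le> G t - G 0" by simp
  also have "\<dots> \<le> 2 * norm a * (CN * Z)" using G_bdd[of t] G_bdd[of 0] t by linarith
  finally show False using \<kappa> by (simp add: t_def)
qed

section \<open>Cones around the leading direction near a sink\<close>

text \<open>A sink whose linearisation splits into a leading direction, measured by \<open>\<alpha>\<close>, and a complement,
  measured by \<open>T\<close>, that decays faster by the rate \<open>gap \<ge> 0\<close>. The vector \<open>r\<close> spans the leading
  direction. The last assumption is what a second derivative of \<open>f\<close> at \<open>p\<close> provides.\<close>
locale split_sink = C1_flow f F \<psi>
  for f :: "'a::euclidean_space \<Rightarrow> 'a" and F :: "'a \<Rightarrow> 'a \<Rightarrow>\<^sub>L 'a" and \<psi> :: "real \<Rightarrow> 'a \<Rightarrow> 'a" +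
  fixes p :: 'a and \<mu> gap :: real and \<alpha> :: "'a \<Rightarrow> real" and T :: "'a \<Rightarrow> 'b::euclidean_space" and r :: 'a
  assumes f_p: "f p = 0"
    and \<mu>_neg: "\<mu> < 0" and gap_nonneg: "gap \<ge> 0"
    and lin_\<alpha>: "linear \<alpha>" and lin_T: "linear T"
    and \<alpha>_F: "\<alpha> (F p u) = \<mu> * \<alpha> u"
    and T_F: "T u \<bullet> T (F p u) \<le> (\<mu> - gap) * (norm (T u))\<^sup>2"
    and \<alpha>_T_inj: "\<alpha> u = 0 \<Longrightarrow> T u = 0 \<Longrightarrow> u = 0"
    and \<alpha>_r: "\<alpha> r = 1" and T_r: "T r = 0"
    and F_lipschitz_at_p: "\<exists>\<rho>>0. \<exists>L. \<forall>x. norm (x - p) < \<rho> \<longrightarrow> norm (F x - F p) \<le> L * norm (x - p)"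
begin

definition S :: "'a \<Rightarrow> real \<times> 'b" where "S u = (\<alpha> u, T u)"

text \<open>The distance to \<open>p\<close> in the norm adapted to the splitting, for which the linear flow contracts
  from the very beginning and not just asymptotically.\<close>
definition W :: "'a \<Rightarrow> real" where "W x = norm (S (x - p))"

lemma lin_S: "linear S"
  by (rule linearI) (simp_all add: S_def linear_add[OF lin_\<alpha>] linear_add[OF lin_T]
      linear_scale[OF lin_\<alpha>] linear_scale[OF lin_T])

lemma inj_S: "inj S"
  using linear_injective_0[OF lin_S] \<alpha>_T_inj by (simp add: S_def zero_prod_def)

lemma abs_\<alpha>_le: "\<bar>\<alpha> u\<bar> \<le> norm (S u)"
  using norm_fst_le[of "\<alpha> u" "T u"] by (simp add: S_def)

lemma norm_T_le: "norm (T u) \<le> norm (S u)"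
  using norm_snd_le[of "T u" "\<alpha> u"] by (simp add: S_def)

lemma norm_S_le: "norm (S u) \<le> \<bar>\<alpha> u\<bar> + norm (T u)"
  using norm_Pair_le[of "\<alpha> u" "T u"] by (simp add: S_def)

lemma S_F: "S u \<bullet> S (F p u) \<le> \<mu> * (norm (S u))\<^sup>2"
proof -
  have "S u \<bullet> S (F p u) = \<mu> * (\<alpha> u)\<^sup>2 + T u \<bullet> T (F p u)"
    by (simp add: S_def \<alpha>_F power2_eq_square)
  also have "\<dots> \<le> \<mu> * (\<alpha> u)\<^sup>2 + \<mu> * (norm (T u))\<^sup>2"
  proof -
    have "(\<mu> - gap) * (norm (T u))\<^sup>2 \<le> \<mu> * (norm (T u))\<^sup>2"
      using gap_nonneg by (intro mult_right_mono) auto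
    then show ?thesis using T_F[of u] by linarith
  qed
  also have "\<dots> = \<mu> * (norm (S u))\<^sup>2"
    by (simp add: S_def norm_Pair distrib_left)
  finally show ?thesis .
qed

lemma W_nonneg: "W x \<ge> 0" by (simp add: W_def)

lemma continuous_on_W: "continuous_on X W"
  unfolding W_def[abs_def]
  by (intro continuous_on_norm linear_continuous_on_compose[OF _ lin_S] continuous_intros)

lemma norm_le_W: obtains m where "m > 0" "\<And>x. m * norm (x - p) \<le> W x"
  using linear_inj_bounded_below_pos[OF lin_S inj_S] unfolding W_def by metis

lemma local_estimates:
  obtains \<rho> C where "\<rho> > 0" "C \<ge> 0"
    "\<And>x. W x \<le> \<rho> \<Longrightarrow> S (x - p) \<bullet> S (f x) \<le> (3 / 4) * \<mu> * (W x)\<^sup>2"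
    "\<And>x u. W x \<le> \<rho> \<Longrightarrow> norm (S ((F x - F p) u)) \<le> C * W x * norm (S u)"
proof -
  obtain m where m: "m > 0" "\<And>u. m * norm u \<le> norm (S u)"
    using linear_inj_bounded_below_pos[OF lin_S inj_S] by blast
  obtain M where M: "M > 0" "\<And>u. norm (S u) \<le> M * norm u"
    using linear_bounded_pos[OF lin_S] by blast
  have m': "norm u \<le> norm (S u) / m" for u using m by (simp add: le_divide_eq mult.commute)
  \<comment> \<open>With this \<open>\<epsilon>\<close> the nonlinear part of \<open>f\<close> costs a quarter of the contraction rate.\<close>
  define \<epsilon> where "\<epsilon> = (- \<mu> / 4) * m / M"
  have \<epsilon>: "\<epsilon> > 0" "M * \<epsilon> / m = - \<mu> / 4" using \<mu>_neg m M by (auto simp: \<epsilon>_def divide_neg_pos mult_neg_pos)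
  obtain d1 where d1: "d1 > 0" "\<And>x. norm (x - p) < d1 \<Longrightarrow> norm (f x - f p - F p (x - p)) \<le> \<epsilon> * norm (x - p)"
    using f_deriv[of p] \<epsilon>(1) unfolding has_derivative_at_alt by blast
  obtain d2 L where d2: "d2 > 0" "\<And>x. norm (x - p) < d2 \<Longrightarrow> norm (F x - F p) \<le> L * norm (x - p)"
    using F_lipschitz_at_p by blast
  define \<rho> where "\<rho> = min d1 d2 * m / 2"
  have near: "norm (x - p) < min d1 d2" if "W x \<le> \<rho>" for x
  proof -
    have "norm (x - p) \<le> W x / m" using m' by (simp add: W_def)
    also have "\<dots> \<le> \<rho> / m" using that m(1) by (intro divide_right_mono) auto
    also have "\<dots> < min d1 d2" using m(1) d1(1) d2(1) by (simp add: \<rho>_def min_def)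
    finally show ?thesis .
  qed
  have e1: "S (x - p) \<bullet> S (f x) \<le> (3 / 4) * \<mu> * (W x)\<^sup>2" if x: "W x \<le> \<rho>" for x
  proof -
    define z e where "z = x - p" and "e = f x - F p z"
    have "norm (S e) \<le> M * (\<epsilon> * norm z)"
      using M(2)[of e] d1(2)[of x] near[OF x] M(1)
      by (smt (verit) e_def f_p diff_zero min_less_iff_conj mult_left_mono z_def)
    also have "\<dots> \<le> M * (\<epsilon> * (norm (S z) / m))" using M(1) \<epsilon>(1) m' by (intro mult_left_mono) auto
    also have "\<dots> = (- \<mu> / 4) * norm (S z)" using \<epsilon>(2) by (metis times_divide_eq_right times_divide_eq_left mult.assoc)
    finally have e: "norm (S e) \<le> (- \<mu> / 4) * norm (S z)" .
    have "S z \<bullet> S (f x) = S z \<bullet> S (F p z) + S z \<bullet> S e"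
      by (simp add: e_def linear_diff[OF lin_S] inner_diff_right)
    also have "\<dots> \<le> \<mu> * (norm (S z))\<^sup>2 + norm (S z) * ((- \<mu> / 4) * norm (S z))"
      using norm_cauchy_schwarz[of "S z" "S e"] mult_left_mono[OF e norm_ge_zero[of "S z"]]
      by (intro add_mono S_F) linarith
    also have "\<dots> = (3 / 4) * \<mu> * (norm (S z))\<^sup>2" by (simp add: power2_eq_square)
    finally show ?thesis by (simp add: W_def z_def)
  qed
  define C where "C = M * \<bar>L\<bar> / (m * m)"
  have e2: "norm (S ((F x - F p) u)) \<le> C * W x * norm (S u)" if x: "W x \<le> \<rho>" for x u
  proof -
    have "norm (S ((F x - F p) u)) \<le> M * norm ((F x - F p) u)" by (rule M(2))
    also have "\<dots> \<le> M * ((\<bar>L\<bar> * (W x / m)) * (norm (S u) / m))"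
    proof -
      have "norm (F x - F p) \<le> L * norm (x - p)" using d2(2) near[OF x] by simp
      also have "\<dots> \<le> \<bar>L\<bar> * (W x / m)" using m'[of "x - p"] by (intro mult_mono) (auto simp: W_def)
      finally have "norm (F x - F p) * norm u \<le> (\<bar>L\<bar> * (W x / m)) * (norm (S u) / m)"
        using m'[of u] m(1) W_nonneg by (intro mult_mono) auto
      then show ?thesis using norm_blinfun[of "F x - F p" u] M(1) by (intro mult_left_mono) auto
    qed
    also have "\<dots> = C * W x * norm (S u)" by (simp add: C_def)
    finally show ?thesis .
  qed
  have "\<rho> > 0" using d1 d2 m by (simp add: \<rho>_def)
  moreover have "C \<ge> 0" using M m by (simp add: C_def)
  ultimately show thesis using that e1 e2 by blast
qed

text \<open>The constant \<open>C\<close> weighs \<open>W\<close> against the aperture of the cones. The factor \<open>9\<close> is the largest value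
  of \<open>(1 + c)\<^sup>2\<close> for apertures \<open>c \<le> 2\<close>; this is the size of the perturbation in the Riccati inequality.\<close>
definition good_constants :: "real \<Rightarrow> real \<Rightarrow> real \<Rightarrow> bool" where
  "good_constants \<rho> C\<^sub>1 C \<longleftrightarrow> \<rho> > 0 \<and> C\<^sub>1 \<ge> 0 \<and> C > 0 \<and> C * (- \<mu> / 4) > 9 * C\<^sub>1 \<and>
    (\<forall>x. W x \<le> \<rho> \<longrightarrow> S (x - p) \<bullet> S (f x) \<le> (3 / 4) * \<mu> * (W x)\<^sup>2) \<and>
    (\<forall>x u. W x \<le> \<rho> \<longrightarrow> norm (S ((F x - F p) u)) \<le> C\<^sub>1 * W x * norm (S u))"

lemma good_constants_exist: obtains \<rho> C\<^sub>1 C where "good_constants \<rho> C\<^sub>1 C"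
proof -
  obtain \<rho> C where 1: "\<rho> > 0" "C \<ge> 0"
    "\<And>x. W x \<le> \<rho> \<Longrightarrow> S (x - p) \<bullet> S (f x) \<le> (3 / 4) * \<mu> * (W x)\<^sup>2"
    "\<And>x u. W x \<le> \<rho> \<Longrightarrow> norm (S ((F x - F p) u)) \<le> C * W x * norm (S u)"
    using local_estimates by blast
  have "4 * (9 * C + 1) / (- \<mu>) > 0" using 1(2) \<mu>_neg by (intro divide_pos_pos) auto
  moreover have "(4 * (9 * C + 1) / (- \<mu>)) * (- \<mu> / 4) > 9 * C"
  proof -
    have "(4 * (9 * C + 1) / (- \<mu>)) * (- \<mu> / 4) = 9 * C + 1" using \<mu>_neg by (simp add: field_simps)
    then show ?thesis by linarith
  qed
  ultimately have "good_constants \<rho> C (4 * (9 * C + 1) / (- \<mu>))"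
    using 1 unfolding good_constants_def by blast
  then show thesis by (rule that)
qed

text \<open>The rate at which cones contract. It is positive exactly if \<open>gap\<close> is, and it stays well below the
  rate \<open>- \<mu> / 2\<close> at which \<open>W\<close> decays.\<close>
definition \<gamma> :: real where "\<gamma> = min gap (- \<mu> / 4)"

lemma \<gamma>_nonneg: "\<gamma> \<ge> 0" using gap_nonneg \<mu>_neg by (simp add: \<gamma>_def)

lemma \<gamma>_le: "\<gamma> \<le> gap" "\<gamma> \<le> - \<mu> / 4" by (simp_all add: \<gamma>_def)

lemma W_decay_strict:
  assumes gc: "good_constants \<rho> C\<^sub>1 C" and w: "W x < w" "w \<le> \<rho>" and t: "0 \<le> t"
  shows "W (\<psi> t x) < w * exp (\<mu> / 2 * t)"
proof -
  define z where "z t = S (\<psi> t x - p)" for t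
  have z_der: "(z has_vector_derivative S (f (\<psi> s x))) (at s)" for s
  proof -
    have "((\<lambda>s. \<psi> s x - p) has_vector_derivative f (\<psi> s x) - 0) (at s)"
      by (intro has_vector_derivative_diff flow_ode has_vector_derivative_const)
    from bounded_linear.has_vector_derivative[OF linear_conv_bounded_linear[THEN iffD1, OF lin_S] this]
    show ?thesis by (simp add: z_def[abs_def])
  qed
  have w0: "w > 0" using w(1) W_nonneg[of x] by linarith
  define \<phi> where "\<phi> s = w * exp (\<mu> / 2 * s) - norm (z s)" for s
  have "\<phi> t > 0"
  proof (rule positive_until_first_zero[where \<phi> = \<phi> and T = t])
    show "continuous_on {0..t} \<phi>" unfolding \<phi>_def
      using z_der by (intro continuous_intros continuous_at_imp_continuous_on ballI)
        (auto intro: has_vector_derivative_continuous)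
    show "\<phi> 0 > 0" using w(1) by (simp add: \<phi>_def z_def flow_0 W_def)
    fix s assume s: "0 < s" "s \<le> t" "\<phi> s = 0"
    then have ne: "norm (z s) = w * exp (\<mu> / 2 * s)" by (simp add: \<phi>_def)
    then have pos: "norm (z s) > 0" using w0 by simp
    have "norm (z s) \<le> w * 1" unfolding ne using w0 \<mu>_neg s(1)
      by (intro mult_left_mono) (auto simp: mult_nonpos_nonneg)
    then have "W (\<psi> s x) \<le> \<rho>" using w(2) by (simp add: W_def z_def)
    then have "z s \<bullet> S (f (\<psi> s x)) \<le> (3 / 4) * \<mu> * (norm (z s))\<^sup>2"
      using gc unfolding good_constants_def z_def W_def by blast
    then have le: "S (f (\<psi> s x)) \<bullet> z s / norm (z s) \<le> (3 / 4) * \<mu> * norm (z s)"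
      using pos by (simp add: divide_le_eq power2_eq_square inner_commute mult.assoc)
    have D: "(\<phi> has_real_derivative (w * (\<mu> / 2 * exp (\<mu> / 2 * s)) - S (f (\<psi> s x)) \<bullet> z s / norm (z s))) (at s)"
      unfolding \<phi>_def using norm_has_real_derivative[OF z_der, of s] pos
      by (auto intro!: derivative_eq_intros)
    have "(3 / 4) * \<mu> * norm (z s) < \<mu> / 2 * norm (z s)"
      using \<mu>_neg pos by (intro mult_strict_right_mono) auto
    then have "w * (\<mu> / 2 * exp (\<mu> / 2 * s)) - S (f (\<psi> s x)) \<bullet> z s / norm (z s) > 0"
      using le unfolding ne by (simp add: mult_ac)
    then show "\<exists>D>0. (\<phi> has_real_derivative D) (at s)" using D by blast
  qed (use t in auto)
  then show ?thesis by (simp add: \<phi>_def z_def W_def)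
qed

lemma W_decay:
  assumes gc: "good_constants \<rho> C\<^sub>1 C" and x: "W x < \<rho>" and t: "0 \<le> t"
  shows "W (\<psi> t x) \<le> W x * exp (\<mu> / 2 * t)"
proof (rule tendsto_lowerbound)
  show "((\<lambda>w. w * exp (\<mu> / 2 * t)) \<longlongrightarrow> W x * exp (\<mu> / 2 * t)) (at_right (W x))"
    by (intro tendsto_intros)
  show "\<forall>\<^sub>F w in at_right (W x). W (\<psi> t x) \<le> w * exp (\<mu> / 2 * t)"
    using eventually_at_right_real[OF x]
    by eventually_elim (use W_decay_strict[OF gc _ _ t] in fastforce)
qed simp

text \<open>The quotient \<open>norm (T y) / \<alpha> y\<close> of a tangent vector \<open>y\<close> obeys a Riccati inequality whose
  inhomogeneous part is of the order of \<open>W\<close>, hence of \<open>w exp (\<mu> t / 2)\<close>. The explicit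
  supersolution \<open>c\<close> absorbs it; the strict slack in \<open>w\<close> and \<open>Y\<close> makes the crossing transversal.\<close>

lemma cone_estimate_strict:
  assumes gc: "good_constants \<rho> C\<^sub>1 C" and w: "W x < w" "w \<le> \<rho>"
    and Y: "Y \<le> 2" and u: "\<alpha> u > 0" "norm (T u) < (Y - C * w) * \<alpha> u" and t: "0 \<le> t"
  shows "norm (T (D\<psi> t x u)) < (exp (- \<gamma> * t) * Y - C * w * exp (\<mu> / 2 * t)) * \<alpha> (D\<psi> t x u)"
    and "\<alpha> (D\<psi> t x u) > 0"
proof -
  have gcs: "C\<^sub>1 \<ge> 0" "C > 0" "C * (- \<mu> / 4) > 9 * C\<^sub>1"
    "\<And>x u. W x \<le> \<rho> \<Longrightarrow> norm (S ((F x - F p) u)) \<le> C\<^sub>1 * W x * norm (S u)"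
    using gc unfolding good_constants_def by auto
  have w0: "w > 0" using w(1) W_nonneg[of x] by linarith
  have Yw: "Y - C * w > 0"
  proof (rule ccontr)
    assume "\<not> ?thesis"
    then have "(Y - C * w) * \<alpha> u \<le> 0" using u(1) by (intro mult_nonpos_nonneg) auto
    then show False using u(2) norm_ge_zero[of "T u"] by linarith
  qed
  define c where "c s = exp (- \<gamma> * s) * Y - C * w * exp (\<mu> / 2 * s)" for s
  define y where "y s = D\<psi> s x u" for s
  have c_pos: "c s > 0" if "0 \<le> s" for s
  proof -
    have "\<mu> / 2 * s \<le> - \<gamma> * s" using \<gamma>_le(2) \<mu>_neg that by (intro mult_right_mono) auto
    then have "C * w * exp (\<mu> / 2 * s) \<le> C * w * exp (- \<gamma> * s)"
      using gcs w0 by (intro mult_left_mono) auto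
    moreover have "exp (- \<gamma> * s) * (Y - C * w) > 0" using Yw by simp
    moreover have "exp (- \<gamma> * s) * (Y - C * w) = exp (- \<gamma> * s) * Y - C * w * exp (- \<gamma> * s)"
      by (simp add: algebra_simps)
    ultimately show ?thesis unfolding c_def by linarith
  qed
  have c_le: "c s \<le> 2" if "0 \<le> s" for s
  proof -
    have "C * w > 0" using gcs(2) w0 by simp
    then have "Y \<ge> 0" using Yw by linarith
    then have "exp (- \<gamma> * s) * Y \<le> 1 * 2"
      using Y \<gamma>_nonneg that by (intro mult_mono) (auto intro: mult_nonneg_nonneg)
    moreover have "C * w * exp (\<mu> / 2 * s) \<ge> 0" using gcs w0 by simp
    ultimately show ?thesis unfolding c_def by linarith
  qed
  have y_cont: "continuous_on {0..t} y"
    unfolding y_def[abs_def] by (rule continuous_on_subset[OF D\<psi>_continuous_time]) auto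
  have \<alpha>y_cont: "continuous_on {0..t} (\<lambda>s. \<alpha> (y s))"
    using linear_continuous_on_compose[OF y_cont lin_\<alpha>] .
  have u0: "u \<noteq> 0" using u(1) linear_0[OF lin_\<alpha>] by auto
  define \<phi> where "\<phi> s = c s * \<alpha> (y s) - norm (T (y s))" for s
  have \<phi>_pos: "\<phi> s' > 0" if s': "0 \<le> s'" "s' \<le> t" for s'
  proof (rule positive_until_first_zero[where \<phi> = \<phi> and T = t])
    show "continuous_on {0..t} \<phi>" unfolding \<phi>_def c_def
      by (intro continuous_intros \<alpha>y_cont linear_continuous_on_compose[OF y_cont lin_T])
    show "\<phi> 0 > 0" using u(2) by (simp add: \<phi>_def c_def y_def D\<psi>_0)
    fix s assume s: "0 < s" "s \<le> t" "\<phi> s = 0" and before: "\<And>s'. 0 \<le> s' \<Longrightarrow> s' < s \<Longrightarrow> \<phi> s' > 0"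
    define a where "a = \<alpha> (y s)"
    have "\<alpha> (y s') \<ge> 0" if "0 \<le> s'" "s' < s" for s'
    proof -
      have "c s' * \<alpha> (y s') > 0" using before[OF that] norm_ge_zero[of "T (y s')"] unfolding \<phi>_def by linarith
      then show ?thesis using c_pos[OF that(1)] by (simp add: zero_less_mult_iff)
    qed
    then have "\<alpha> (y s) \<ge> 0"
    proof (intro tendsto_lowerbound[of "\<lambda>s. \<alpha> (y s)" _ "at_left s"])
      have "continuous_on {0..s} (\<lambda>s. \<alpha> (y s))" using \<alpha>y_cont by (rule continuous_on_subset) (use s in auto)
      then show "((\<lambda>s. \<alpha> (y s)) \<longlongrightarrow> \<alpha> (y s)) (at_left s)"
        using s(1) unfolding continuous_on_def by (metis atLeastAtMost_iff at_within_Icc_at_left less_imp_le order_refl)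
      show "\<forall>\<^sub>F s' in at_left s. 0 \<le> \<alpha> (y s')" if "\<And>s'. 0 \<le> s' \<Longrightarrow> s' < s \<Longrightarrow> 0 \<le> \<alpha> (y s')"
        using eventually_at_left_real[OF s(1)] by eventually_elim (use that in auto)
    qed simp
    moreover have ne: "norm (T (y s)) = c s * a" using s(3) by (simp add: \<phi>_def a_def)
    moreover have "y s \<noteq> 0" using D\<psi>_nonzero[OF u0] s(1) by (simp add: y_def)
    ultimately have a: "a > 0" using \<alpha>_T_inj[of "y s"] by (cases "a = 0") (auto simp: a_def)
    have cs: "c s > 0" "c s \<le> 2" using c_pos c_le s(1) by auto
    have Ty: "norm (T (y s)) > 0" unfolding ne using a cs by simp
    define \<delta> where "\<delta> = C\<^sub>1 * (w * exp (\<mu> / 2 * s))"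
    define e where "e = (F (\<psi> s x) - F p) (y s)"
    have W_s: "W (\<psi> s x) < w * exp (\<mu> / 2 * s)" using W_decay_strict[OF gc w] s(1) by simp
    also have "\<dots> \<le> w * 1" using w0 \<mu>_neg s(1) by (intro mult_left_mono) (auto simp: mult_nonpos_nonneg)
    finally have "norm (S e) \<le> C\<^sub>1 * W (\<psi> s x) * norm (S (y s))" unfolding e_def using gcs(4) w(2) by simp
    also have "\<dots> \<le> \<delta> * ((1 + c s) * a)"
    proof (intro mult_mono)
      show "C\<^sub>1 * W (\<psi> s x) \<le> \<delta>" unfolding \<delta>_def using W_s gcs(1) by (intro mult_left_mono) auto
      show "norm (S (y s)) \<le> (1 + c s) * a"
        using norm_S_le[of "y s"] a ne by (simp add: a_def[symmetric] distrib_right)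
    qed (use gcs(1) w0 in \<open>auto simp: \<delta>_def\<close>)
    finally have Se: "norm (S e) \<le> \<delta> * ((1 + c s) * a)" .
    have Fy: "F (\<psi> s x) (y s) = F p (y s) + e" by (simp add: e_def blinfun.diff_left)
    have y_der: "(y has_vector_derivative F (\<psi> s x) (y s)) (at s)"
      unfolding y_def[abs_def] using D\<psi>_ode s(1) by simp
    have \<alpha>_der: "((\<lambda>s. \<alpha> (y s)) has_real_derivative \<mu> * a + \<alpha> e) (at s)"
      using bounded_linear.has_vector_derivative[OF linear_conv_bounded_linear[THEN iffD1, OF lin_\<alpha>] y_der]
      unfolding has_real_derivative_iff_has_vector_derivative Fy a_def
      by (simp add: linear_add[OF lin_\<alpha>] \<alpha>_F)
    have T_der: "((\<lambda>s. norm (T (y s))) has_real_derivative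
        (T (F (\<psi> s x) (y s)) \<bullet> T (y s) / norm (T (y s)))) (at s)"
      by (rule norm_has_real_derivative[OF
            bounded_linear.has_vector_derivative[OF linear_conv_bounded_linear[THEN iffD1, OF lin_T] y_der]])
         (use Ty in auto)
    have T_le: "T (F (\<psi> s x) (y s)) \<bullet> T (y s) / norm (T (y s)) \<le> (\<mu> - gap) * (c s * a) + \<delta> * ((1 + c s) * a)"
    proof -
      have "T (F (\<psi> s x) (y s)) \<bullet> T (y s) = T (y s) \<bullet> T (F p (y s)) + T (y s) \<bullet> T e"
        unfolding Fy by (simp add: linear_add[OF lin_T] inner_add_left inner_add_right inner_commute)
      also have "\<dots> \<le> (\<mu> - gap) * (norm (T (y s)))\<^sup>2 + norm (T (y s)) * norm (T e)"
        by (intro add_mono T_F norm_cauchy_schwarz)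
      also have "\<dots> \<le> (\<mu> - gap) * (norm (T (y s)))\<^sup>2 + norm (T (y s)) * (\<delta> * ((1 + c s) * a))"
        by (intro add_left_mono mult_left_mono order_trans[OF norm_T_le Se]) simp
      also have "\<dots> = ((\<mu> - gap) * (c s * a) + \<delta> * ((1 + c s) * a)) * norm (T (y s))"
        unfolding ne by (simp add: power2_eq_square algebra_simps)
      finally show ?thesis using Ty by (simp add: divide_le_eq)
    qed
    define c' where "c' = - \<gamma> * exp (- \<gamma> * s) * Y - C * w * (\<mu> / 2 * exp (\<mu> / 2 * s))"
    have c_der: "(c has_real_derivative c') (at s)"
      unfolding c_def[abs_def] c'_def by (auto intro!: derivative_eq_intros)
    have D: "(\<phi> has_real_derivative (c' * a + (\<mu> * a + \<alpha> e) * c s - T (F (\<psi> s x) (y s)) \<bullet> T (y s) / norm (T (y s)))) (at s)"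
      unfolding \<phi>_def[abs_def] a_def by (intro DERIV_diff DERIV_mult c_der \<alpha>_der[unfolded a_def] T_der)
    \<comment> \<open>That is, \<open>c' > - gap * c + 9 * \<delta>\<close>: the strict supersolution property of \<open>c\<close>.\<close>
    have riccati: "c' + gap * c s > 9 * \<delta>"
    proof -
      define E where "E = w * exp (\<mu> / 2 * s)"
      have E: "E > 0" using w0 by (simp add: E_def)
      have "C * (- \<mu> / 4) \<le> C * (- \<mu> / 2 - \<gamma>)" using \<gamma>_le(2) gcs(2) by (intro mult_left_mono) auto
      then have "9 * C\<^sub>1 < C * (- \<mu> / 2 - \<gamma>)" using gcs(3) by linarith
      then have "9 * C\<^sub>1 * E < C * (- \<mu> / 2 - \<gamma>) * E" using E by (rule mult_strict_right_mono)
      also have "\<dots> = c' + \<gamma> * c s" unfolding c'_def c_def E_def by (simp add: algebra_simps)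
      also have "\<dots> \<le> c' + gap * c s" using \<gamma>_le(1) cs by (simp add: mult_right_mono)
      finally show ?thesis by (simp add: \<delta>_def E_def mult.assoc)
    qed
    have "(1 + c s) * (1 + c s) \<le> 3 * 3" using cs by (intro mult_mono) auto
    then have "\<delta> * ((1 + c s) * (1 + c s)) \<le> \<delta> * 9"
      using gcs(1) w0 by (intro mult_left_mono) (auto simp: \<delta>_def)
    then have "c' + gap * c s - \<delta> * ((1 + c s) * (1 + c s)) > 0" using riccati by linarith
    then have "0 < a * (c' + gap * c s - \<delta> * ((1 + c s) * (1 + c s)))" using a by simp
    also have "\<dots> = c' * a + \<mu> * a * c s - (\<delta> * ((1 + c s) * a)) * c s
        - ((\<mu> - gap) * (c s * a) + \<delta> * ((1 + c s) * a))"
      by (simp add: algebra_simps)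
    also have "\<dots> \<le> c' * a + (\<mu> * a + \<alpha> e) * c s - T (F (\<psi> s x) (y s)) \<bullet> T (y s) / norm (T (y s))"
    proof -
      have "- (\<delta> * ((1 + c s) * a)) \<le> \<alpha> e" using abs_\<alpha>_le[of e] Se by linarith
      then have "- (\<delta> * ((1 + c s) * a)) * c s \<le> \<alpha> e * c s" using cs by (intro mult_right_mono) auto
      then show ?thesis using T_le by (simp add: distrib_right)
    qed
    finally show "\<exists>D>0. (\<phi> has_real_derivative D) (at s)" using D by blast
  qed (use s' in auto)
  show "norm (T (D\<psi> t x u)) < (exp (- \<gamma> * t) * Y - C * w * exp (\<mu> / 2 * t)) * \<alpha> (D\<psi> t x u)"
    using \<phi>_pos[OF t order_refl] by (simp add: \<phi>_def y_def c_def)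
  then have "c t * \<alpha> (D\<psi> t x u) > 0" using norm_ge_zero[of "T (D\<psi> t x u)"] unfolding c_def by linarith
  then show "\<alpha> (D\<psi> t x u) > 0" using c_pos[OF t] by (simp add: zero_less_mult_iff)
qed

text \<open>Letting the slack tend to zero. The quantity \<open>norm (T y) / \<alpha> y + C * W\<close> is thus a Lyapunov function
  for the angle: if \<open>Y\<close> bounds it initially, then \<open>exp (- \<gamma> t) * Y\<close> bounds it at time \<open>t\<close>.\<close>

lemma cone_estimate:
  assumes gc: "good_constants \<rho> C\<^sub>1 C" and x: "W x < \<rho>"
    and Y: "Y \<le> 1" and u: "\<alpha> u \<ge> 0" "norm (T u) \<le> (Y - C * W x) * \<alpha> u" and t: "0 \<le> t"
  shows "norm (T (D\<psi> t x u)) \<le> (exp (- \<gamma> * t) * Y - C * W (\<psi> t x)) * \<alpha> (D\<psi> t x u)"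
    and "\<alpha> (D\<psi> t x u) \<ge> 0"
proof -
  have C0: "C > 0" using gc by (simp add: good_constants_def)
  let ?y = "D\<psi> t x u"
  have "norm (T ?y) \<le> (exp (- \<gamma> * t) * Y - C * W (\<psi> t x)) * \<alpha> ?y \<and> \<alpha> ?y \<ge> 0"
  proof (cases "u = 0")
    case True
    then show ?thesis
      by (simp add: linear_0[OF D\<psi>_linear[OF t]] linear_0[OF lin_T] linear_0[OF lin_\<alpha>])
  next
    case False
    have \<alpha>u: "\<alpha> u > 0"
    proof (rule ccontr)
      assume "\<not> ?thesis"
      then have "\<alpha> u = 0" using u(1) by simp
      then show False using u(2) \<alpha>_T_inj[of u] False by simp
    qed
    define \<epsilon>0 where "\<epsilon>0 = min (\<rho> - W x) (1 / (C + 1))"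
    have \<epsilon>0: "\<epsilon>0 > 0" using x C0 by (simp add: \<epsilon>0_def)
    have step: "norm (T ?y) < (exp (- \<gamma> * t) * (Y + (C + 1) * \<epsilon>) - C * (W x + \<epsilon>) * exp (\<mu> / 2 * t)) * \<alpha> ?y"
      "\<alpha> ?y > 0" if \<epsilon>: "0 < \<epsilon>" "\<epsilon> < \<epsilon>0" for \<epsilon>
    proof -
      have "(C + 1) * \<epsilon> \<le> 1" using \<epsilon> C0 by (simp add: \<epsilon>0_def less_divide_eq mult.commute less_imp_le)
      then have Y2: "Y + (C + 1) * \<epsilon> \<le> 2" using Y by linarith
      have "(Y - C * W x) * \<alpha> u < (Y - C * W x) * \<alpha> u + \<epsilon> * \<alpha> u" using \<epsilon>(1) \<alpha>u by simp
      also have "\<dots> = (Y + (C + 1) * \<epsilon> - C * (W x + \<epsilon>)) * \<alpha> u" by (simp add: algebra_simps)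
      finally have "norm (T u) < (Y + (C + 1) * \<epsilon> - C * (W x + \<epsilon>)) * \<alpha> u" using u(2) by linarith
      then show "norm (T ?y) < (exp (- \<gamma> * t) * (Y + (C + 1) * \<epsilon>) - C * (W x + \<epsilon>) * exp (\<mu> / 2 * t)) * \<alpha> ?y"
        "\<alpha> ?y > 0"
        using cone_estimate_strict[OF gc _ _ Y2 \<alpha>u _ t, of x "W x + \<epsilon>"] \<epsilon> by (auto simp: \<epsilon>0_def)
    qed
    have \<alpha>y: "\<alpha> ?y > 0" using step(2)[of "\<epsilon>0 / 2"] \<epsilon>0 by simp
    have "norm (T ?y) \<le> (exp (- \<gamma> * t) * (Y + (C + 1) * 0) - C * (W x + 0) * exp (\<mu> / 2 * t)) * \<alpha> ?y"
    proof (rule tendsto_lowerbound)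
      show "((\<lambda>\<epsilon>. (exp (- \<gamma> * t) * (Y + (C + 1) * \<epsilon>) - C * (W x + \<epsilon>) * exp (\<mu> / 2 * t)) * \<alpha> ?y) \<longlongrightarrow>
          (exp (- \<gamma> * t) * (Y + (C + 1) * 0) - C * (W x + 0) * exp (\<mu> / 2 * t)) * \<alpha> ?y) (at_right 0)"
        by (intro tendsto_intros)
      show "\<forall>\<^sub>F \<epsilon> in at_right 0. norm (T ?y) \<le>
          (exp (- \<gamma> * t) * (Y + (C + 1) * \<epsilon>) - C * (W x + \<epsilon>) * exp (\<mu> / 2 * t)) * \<alpha> ?y"
        using eventually_at_right_real[OF \<epsilon>0] by eventually_elim (use step(1) in \<open>auto intro: less_imp_le\<close>)
    qed simp
    also have "\<dots> \<le> (exp (- \<gamma> * t) * Y - C * W (\<psi> t x)) * \<alpha> ?y"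
    proof (rule mult_right_mono)
      have "C * W (\<psi> t x) \<le> C * (W x * exp (\<mu> / 2 * t))"
        using W_decay[OF gc x t] C0 by (intro mult_left_mono) auto
      then show "exp (- \<gamma> * t) * (Y + (C + 1) * 0) - C * (W x + 0) * exp (\<mu> / 2 * t)
          \<le> exp (- \<gamma> * t) * Y - C * W (\<psi> t x)" by simp
    qed (use \<alpha>y in simp)
    finally show ?thesis using \<alpha>y by simp
  qed
  then show "norm (T ?y) \<le> (exp (- \<gamma> * t) * Y - C * W (\<psi> t x)) * \<alpha> ?y" "\<alpha> ?y \<ge> 0" by auto
qed


lemma cone_radius_exists:
  obtains \<rho> C\<^sub>1 C \<rho>\<^sub>0 where "good_constants \<rho> C\<^sub>1 C" "0 < \<rho>\<^sub>0" "\<rho>\<^sub>0 < \<rho>" "C * \<rho>\<^sub>0 \<le> 1 / 8"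
proof -
  obtain \<rho> C\<^sub>1 C where gc: "good_constants \<rho> C\<^sub>1 C" by (rule good_constants_exist)
  then have pos: "\<rho> > 0" "C > 0" by (auto simp: good_constants_def)
  define \<rho>\<^sub>0 where "\<rho>\<^sub>0 = min (\<rho> / 2) (1 / (8 * C))"
  have "C * \<rho>\<^sub>0 \<le> C * (1 / (8 * C))" using pos by (intro mult_left_mono) (auto simp: \<rho>\<^sub>0_def)
  also have "\<dots> = 1 / 8" using pos by simp
  finally show thesis using that[OF gc, of \<rho>\<^sub>0] pos by (simp add: \<rho>\<^sub>0_def)
qed

end

locale split_sink_radius = split_sink +
  fixes \<rho> C\<^sub>1 C \<rho>\<^sub>0 :: real
  assumes gc: "good_constants \<rho> C\<^sub>1 C" and \<rho>\<^sub>0_pos: "0 < \<rho>\<^sub>0" and \<rho>\<^sub>0_less: "\<rho>\<^sub>0 < \<rho>" and C\<rho>\<^sub>0: "C * \<rho>\<^sub>0 \<le> 1 / 8"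
begin

lemma C_pos: "C > 0" using gc by (simp add: good_constants_def)

section \<open>The basin and the entrance time\<close>

definition X :: "'a set" where "X = {x. ((\<lambda>t. \<psi> t x) \<longlongrightarrow> p) at_top}"

lemma W_p: "W p = 0" by (simp add: W_def linear_0[OF lin_S])

lemma continuous_on_W_flow: "0 \<le> t \<Longrightarrow> continuous_on UNIV (\<lambda>x. W (\<psi> t x))"
proof -
  assume "0 \<le> t"
  then have "continuous_on UNIV (\<psi> t)"
    using D\<psi>_has_derivative by (auto intro!: continuous_at_imp_continuous_on has_derivative_continuous)
  then show ?thesis using continuous_on_compose2[OF continuous_on_W[of UNIV]] by blast
qed

lemma flow_in_X: "x \<in> X \<Longrightarrow> 0 \<le> t \<Longrightarrow> \<psi> t x \<in> X"
proof -
  assume x: "x \<in> X" and t: "0 \<le> t"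
  have "((\<lambda>s. \<psi> (s + t) x) \<longlongrightarrow> p) at_top"
    using filterlim_compose[of "\<lambda>t. \<psi> t x" "nhds p" at_top "\<lambda>s. s + t" at_top] x
    by (simp add: X_def filterlim_at_top_add_at_top[OF filterlim_ident, simplified] filterlim_tendsto_add_at_top[OF tendsto_const filterlim_ident, of t, simplified add.commute])
  moreover have "eventually (\<lambda>s. \<psi> (s + t) x = \<psi> s (\<psi> t x)) at_top"
    using eventually_ge_at_top[of 0] by eventually_elim (use flow_semigroup t in auto)
  ultimately show ?thesis unfolding X_def using tendsto_cong by force
qed

text \<open>Near \<open>p\<close> the exponential decay of \<open>W\<close> forces convergence.\<close>

lemma near_in_X: "W x < \<rho> \<Longrightarrow> x \<in> X"
proof -
  assume x: "W x < \<rho>"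
  obtain m where m: "m > 0" "\<And>x. m * norm (x - p) \<le> W x" by (rule norm_le_W) blast
  have "((\<lambda>t. W x * exp (\<mu> / 2 * t) / m) \<longlongrightarrow> 0) at_top"
  proof -
    have "filterlim (\<lambda>t. \<mu> / 2 * t) at_bot at_top"
      using \<mu>_neg by (intro filterlim_tendsto_neg_mult_at_bot[OF tendsto_const _ filterlim_ident]) auto
    then have "((\<lambda>t. exp (\<mu> / 2 * t)) \<longlongrightarrow> 0) at_top" by (rule filterlim_compose[OF exp_at_bot])
    then have "((\<lambda>t. W x * exp (\<mu> / 2 * t) / m) \<longlongrightarrow> W x * 0 / m) at_top"
      by (intro tendsto_intros) (use m in auto)
    then show ?thesis by simp
  qed
  then have "((\<lambda>t. \<psi> t x - p) \<longlongrightarrow> 0) at_top"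
  proof (rule Lim_null_comparison[rotated])
    show "\<forall>\<^sub>F t in at_top. norm (\<psi> t x - p) \<le> W x * exp (\<mu> / 2 * t) / m"
      using eventually_ge_at_top[of 0]
    proof eventually_elim
      case (elim t)
      have "m * norm (\<psi> t x - p) \<le> W x * exp (\<mu> / 2 * t)"
        using m(2)[of "\<psi> t x"] W_decay[OF gc x elim] by linarith
      then show ?case using m(1) by (simp add: le_divide_eq mult.commute)
    qed
  qed
  then show ?thesis unfolding X_def using LIM_zero_iff by blast
qed

lemma flow_enters: "x \<in> X \<Longrightarrow> \<exists>t\<ge>0. W (\<psi> t x) < \<rho>\<^sub>0"
proof -
  assume "x \<in> X"
  then have "((\<lambda>t. W (\<psi> t x)) \<longlongrightarrow> W p) at_top"
    using continuous_on_tendsto_compose[OF continuous_on_W[of UNIV]] by (simp add: X_def)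
  then have "\<forall>\<^sub>F t in at_top. W (\<psi> t x) < \<rho>\<^sub>0" using \<rho>\<^sub>0_pos by (auto simp: W_p dest: order_tendstoD)
  then have "\<forall>\<^sub>F t in at_top. W (\<psi> t x) < \<rho>\<^sub>0 \<and> t \<ge> 0" using eventually_ge_at_top by (rule eventually_conj)
  from eventually_happens[OF this] show ?thesis by (auto simp: trivial_limit_at_top_linorder)
qed

lemma open_X: "open X"
proof (subst open_subopen, intro ballI)
  fix x assume "x \<in> X"
  then obtain t where t: "t \<ge> 0" "W (\<psi> t x) < \<rho>\<^sub>0" using flow_enters by blast
  have "y \<in> X" if y: "W (\<psi> t y) < \<rho>\<^sub>0" for y
  proof -
    have "\<psi> t y \<in> X" using near_in_X y \<rho>\<^sub>0_less by force
    then have lim: "((\<lambda>s. \<psi> s (\<psi> t y)) \<longlongrightarrow> p) at_top" by (simp add: X_def)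
    have "filterlim (\<lambda>s. s - t) at_top at_top"
      using filterlim_tendsto_add_at_top[OF tendsto_const[of "- t"] filterlim_ident] by simp
    from filterlim_compose[OF lim this] have "((\<lambda>s. \<psi> (s - t) (\<psi> t y)) \<longlongrightarrow> p) at_top" .
    moreover have "eventually (\<lambda>s. \<psi> (s - t) (\<psi> t y) = \<psi> s y) at_top"
      using eventually_ge_at_top[of t]
      by eventually_elim (use flow_semigroup[of "_ - t" t y] t in \<open>metis diff_add_cancel diff_ge_0_iff_ge\<close>)
    ultimately show ?thesis unfolding X_def using tendsto_cong by force
  qed
  moreover have "open {y. W (\<psi> t y) < \<rho>\<^sub>0}"
    using continuous_on_W_flow[OF t(1)] by (intro open_Collect_less continuous_on_const)
  ultimately show "\<exists>V. open V \<and> x \<in> V \<and> V \<subseteq> X" using t(2) by blast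
qed

text \<open>The entrance time into the ball \<open>W \<le> \<rho>\<^sub>0\<close>, on which the local estimates hold.\<close>
definition \<tau> :: "'a \<Rightarrow> real" where "\<tau> x = Inf {t. 0 \<le> t \<and> W (\<psi> t x) \<le> \<rho>\<^sub>0}"

lemma stays_near:
  assumes "W (\<psi> s x) \<le> \<rho>\<^sub>0" "0 \<le> s" "s \<le> t"
  shows "W (\<psi> t x) \<le> \<rho>\<^sub>0 * exp (\<mu> / 2 * (t - s))"
proof -
  have "W (\<psi> (t - s) (\<psi> s x)) \<le> W (\<psi> s x) * exp (\<mu> / 2 * (t - s))"
    using W_decay[OF gc] assms \<rho>\<^sub>0_less by simp
  also have "\<dots> \<le> \<rho>\<^sub>0 * exp (\<mu> / 2 * (t - s))" using assms(1) by (intro mult_right_mono) auto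
  finally show ?thesis using flow_semigroup[of "t - s" s x] assms by simp
qed

lemma \<tau>_nonneg: "x \<in> X \<Longrightarrow> 0 \<le> \<tau> x"
  unfolding \<tau>_def using flow_enters[of x] by (intro cInf_greatest) (auto intro: less_imp_le)

text \<open>The ball cannot be left again, so the times spent in it form a closed half-line.\<close>

lemma \<tau>_le_iff:
  assumes x: "x \<in> X" and t: "0 \<le> t"
  shows "\<tau> x \<le> t \<longleftrightarrow> W (\<psi> t x) \<le> \<rho>\<^sub>0"
proof
  let ?A = "{t. 0 \<le> t \<and> W (\<psi> t x) \<le> \<rho>\<^sub>0}"
  have bdd: "bdd_below ?A" by (auto simp: bdd_below_def)
  show "W (\<psi> t x) \<le> \<rho>\<^sub>0 \<Longrightarrow> \<tau> x \<le> t" unfolding \<tau>_def using t bdd by (intro cInf_lower) auto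
  assume le: "\<tau> x \<le> t"
  have "?A = {0..} \<inter> {t. W (\<psi> t x) \<le> \<rho>\<^sub>0}" by auto
  moreover have "closed {t. W (\<psi> t x) \<le> \<rho>\<^sub>0}"
    using continuous_on_compose2[OF continuous_on_W[of UNIV] flow_continuous_time[of UNIV x]]
    by (intro closed_Collect_le continuous_on_const) auto
  ultimately have "closed ?A" by (metis closed_Int closed_atLeast)
  moreover have "?A \<noteq> {}" using flow_enters[OF x] by (auto intro: less_imp_le)
  ultimately have "\<tau> x \<in> ?A" unfolding \<tau>_def using closed_contains_Inf[OF _ bdd] by blast
  then have "W (\<psi> t x) \<le> \<rho>\<^sub>0 * exp (\<mu> / 2 * (t - \<tau> x))" using stays_near le by blast
  also have "\<dots> \<le> \<rho>\<^sub>0 * 1" using \<rho>\<^sub>0_pos \<mu>_neg le by (intro mult_left_mono) (auto simp: mult_nonpos_nonneg)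
  finally show "W (\<psi> t x) \<le> \<rho>\<^sub>0" by simp
qed

lemma W_at_\<tau>: "x \<in> X \<Longrightarrow> W (\<psi> (\<tau> x) x) \<le> \<rho>\<^sub>0"
  using \<tau>_le_iff \<tau>_nonneg by blast

lemma \<tau>_flow:
  assumes x: "x \<in> X" and t: "0 \<le> t"
  shows "\<tau> (\<psi> t x) = max 0 (\<tau> x - t)"
proof -
  have iff: "\<tau> (\<psi> t x) \<le> s \<longleftrightarrow> \<tau> x - t \<le> s" if "0 \<le> s" for s
    using \<tau>_le_iff[OF flow_in_X[OF x t] that] \<tau>_le_iff[OF x, of "s + t"] flow_semigroup[OF that t, of x] that t
    by auto
  have "0 \<le> \<tau> (\<psi> t x)" using \<tau>_nonneg flow_in_X[OF x t] by blast
  then show ?thesis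
    using iff[of "\<tau> (\<psi> t x)"] iff[of "max 0 (\<tau> x - t)"] by (intro antisym) auto
qed

text \<open>Orbits enter transversally: after time \<open>\<tau> x\<close> the value of \<open>W\<close> lies strictly below \<open>\<rho>\<^sub>0\<close> and before
  it strictly above, and both conditions are open in \<open>x\<close>.\<close>

lemma continuous_on_\<tau>: "continuous_on X \<tau>"
  unfolding continuous_on_def
proof (intro ballI order_tendstoI)
  fix x a assume x: "x \<in> X" and a: "a < \<tau> x"
  show "\<forall>\<^sub>F y in at x within X. a < \<tau> y"
  proof (cases "a < 0")
    case True
    then show ?thesis using \<tau>_nonneg by (fastforce simp: eventually_at_filter intro: always_eventually)
  next
    case False
    then have "W (\<psi> a x) > \<rho>\<^sub>0" using \<tau>_le_iff[OF x, of a] a by auto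
    moreover have "((\<lambda>y. W (\<psi> a y)) \<longlongrightarrow> W (\<psi> a x)) (at x within X)"
      using continuous_on_W_flow[of a] False by (metis UNIV_I continuous_on_def continuous_on_subset linorder_not_less subset_UNIV x)
    ultimately have "\<forall>\<^sub>F y in at x within X. W (\<psi> a y) > \<rho>\<^sub>0" by (rule order_tendstoD(1)[rotated])
    moreover have "\<forall>\<^sub>F y in at x within X. y \<in> X" by (simp add: eventually_at_filter)
    ultimately show ?thesis
    proof eventually_elim
      case (elim y)
      then show ?case using \<tau>_le_iff[of y a] False by auto
    qed
  qed
next
  fix x b assume x: "x \<in> X" and b: "\<tau> x < b"
  define t where "t = (\<tau> x + b) / 2"
  have t: "\<tau> x < t" "t < b" "0 \<le> t" using b \<tau>_nonneg[OF x] by (auto simp: t_def)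
  have "W (\<psi> t x) \<le> \<rho>\<^sub>0 * exp (\<mu> / 2 * (t - \<tau> x))"
    using stays_near[OF W_at_\<tau>[OF x] \<tau>_nonneg[OF x]] t by simp
  also have "\<dots> < \<rho>\<^sub>0 * 1" using \<rho>\<^sub>0_pos \<mu>_neg t(1) by (intro mult_strict_left_mono) (auto simp: mult_neg_pos)
  finally have "W (\<psi> t x) < \<rho>\<^sub>0" by simp
  moreover have "((\<lambda>y. W (\<psi> t y)) \<longlongrightarrow> W (\<psi> t x)) (at x within X)"
    using continuous_on_W_flow[OF t(3)] by (metis continuous_on_def continuous_on_subset subset_UNIV x)
  ultimately have "\<forall>\<^sub>F y in at x within X. W (\<psi> t y) < \<rho>\<^sub>0" by (rule order_tendstoD(2)[rotated])
  moreover have "\<forall>\<^sub>F y in at x within X. y \<in> X" by (simp add: eventually_at_filter)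
  ultimately show "\<forall>\<^sub>F y in at x within X. \<tau> y < b"
  proof eventually_elim
    case (elim y)
    then have "\<tau> y \<le> t" using \<tau>_le_iff[of y t] t(3) by simp
    then show ?case using t(2) by simp
  qed
qed

section \<open>The cone field on the basin\<close>

text \<open>A tangent vector at \<open>x\<close> is carried by \<open>M x\<close> to the entrance point, where the splitting is used to
  measure its angle. The admissible aperture \<open>c x\<close> has two factors. Near \<open>p\<close> only \<open>1 - C * W\<close> matters,
  which is dictated by the local estimate. The factor \<open>exp (- \<gamma> * \<tau> x)\<close> makes cones far from \<open>p\<close> narrow
  when viewed from the entrance point: transport to the entrance point does not change a cone, so there
  the narrowing is the only source of contraction, and its rate is the same on the whole basin.\<close>

definition M :: "'a \<Rightarrow> 'a \<Rightarrow> 'a" where "M x = D\<psi> (\<tau> x) x"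

definition c :: "'a \<Rightarrow> real" where "c x = exp (- \<gamma> * \<tau> x) * (1 - C * W (\<psi> (\<tau> x) x))"

text \<open>Stretching the complementary part by \<open>1 / c x\<close> turns the cone at \<open>x\<close> into one fixed cone. Hence all
  cones are linearly isomorphic, and the isomorphism does not depend on the aperture factor \<open>k\<close> in
  \<open>cone_of\<close>.\<close>
definition frame :: "'a \<Rightarrow> 'a \<Rightarrow> 'a" where
  "frame x u = \<alpha> (M x u) *\<^sub>R r + inverse (c x) *\<^sub>R (M x u - \<alpha> (M x u) *\<^sub>R r)"

lemma CW_le: "x \<in> X \<Longrightarrow> C * W (\<psi> (\<tau> x) x) \<le> 1 / 8"
  using mult_left_mono[OF W_at_\<tau>[of x], of C] C_pos C\<rho>\<^sub>0 by linarith

lemma c_pos: "x \<in> X \<Longrightarrow> c x > 0"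
  unfolding c_def using CW_le[of x] by (intro mult_pos_pos) auto

lemma lin_M: "x \<in> X \<Longrightarrow> linear (M x)"
  unfolding M_def using D\<psi>_linear \<tau>_nonneg by blast

lemma \<alpha>_frame: "\<alpha> (frame x u) = \<alpha> (M x u)"
  by (simp add: frame_def linear_add[OF lin_\<alpha>] linear_diff[OF lin_\<alpha>] linear_scale[OF lin_\<alpha>] \<alpha>_r)

lemma T_frame: "T (frame x u) = inverse (c x) *\<^sub>R T (M x u)"
  by (simp add: frame_def linear_add[OF lin_T] linear_diff[OF lin_T] linear_scale[OF lin_T] T_r)

lemma lin_frame: "x \<in> X \<Longrightarrow> linear (frame x)"
  by (rule linearI)
     (simp_all add: frame_def linear_add[OF lin_M] linear_scale[OF lin_M] linear_add[OF lin_\<alpha>]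
       linear_scale[OF lin_\<alpha>] algebra_simps)

lemma bij_frame: "x \<in> X \<Longrightarrow> bij (frame x)"
proof -
  assume x: "x \<in> X"
  have "u = 0" if "frame x u = 0" for u
  proof -
    have "\<alpha> (M x u) = 0" using \<alpha>_frame[of x u] that linear_0[OF lin_\<alpha>] by simp
    moreover have "T (M x u) = 0" using T_frame[of x u] that linear_0[OF lin_T] c_pos[OF x] by simp
    ultimately have "D\<psi> (\<tau> x) x u = 0" using \<alpha>_T_inj by (simp add: M_def)
    then show "u = 0" using D\<psi>_nonzero \<tau>_nonneg[OF x] by blast
  qed
  then have "inj (frame x)" using linear_injective_0[OF lin_frame[OF x]] by blast
  then show ?thesis using linear_injective_imp_surjective[OF lin_frame[OF x]] by (simp add: bij_def)
qed

lemma continuous_on_frame: "continuous_on (X \<times> UNIV) (\<lambda>z. frame (fst z) (snd z))"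
proof -
  have \<tau>: "continuous_on (X \<times> UNIV) (\<lambda>z. \<tau> (fst z))"
    by (rule continuous_on_compose2[OF continuous_on_\<tau> continuous_on_fst[OF continuous_on_id]]) auto
  have "continuous_on (X \<times> UNIV) (\<lambda>z. (\<lambda>(t, x, u). D\<psi> t x u) (\<tau> (fst z), fst z, snd z))"
    by (rule continuous_on_compose2[OF continuous_on_D\<psi>])
       (use \<tau> \<tau>_nonneg in \<open>auto intro!: continuous_intros\<close>)
  then have M: "continuous_on (X \<times> UNIV) (\<lambda>z. M (fst z) (snd z))"
    by (simp add: M_def split_beta)
  have "continuous_on (X \<times> UNIV) (\<lambda>z. (\<lambda>(t, x). \<psi> t x) (\<tau> (fst z), fst z))"
    by (rule continuous_on_compose2[OF continuous_on_flow])
       (use \<tau> \<tau>_nonneg in \<open>auto intro!: continuous_intros\<close>)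
  then have "continuous_on (X \<times> UNIV) (\<lambda>z. W (\<psi> (\<tau> (fst z)) (fst z)))"
    using continuous_on_compose2[OF continuous_on_W[of UNIV]] by auto
  then have c: "continuous_on (X \<times> UNIV) (\<lambda>z. c (fst z))"
    unfolding c_def by (intro continuous_intros \<tau>)
  have "\<forall>z\<in>X \<times> UNIV. c (fst z) \<noteq> 0" using c_pos by fastforce
  then show ?thesis
    unfolding frame_def
    by (intro continuous_intros M c linear_continuous_on_compose[OF M lin_\<alpha>]) auto
qed

text \<open>In coordinates adapted to the splitting this is a cone of revolution around \<open>r\<close>. The value \<open>k = 1\<close>
  gives the cone field itself, \<open>k = 2\<close> the narrower one for strict positivity.\<close>
definition cone_of :: "real \<Rightarrow> 'a \<Rightarrow> 'a set" where
  "cone_of k x = {u. k * norm (T (frame x u)) \<le> \<alpha> (frame x u)}"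

abbreviation K :: "'a \<Rightarrow> 'a set" where "K \<equiv> cone_of 1"
abbreviation R :: "'a \<Rightarrow> 'a set" where "R \<equiv> cone_of 2"

lemma \<alpha>_pos_of_mem_cone_of:
  assumes "x \<in> X" "k > 0" "u \<in> cone_of k x" "u \<noteq> 0"
  shows "\<alpha> (frame x u) > 0"
proof (rule ccontr)
  assume neg: "\<not> ?thesis"
  have le: "k * norm (T (frame x u)) \<le> \<alpha> (frame x u)" using assms(3) by (simp add: cone_of_def)
  moreover have "k * norm (T (frame x u)) \<ge> 0" using assms(2) by simp
  ultimately have "\<alpha> (frame x u) = 0" "k * norm (T (frame x u)) = 0" using neg by linarith+
  then have "frame x u = 0" using \<alpha>_T_inj assms(2) by simp
  then show False
    using assms(1,4) bij_frame lin_frame linear_injective_0 by (metis bij_is_inj)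
qed

lemma continuous_on_\<alpha>_frame: "continuous_on (X \<times> UNIV) (\<lambda>z. \<alpha> (frame (fst z) (snd z)))"
  and continuous_on_T_frame: "continuous_on (X \<times> UNIV) (\<lambda>z. T (frame (fst z) (snd z)))"
  using linear_continuous_on_compose[OF continuous_on_frame lin_\<alpha>]
    linear_continuous_on_compose[OF continuous_on_frame lin_T] .

lemma open_outside_cone_of: "open (X \<times> UNIV - {z. snd z \<in> cone_of k (fst z)})"
proof -
  have "X \<times> UNIV - {z. snd z \<in> cone_of k (fst z)} =
      (X \<times> UNIV) \<inter> (\<lambda>z. k * norm (T (frame (fst z) (snd z))) - \<alpha> (frame (fst z) (snd z))) -` {0<..}"
    by (auto simp: cone_of_def)
  also have "open \<dots>"
    by (intro continuous_open_preimage continuous_intros continuous_on_\<alpha>_frame continuous_on_T_frame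
        open_Times open_X) auto
  finally show ?thesis .
qed

lemma open_inside_cone:
  "open ((X \<times> UNIV) \<inter> {z. norm (T (frame (fst z) (snd z))) < \<alpha> (frame (fst z) (snd z))})"
proof -
  have "(X \<times> UNIV) \<inter> {z. norm (T (frame (fst z) (snd z))) < \<alpha> (frame (fst z) (snd z))} =
      (X \<times> UNIV) \<inter> (\<lambda>z. \<alpha> (frame (fst z) (snd z)) - norm (T (frame (fst z) (snd z)))) -` {0<..}"
    by auto
  also have "open \<dots>"
    by (intro continuous_open_preimage continuous_intros continuous_on_\<alpha>_frame continuous_on_T_frame
        open_Times open_X) auto
  finally show ?thesis .
qed

lemma continuous_\<alpha>_frame_fiber: "x \<in> X \<Longrightarrow> continuous_on UNIV (\<lambda>u. \<alpha> (frame x u))"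
  and continuous_T_frame_fiber: "x \<in> X \<Longrightarrow> continuous_on UNIV (\<lambda>u. T (frame x u))"
  using linear_continuous_on[OF linear_conv_bounded_linear[THEN iffD1,
        OF linear_compose[OF lin_frame lin_\<alpha>]], of x UNIV]
    linear_continuous_on[OF linear_conv_bounded_linear[THEN iffD1,
        OF linear_compose[OF lin_frame lin_T]], of x UNIV]
  by (simp_all add: o_def)

lemma strictly_inside_subset_interior:
  assumes "x \<in> X"
  shows "{u. k * norm (T (frame x u)) < \<alpha> (frame x u)} \<subseteq> interior (cone_of k x)"
proof (rule interior_maximal)
  show "open {u. k * norm (T (frame x u)) < \<alpha> (frame x u)}"
    by (intro open_Collect_less continuous_intros continuous_\<alpha>_frame_fiber continuous_T_frame_fiber assms)
qed (auto simp: cone_of_def)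

lemma cone_of_is_cone:
  assumes x: "x \<in> X" and k: "k > 0"
  shows "closed (cone_of k x)" "interior (cone_of k x) \<noteq> {}"
    "\<And>u v. u \<in> cone_of k x \<Longrightarrow> v \<in> cone_of k x \<Longrightarrow> u + v \<in> cone_of k x"
    "cone (cone_of k x)" "cone_of k x \<inter> uminus ` cone_of k x = {0}"
proof -
  note lf = lin_frame[OF x]
  show "closed (cone_of k x)"
    unfolding cone_of_def
    by (intro closed_Collect_le continuous_intros continuous_\<alpha>_frame_fiber continuous_T_frame_fiber x)
  obtain u where "frame x u = r" using bij_frame[OF x] by (metis bij_pointE)
  then have "u \<in> interior (cone_of k x)"
    using strictly_inside_subset_interior[OF x, of k] \<alpha>_r T_r by auto
  then show "interior (cone_of k x) \<noteq> {}" by blast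
  show "u + v \<in> cone_of k x" if "u \<in> cone_of k x" "v \<in> cone_of k x" for u v
  proof -
    have "k * norm (T (frame x (u + v))) \<le> k * (norm (T (frame x u)) + norm (T (frame x v)))"
      using k by (intro mult_left_mono) (auto simp: linear_add[OF lf] linear_add[OF lin_T] norm_triangle_ineq)
    then show ?thesis
      using that by (simp add: cone_of_def linear_add[OF lf] linear_add[OF lin_\<alpha>] distrib_left)
  qed
  show "cone (cone_of k x)"
    unfolding cone_def
  proof (intro ballI allI impI)
    fix u and a :: real assume u: "u \<in> cone_of k x" and a: "0 \<le> a"
    have "a * (k * norm (T (frame x u))) \<le> a * \<alpha> (frame x u)"
      using u a by (intro mult_left_mono) (auto simp: cone_of_def)
    then show "a *\<^sub>R u \<in> cone_of k x"
      using a by (simp add: cone_of_def linear_scale[OF lf] linear_scale[OF lin_\<alpha>] linear_scale[OF lin_T] mult_ac)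
  qed
  have "u = 0" if "u \<in> cone_of k x" "- u \<in> cone_of k x" for u
  proof (rule ccontr)
    assume "u \<noteq> 0"
    then have "\<alpha> (frame x u) > 0" "\<alpha> (frame x (- u)) > 0"
      using \<alpha>_pos_of_mem_cone_of[OF x k] that by auto
    then show False by (simp add: linear_neg[OF lf] linear_neg[OF lin_\<alpha>])
  qed
  moreover have "0 \<in> cone_of k x"
    by (simp add: cone_of_def linear_0[OF lf] linear_0[OF lin_\<alpha>] linear_0[OF lin_T])
  ultimately show "cone_of k x \<inter> uminus ` cone_of k x = {0}" by force
qed

lemma cones_isomorphic:
  assumes "x1 \<in> X" "x2 \<in> X"
  shows "\<exists>\<Gamma>. linear \<Gamma> \<and> bij \<Gamma> \<and> (\<forall>k. \<Gamma> ` cone_of k x1 = cone_of k x2)"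
proof (intro exI conjI allI)
  let ?\<Gamma> = "inv (frame x2) \<circ> frame x1"
  have f2: "frame x2 (?\<Gamma> u) = frame x1 u" for u
    using bij_frame[OF assms(2)] by (simp add: bij_is_surj surj_f_inv_f)
  obtain h where h: "linear h" "h \<circ> frame x2 = id"
    using linear_injective_left_inverse[OF lin_frame[OF assms(2)] bij_is_inj[OF bij_frame[OF assms(2)]]] by blast
  then have "inv (frame x2) = h" by (metis assms(2) bij_frame bij_is_surj fun.map_id o_assoc id_o o_id surj_iff)
  then show "linear ?\<Gamma>" using linear_compose[OF lin_frame[OF assms(1)] h(1)] by simp
  show bij: "bij ?\<Gamma>" using bij_frame assms by (intro bij_comp bij_imp_bij_inv) auto
  show "?\<Gamma> ` cone_of k x1 = cone_of k x2" for k
  proof -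
    have "u \<in> cone_of k x1 \<longleftrightarrow> ?\<Gamma> u \<in> cone_of k x2" for u unfolding cone_of_def mem_Collect_eq f2 ..
    then have "cone_of k x1 = ?\<Gamma> -` cone_of k x2" by blast
    then show ?thesis using surj_image_vimage_eq[OF bij_is_surj[OF bij]] by simp
  qed
qed

lemma R_subset_interior_K: "x \<in> X \<Longrightarrow> R x \<subseteq> interior (K x) \<union> {0}"
proof
  fix u assume x: "x \<in> X" and u: "u \<in> R x"
  have "norm (T (frame x u)) < \<alpha> (frame x u)" if "u \<noteq> 0"
  proof -
    have "\<alpha> (frame x u) > 0" using \<alpha>_pos_of_mem_cone_of[OF x _ u that] by simp
    then show ?thesis using u norm_ge_zero[of "T (frame x u)"] unfolding cone_of_def by auto
  qed
  then show "u \<in> interior (K x) \<union> {0}" using strictly_inside_subset_interior[OF x, of 1] by auto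
qed

lemma in_K_iff: "x \<in> X \<Longrightarrow> u \<in> K x \<longleftrightarrow> norm (T (M x u)) \<le> c x * \<alpha> (M x u)"
  using c_pos[of x] by (simp add: cone_of_def \<alpha>_frame T_frame field_simps)

lemma in_R_iff: "x \<in> X \<Longrightarrow> u \<in> R x \<longleftrightarrow> 2 * norm (T (M x u)) \<le> c x * \<alpha> (M x u)"
  using c_pos[of x] by (simp add: cone_of_def \<alpha>_frame T_frame field_simps)

text \<open>Before the entrance time the transported vector is unchanged and only the aperture grows, by
  the factor \<open>exp (\<gamma> t)\<close>; afterwards the local estimate applies. There the angle is bounded by the
  decayed aperture and the value of \<open>C * W\<close> at the entrance point. Two terms of size \<open>1 / 8\<close> are small
  enough for the narrower cone, whose aperture is \<open>(1 - C * W) / 2\<close>.\<close>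

lemma cone_invariance:
  assumes x: "x \<in> X" and t: "0 \<le> t" and u: "u \<in> K x"
  shows "D\<psi> t x u \<in> K (\<psi> t x)"
    and "exp (- \<gamma> * t) \<le> 1 / 8 \<Longrightarrow> D\<psi> t x u \<in> R (\<psi> t x)"
proof -
  have x': "\<psi> t x \<in> X" using flow_in_X[OF x t] .
  let ?y = "\<psi> (\<tau> x) x" and ?v = "M x u" and ?x' = "\<psi> t x" and ?u' = "D\<psi> t x u"
  have v: "norm (T ?v) \<le> c x * \<alpha> ?v" using u in_K_iff[OF x] by simp
  have "0 \<le> c x * \<alpha> ?v" using v norm_ge_zero[of "T ?v"] by linarith
  then have \<alpha>v: "\<alpha> ?v \<ge> 0" using c_pos[OF x] by (simp add: zero_le_mult_iff)
  have "?u' \<in> K ?x' \<and> (exp (- \<gamma> * t) \<le> 1 / 8 \<longrightarrow> ?u' \<in> R ?x')"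
  proof (cases "t \<le> \<tau> x")
    case True
    have \<tau>': "\<tau> ?x' = \<tau> x - t" using \<tau>_flow[OF x t] True by simp
    have eqM: "M ?x' ?u' = ?v"
      using D\<psi>_semigroup[of "\<tau> x - t" t x u] True t by (simp add: M_def \<tau>')
    have y': "\<psi> (\<tau> ?x') ?x' = ?y" using flow_semigroup[of "\<tau> x - t" t x] True t by (simp add: \<tau>')
    have "exp (- \<gamma> * \<tau> x) = exp (- \<gamma> * t) * exp (- \<gamma> * (\<tau> x - t))"
      by (simp add: algebra_simps flip: exp_add)
    moreover have "c ?x' = exp (- \<gamma> * (\<tau> x - t)) * (1 - C * W ?y)"
      unfolding c_def y' by (simp only: \<tau>')
    ultimately have cc: "c x = exp (- \<gamma> * t) * c ?x'" by (simp only: c_def mult.assoc)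
    have le: "norm (T ?v) \<le> exp (- \<gamma> * t) * (c ?x' * \<alpha> ?v)" using v unfolding cc by (simp add: mult.assoc)
    have nn: "0 \<le> c ?x' * \<alpha> ?v" using c_pos[OF x'] \<alpha>v by simp
    have "exp (- \<gamma> * t) * (c ?x' * \<alpha> ?v) \<le> 1 * (c ?x' * \<alpha> ?v)"
      using nn \<gamma>_nonneg t by (intro mult_right_mono) auto
    then have "?u' \<in> K ?x'" using le by (simp add: in_K_iff[OF x'] eqM)
    moreover have "?u' \<in> R ?x'" if "exp (- \<gamma> * t) \<le> 1 / 8"
    proof -
      have "exp (- \<gamma> * t) * (c ?x' * \<alpha> ?v) \<le> 1 / 8 * (c ?x' * \<alpha> ?v)"
        using that nn by (rule mult_right_mono)
      then show ?thesis using le nn by (simp add: in_R_iff[OF x'] eqM)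
    qed
    ultimately show ?thesis by blast
  next
    case False
    define s where "s = t - \<tau> x"
    have s: "0 \<le> s" "s + \<tau> x = t" using False by (auto simp: s_def)
    have \<tau>': "\<tau> ?x' = 0" using \<tau>_flow[OF x t] False by simp
    have M': "M ?x' ?u' = ?u'" by (simp add: M_def \<tau>' D\<psi>_0)
    have c': "c ?x' = 1 - C * W ?x'" by (simp add: c_def \<tau>' flow_0)
    have x's: "?x' = \<psi> s ?y" using flow_semigroup[OF s(1) \<tau>_nonneg[OF x], of x] s(2) by simp
    have u's: "?u' = D\<psi> s ?y ?v"
      using D\<psi>_semigroup[OF s(1) \<tau>_nonneg[OF x], of x u] s(2) by (simp add: M_def)
    define e where "e = exp (- \<gamma> * \<tau> x)"
    have e: "0 < e" "e \<le> 1" using \<gamma>_nonneg \<tau>_nonneg[OF x] by (auto simp: e_def)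
    \<comment> \<open>The Lyapunov function of the angle at the entrance point: the aperture plus \<open>C * W\<close>.\<close>
    define Y where "Y = e * (1 - C * W ?y) + C * W ?y"
    have CW: "0 \<le> C * W ?y" "C * W ?y \<le> 1 / 8" using CW_le[OF x] C_pos W_nonneg[of ?y] by auto
    have "Y \<le> 1 * (1 - C * W ?y) + C * W ?y" unfolding Y_def using e CW by (intro add_right_mono mult_right_mono) auto
    then have Y1: "Y \<le> 1" by simp
    have "e * (1 - C * W ?y) \<le> e * 1" using e CW by (intro mult_left_mono) auto
    then have Y2: "Y \<le> e + 1 / 8" unfolding Y_def using CW(2) by linarith
    have Wy: "W ?y < \<rho>" using W_at_\<tau>[OF x] \<rho>\<^sub>0_less by linarith
    have ty: "norm (T ?v) \<le> (Y - C * W ?y) * \<alpha> ?v" using v by (simp add: Y_def c_def e_def)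
    have est: "norm (T ?u') \<le> (exp (- \<gamma> * s) * Y - C * W ?x') * \<alpha> ?u'" "\<alpha> ?u' \<ge> 0"
      using cone_estimate[OF gc Wy Y1 \<alpha>v ty s(1)] unfolding x's u's by auto
    have es: "0 < exp (- \<gamma> * s)" "exp (- \<gamma> * s) \<le> 1" using \<gamma>_nonneg s(1) by auto
    have "exp (- \<gamma> * s) * Y \<le> exp (- \<gamma> * s) * 1" using Y1 es by (intro mult_left_mono) auto
    then have "exp (- \<gamma> * s) * Y - C * W ?x' \<le> 1 - C * W ?x'" using es(2) by linarith
    then have "(exp (- \<gamma> * s) * Y - C * W ?x') * \<alpha> ?u' \<le> (1 - C * W ?x') * \<alpha> ?u'"
      using est(2) by (rule mult_right_mono)
    then have "?u' \<in> K ?x'" using est(1) by (simp add: in_K_iff[OF x'] M' c')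
    moreover have "?u' \<in> R ?x'" if small: "exp (- \<gamma> * t) \<le> 1 / 8"
    proof -
      have "exp (- \<gamma> * s) * Y \<le> exp (- \<gamma> * s) * (e + 1 / 8)" using Y2 es by (intro mult_left_mono) auto
      also have "\<dots> = exp (- \<gamma> * t) + exp (- \<gamma> * s) * (1 / 8)"
        unfolding e_def s(2)[symmetric] by (simp add: distrib_left algebra_simps flip: exp_add)
      also have "\<dots> \<le> 1 / 4" using small es(2) by linarith
      finally have quarter: "exp (- \<gamma> * s) * Y \<le> 1 / 4" .
      have "a - b \<le> (1 - b) / 2" if "a \<le> 1 / 4" "0 \<le> b" for a b :: real
        using that by (simp add: field_simps)
      from this[OF quarter mult_nonneg_nonneg[OF less_imp_le[OF C_pos] W_nonneg[of ?x']]]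
      have "exp (- \<gamma> * s) * Y - C * W ?x' \<le> (1 - C * W ?x') / 2" .
      then have "(exp (- \<gamma> * s) * Y - C * W ?x') * \<alpha> ?u' \<le> (1 - C * W ?x') / 2 * \<alpha> ?u'"
        using est(2) by (rule mult_right_mono)
      then show ?thesis using est(1) by (simp add: in_R_iff[OF x'] M' c')
    qed
    ultimately show ?thesis by blast
  qed
  then show "?u' \<in> K ?x'" "exp (- \<gamma> * t) \<le> 1 / 8 \<Longrightarrow> ?u' \<in> R ?x'" by auto
qed

end

section \<open>Differential positivity\<close>

lemma continuous_on_metric_square:
  fixes g :: "real^'n \<Rightarrow> real^'n \<Rightarrow> real^'n \<Rightarrow> real"
  assumes "riemannian_metric_on X g"
  shows "continuous_on (X \<times> UNIV) (\<lambda>z. g (fst z) (snd z) (snd z))"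
proof -
  have cont: "continuous_on X (\<lambda>x. g x i j)" for i j
    using assms by (auto simp: riemannian_metric_on_def smooth_on_def intro: Ck_on_imp_continuous_on)
  have comp: "continuous_on (X \<times> UNIV) (\<lambda>z. g (fst z) i j)" for i j
    by (rule continuous_on_compose2[OF cont continuous_on_fst[OF continuous_on_id]]) auto
  have "g x u u = (\<Sum>(i, j)\<in>Basis \<times> Basis. (u \<bullet> i) * ((u \<bullet> j) * g x i j))" if x: "x \<in> X" for x u
  proof -
    have bl: "bilinear (g x)" using assms x by (simp add: riemannian_metric_on_def)
    have "g x u u = g x (\<Sum>i\<in>Basis. (u \<bullet> i) *\<^sub>R i) (\<Sum>j\<in>Basis. (u \<bullet> j) *\<^sub>R j)"
      by (simp add: euclidean_representation)
    also have "\<dots> = (\<Sum>(i, j)\<in>Basis \<times> Basis. (u \<bullet> i) * ((u \<bullet> j) * g x i j))"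
      by (simp add: bilinear_sum[OF bl] bilinear_lmul[OF bl] bilinear_rmul[OF bl] mult.left_commute)
    finally show ?thesis .
  qed
  then have "continuous_on (X \<times> UNIV) (\<lambda>z. g (fst z) (snd z) (snd z)) \<longleftrightarrow>
      continuous_on (X \<times> UNIV) (\<lambda>z. \<Sum>(i, j)\<in>Basis \<times> Basis. (snd z \<bullet> i) * ((snd z \<bullet> j) * g (fst z) i j))"
    by (intro continuous_on_cong) auto
  moreover have "continuous_on (X \<times> UNIV)
      (\<lambda>z. \<Sum>(i, j)\<in>Basis \<times> Basis. (snd z \<bullet> i) * ((snd z \<bullet> j) * g (fst z) i j))"
    unfolding split_beta by (intro continuous_intros comp)
  ultimately show ?thesis by blast
qed

text \<open>The flow, hence the frame, is only finitely often differentiable, but the total space of the cone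
  field is closed in the tangent bundle, and any such set is described by a single smooth inequality.\<close>

lemma differentially_positive_of_splitting:
  fixes f :: "real^'n \<Rightarrow> real^'n"
  assumes "split_sink_radius f F \<psi> p \<mu> gap \<alpha> T r \<rho> C\<^sub>1 C \<rho>\<^sub>0"
  shows "differentially_positive_in \<psi> (basin \<psi> p)"
proof -
  interpret split_sink_radius f F \<psi> p \<mu> gap \<alpha> T r \<rho> C\<^sub>1 C \<rho>\<^sub>0 by (rule assms)
  have X: "basin \<psi> p = X" by (simp add: basin_def X_def)
  have op: "open (X \<times> (UNIV :: (real^'n) set))" by (intro open_Times open_X open_UNIV)
  obtain k :: "(real^'n) \<times> (real^'n) \<Rightarrow> real" where k: "smooth_on k (X \<times> UNIV)"
    "\<forall>z\<in>X \<times> UNIV. 0 \<le> k z \<longleftrightarrow> z \<in> {z. snd z \<in> K (fst z)}"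
    using smooth_function_with_two_superlevel_sets[OF op open_outside_cone_of[of 1], of "{}" "{}"] op
    by auto
  show ?thesis
    unfolding differentially_positive_in_def X
  proof (intro exI conjI)
    show "cone_field_on X K"
      unfolding cone_field_on_def using cone_of_is_cone[of _ 1] by simp
    show "\<forall>x1\<in>X. \<forall>x2\<in>X. \<exists>\<Gamma>. linear \<Gamma> \<and> bij \<Gamma> \<and> \<Gamma> ` K x1 = K x2"
      using cones_isomorphic by fast
    show "cone_representation X 1 (\<lambda>_. k) K"
      unfolding cone_representation_def using k by simp
    show "diff_pos_wrt \<psi> X K"
      unfolding diff_pos_wrt_def flow_diff_def D\<psi>_def[symmetric]
      using cone_invariance(1) by (auto intro: less_imp_le)
  qed
qed

text \<open>A single smooth function describes both cone fields, because the unit vectors of the narrower cones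
  form a closed set inside the interior of the total space of the wider ones. Here unit vectors are meant
  with respect to the given metric, so its continuity is needed.\<close>

lemma strictly_differentially_positive_of_splitting:
  fixes f :: "real^'n \<Rightarrow> real^'n"
  assumes "split_sink_radius f F \<psi> p \<mu> gap \<alpha> T r \<rho> C\<^sub>1 C \<rho>\<^sub>0" and "gap > 0"
    and metric: "riemannian_metric_on (basin \<psi> p) g"
  shows "strictly_differentially_positive_in \<psi> (basin \<psi> p) g"
proof -
  interpret split_sink_radius f F \<psi> p \<mu> gap \<alpha> T r \<rho> C\<^sub>1 C \<rho>\<^sub>0 by (rule assms)
  have X: "basin \<psi> p = X" by (simp add: basin_def X_def)
  note g = metric[unfolded X]
  let ?S = "X \<times> (UNIV :: (real^'n) set)"
  let ?B = "{z. snd z \<in> R (fst z) \<and> g (fst z) (snd z) (snd z) = 1}"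
  let ?U = "?S \<inter> {z. norm (T (frame (fst z) (snd z))) < \<alpha> (frame (fst z) (snd z))}"
  have op: "open ?S" by (intro open_Times open_X open_UNIV)
  have "?S - ?B = (?S - {z. snd z \<in> R (fst z)}) \<union> (?S \<inter> (\<lambda>z. g (fst z) (snd z) (snd z)) -` (- {1}))"
    by auto
  also have "open \<dots>"
    by (intro open_Un open_outside_cone_of continuous_open_preimage[OF continuous_on_metric_square[OF g] op]) auto
  finally have opB: "open (?S - ?B)" .
  have BU: "?S \<inter> ?B \<subseteq> ?U"
  proof
    fix z assume z: "z \<in> ?S \<inter> ?B"
    then have x: "fst z \<in> X" by auto
    have "snd z \<noteq> 0"
      using z g x by (auto simp: riemannian_metric_on_def bilinear_lzero)
    then have "\<alpha> (frame (fst z) (snd z)) > 0" using \<alpha>_pos_of_mem_cone_of[OF x, of 2] z by auto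
    moreover have "2 * norm (T (frame (fst z) (snd z))) \<le> \<alpha> (frame (fst z) (snd z))"
      using z by (auto simp: cone_of_def)
    ultimately show "z \<in> ?U" using z norm_ge_zero[of "T (frame (fst z) (snd z))"] by (smt (verit) Int_iff mem_Collect_eq)
  qed
  have UA: "?S \<inter> ?U \<subseteq> {z. snd z \<in> K (fst z)}" by (auto simp: cone_of_def)
  obtain k :: "(real^'n) \<times> (real^'n) \<Rightarrow> real" where k: "smooth_on k ?S"
    "\<forall>z\<in>?S. 0 \<le> k z \<longleftrightarrow> z \<in> {z. snd z \<in> K (fst z)}" "\<forall>z\<in>?S. 1 \<le> k z \<longleftrightarrow> z \<in> ?B"
    using smooth_function_with_two_superlevel_sets[OF op open_outside_cone_of[of 1] opB open_inside_cone BU UA]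
    by blast
  have R_normalised: "u \<in> R x \<longleftrightarrow> u = 0 \<or> 1 \<le> k (x, u /\<^sub>R riemannian_norm g x u)" if x: "x \<in> X" for x u
  proof (cases "u = 0")
    case True
    have "0 \<in> R x" using cone_of_is_cone(5)[OF x, of 2] by auto
    then show ?thesis using True by simp
  next
    case False
    have bl: "bilinear (g x)" and pos: "g x u u > 0" using g x False by (auto simp: riemannian_metric_on_def)
    define a where "a = riemannian_norm g x u"
    have a: "a > 0" "a * a = g x u u" using pos by (auto simp: a_def riemannian_norm_def)
    have unit: "g x (u /\<^sub>R a) (u /\<^sub>R a) = 1"
      using a pos by (simp add: bilinear_lmul[OF bl] bilinear_rmul[OF bl] field_simps)
    have c: "cone (R x)" using cone_of_is_cone(4)[OF x, of 2] by simp
    have "u \<in> R x \<longleftrightarrow> u /\<^sub>R a \<in> R x"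
    proof
      show "u \<in> R x \<Longrightarrow> u /\<^sub>R a \<in> R x" using c a(1) by (simp add: cone_def)
      assume "u /\<^sub>R a \<in> R x"
      then have "a *\<^sub>R (u /\<^sub>R a) \<in> R x" using c a(1) unfolding cone_def by (meson less_imp_le)
      then show "u \<in> R x" using a(1) by simp
    qed
    also have "\<dots> \<longleftrightarrow> 1 \<le> k (x, u /\<^sub>R a)" using k(3) x unit by simp
    finally show ?thesis using False by (simp add: a_def)
  qed
  have \<gamma>_pos: "\<gamma> > 0" using assms(2) \<mu>_neg by (simp add: \<gamma>_def)
  define t0 where "t0 = ln 8 / \<gamma>"
  have t0: "t0 > 0" using \<gamma>_pos by (simp add: t0_def)
  have small: "exp (- \<gamma> * t) \<le> 1 / 8" if "t \<ge> t0" for t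
  proof -
    have "ln 8 \<le> \<gamma> * t" using that \<gamma>_pos by (simp add: t0_def divide_le_eq mult.commute)
    then have "exp (- \<gamma> * t) \<le> exp (- ln 8)" by simp
    also have "\<dots> = 1 / 8" by (simp add: exp_minus inverse_eq_divide)
    finally show ?thesis .
  qed
  show ?thesis
    unfolding strictly_differentially_positive_in_def X
  proof (intro exI conjI)
    show "cone_field_on X K" "cone_field_on X R"
      unfolding cone_field_on_def using cone_of_is_cone[of _ 1] cone_of_is_cone[of _ 2] by simp_all
    show "\<forall>x1\<in>X. \<forall>x2\<in>X. \<exists>\<Gamma>. linear \<Gamma> \<and> bij \<Gamma> \<and> \<Gamma> ` K x1 = K x2 \<and> \<Gamma> ` R x1 = R x2"
      using cones_isomorphic by fast
    show "(0::real) < 1" by simp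
    show "cone_representation X 1 (\<lambda>_. k) K"
      unfolding cone_representation_def using k(1,2) by simp
    show "cone_representation_inner X g 1 (\<lambda>_. k) 1 R"
      unfolding cone_representation_inner_def using R_normalised by (auto simp: set_eq_iff)
    show "strict_diff_pos_wrt \<psi> X K R"
      unfolding strict_diff_pos_wrt_def diff_pos_wrt_def flow_diff_def D\<psi>_def[symmetric]
    proof (intro conjI exI[of _ t0] ballI allI impI t0 R_subset_interior_K)
      fix x t assume x: "x \<in> X"
      show "D\<psi> t x ` K x \<subseteq> K (\<psi> t x)" if "0 < t"
        using cone_invariance(1)[OF x] that by (auto intro: less_imp_le)
      show "D\<psi> t x ` K x \<subseteq> R (\<psi> t x)" if "t0 \<le> t"
        using cone_invariance(2)[OF x _ _ small[OF that]] that t0 by auto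
    qed
  qed
qed

lemma lipschitz_at_point_of_differentiable:
  fixes F :: "'a::euclidean_space \<Rightarrow> 'a \<Rightarrow>\<^sub>L 'a"
  assumes "\<And>i. i \<in> Basis \<Longrightarrow> (\<lambda>x. F x i) differentiable (at p)"
  shows "\<exists>\<rho>>0. \<exists>L. \<forall>x. norm (x - p) < \<rho> \<longrightarrow> norm (F x - F p) \<le> L * norm (x - p)"
proof -
  have "\<exists>L. \<forall>\<^sub>F x in nhds p. norm (F x i - F p i) \<le> L * norm (x - p)" if i: "i \<in> Basis" for i
  proof -
    obtain D where D: "((\<lambda>x. F x i) has_derivative D) (at p)" using assms[OF i] by (auto simp: differentiable_def)
    then obtain B where B: "\<And>h. norm (D h) \<le> norm h * B"
      using bounded_linear.bounded has_derivative_bounded_linear by blast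
    obtain d where d: "d > 0" "\<And>y. norm (y - p) < d \<Longrightarrow> norm (F y i - F p i - D (y - p)) \<le> 1 * norm (y - p)"
      using D unfolding has_derivative_at_alt by (metis zero_less_one)
    have "norm (F y i - F p i) \<le> (1 + B) * norm (y - p)" if "norm (y - p) < d" for y
      using d(2)[OF that] B[of "y - p"] norm_triangle_sub[of "F y i - F p i" "D (y - p)"]
      by (simp add: distrib_right mult.commute)
    then show ?thesis
      unfolding eventually_nhds_metric dist_norm using d(1) by blast
  qed
  then obtain L where L: "\<And>i. i \<in> Basis \<Longrightarrow> \<forall>\<^sub>F x in nhds p. norm (F x i - F p i) \<le> L i * norm (x - p)" by metis
  have "\<forall>\<^sub>F x in nhds p. \<forall>i\<in>Basis. norm (F x i - F p i) \<le> L i * norm (x - p)"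
    using L by (simp add: eventually_ball_finite_distrib)
  then obtain \<rho> where \<rho>: "\<rho> > 0" "\<And>x i. norm (x - p) < \<rho> \<Longrightarrow> i \<in> Basis \<Longrightarrow> norm (F x i - F p i) \<le> L i * norm (x - p)"
    unfolding eventually_nhds_metric dist_norm by blast
  have "norm (F x - F p) \<le> (\<Sum>i\<in>Basis. L i) * norm (x - p)" if "norm (x - p) < \<rho>" for x
  proof -
    have "norm (F x - F p) \<le> (\<Sum>i\<in>Basis. norm ((F x - F p) i))" by (rule norm_blinfun_euclidean_le)
    also have "\<dots> \<le> (\<Sum>i\<in>Basis. L i * norm (x - p))"
      using \<rho>(2)[OF that] by (intro sum_mono) (simp add: blinfun.diff_left)
    finally show ?thesis by (simp add: sum_distrib_right)
  qed
  then show ?thesis using \<rho>(1) by blast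
qed

theorem proposition3:
  fixes f :: "real^'n \<Rightarrow> real^'n"
    and \<psi> :: "real \<Rightarrow> real^'n \<Rightarrow> real^'n"
    and g :: "real^'n \<Rightarrow> real^'n \<Rightarrow> real^'n \<Rightarrow> real"
    and xstar :: "real^'n"
    and ev :: "nat \<Rightarrow> complex"
  assumes f_C2: "Ck_on 2 f UNIV"
    and flow: "complete_flow f \<psi>"
    and fixpoint: "f xstar = 0"
    and metric: "riemannian_metric_on (basin \<psi> xstar) g"
    and eigenvalues: "eigenvalues_with_mult (complex_jacobian f xstar) ev"
    and ordered: "\<forall>j. 1 \<le> j \<and> j < CARD('n) \<longrightarrow> Re (ev j) \<ge> Re (ev (j + 1))"
    and stable: "\<forall>j\<in>{1..CARD('n)}. 0 > Re (ev j)"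
    and ties: "real_first_among_leading CARD('n) ev"
    and eigenvectors: "independent_eigenvectors (complex_jacobian f xstar) ev"
  shows "(differentially_positive_in \<psi> (basin \<psi> xstar) \<longleftrightarrow> ev 1 \<in> \<real>) \<and>
    ((CARD('n) \<ge> 2 \<longrightarrow> Re (ev 1) > Re (ev 2)) \<longrightarrow>
       ev 1 \<in> \<real> \<and> strictly_differentially_positive_in \<psi> (basin \<psi> xstar) g)"
proof -
  let ?f' = "\<lambda>x. frechet_derivative f (at x)"
  have diff: "f differentiable (at x)" and diff': "(\<lambda>x. ?f' x v) differentiable (at x)" for x v
    using f_C2 by (simp_all add: numeral_2_eq_2)
  define F where "F x = Blinfun (?f' x)" for x
  have F: "blinfun_apply (F x) = ?f' x" for x
    unfolding F_def using diff[of x]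
    by (intro bounded_linear_Blinfun_apply has_derivative_bounded_linear) (simp add: frechet_derivative_works)
  have F_der: "(f has_derivative blinfun_apply (F x)) (at x)" for x
    using diff[of x] by (simp add: F frechet_derivative_works)
  have F_cont: "continuous_on UNIV F"
    by (rule continuous_on_blinfun_componentwise)
       (auto simp: F intro!: continuous_at_imp_continuous_on differentiable_imp_continuous_within diff')
  have C1: "C1_flow f F \<psi>"
    using flow F_der F_cont by unfold_locales (auto simp: complete_flow_def)
  interpret C1_flow f F \<psi> by (rule C1)
  define M where "M = matrix (?f' xstar)"
  have jac: "complex_jacobian f xstar = cmat M" by (simp add: complex_jacobian_def cmat_def M_def)
  have MF: "M *v u = F xstar u" for u
    unfolding M_def F using matrix_works[of "?f' xstar"] diff[of xstar]
    by (simp add: linear_frechet_derivative linear_matrix_vector_mul_eq)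
  note ind = eigenvectors[unfolded jac]
  have decreasing: "Re (ev j) \<le> Re (ev i)" if "1 \<le> i" "i \<le> j" "j \<le> CARD('n)" for i j
    using that(2,1,3)
  proof (induction j rule: dec_induct)
    case (step j)
    then show ?case using ordered by (metis Suc_eq_plus1 Suc_leD Suc_le_lessD le_trans order_trans)
  qed simp
  have neg: "Re (ev 1) < 0" using stable by (simp add: Suc_leI)
  have sink: "\<exists>\<alpha> (T :: real^'n \<Rightarrow> complex^'n) r \<rho> C\<^sub>1 C \<rho>\<^sub>0.
      split_sink_radius f F \<psi> xstar (Re (ev 1)) gap \<alpha> T r \<rho> C\<^sub>1 C \<rho>\<^sub>0"
    if real: "ev 1 \<in> \<real>" and gap: "gap \<ge> 0" "\<And>j. 2 \<le> j \<Longrightarrow> j \<le> CARD('n) \<Longrightarrow> Re (ev j) \<le> Re (ev 1) - gap" for gap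
  proof -
    obtain \<alpha> :: "real^'n \<Rightarrow> real" and T :: "real^'n \<Rightarrow> complex^'n" and r where s:
      "linear \<alpha>" "linear T" "\<And>u. \<alpha> (M *v u) = Re (ev 1) * \<alpha> u"
      "\<And>u. T u \<bullet> T (M *v u) \<le> (Re (ev 1) - gap) * (norm (T u))\<^sup>2"
      "\<And>u. \<alpha> u = 0 \<Longrightarrow> T u = 0 \<Longrightarrow> u = 0" "\<alpha> r = 1" "T r = 0"
      using real_leading_splitting[OF ind real refl gap] by blast
    note s' = s[unfolded MF]
    have lip: "\<exists>\<rho>>0. \<exists>L. \<forall>x. norm (x - xstar) < \<rho> \<longrightarrow> norm (F x - F xstar) \<le> L * norm (x - xstar)"
      by (rule lipschitz_at_point_of_differentiable) (simp add: F diff')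
    have sp: "split_sink f F \<psi> xstar (Re (ev 1)) gap \<alpha> T r"
      by (intro split_sink.intro[OF C1] split_sink_axioms.intro fixpoint neg gap(1) s'(1-4) s'(6,7) lip)
         (rule s'(5))
    obtain \<rho> C\<^sub>1 C \<rho>\<^sub>0 where "split_sink.good_constants f F xstar (Re (ev 1)) \<alpha> T \<rho> C\<^sub>1 C"
      "0 < \<rho>\<^sub>0" "\<rho>\<^sub>0 < \<rho>" "C * \<rho>\<^sub>0 \<le> 1 / 8"
      by (rule split_sink.cone_radius_exists[OF sp])
    then have "split_sink_radius f F \<psi> xstar (Re (ev 1)) gap \<alpha> T r \<rho> C\<^sub>1 C \<rho>\<^sub>0"
      by (intro split_sink_radius.intro[OF sp] split_sink_radius_axioms.intro)
    then show ?thesis by blast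
  qed
  have "differentially_positive_in \<psi> (basin \<psi> xstar)" if real: "ev 1 \<in> \<real>"
    using sink[of 0] real decreasing[of 1] differentially_positive_of_splitting by fastforce
  moreover have "ev 1 \<in> \<real>" if dp: "differentially_positive_in \<psi> (basin \<psi> xstar)"
  proof -
    obtain K where K: "cone_field_on (basin \<psi> xstar) K" "diff_pos_wrt \<psi> (basin \<psi> xstar) K"
      using dp by (auto simp: differentially_positive_in_def)
    have eq: "\<psi> t xstar = xstar" if "0 \<le> t" for t using flow_equilibrium[OF fixpoint that] .
    have "((\<lambda>t. \<psi> t xstar) \<longlongrightarrow> xstar) at_top"
      by (rule tendsto_eventually) (use eventually_ge_at_top[of 0] in \<open>eventually_elim, simp add: eq\<close>)
    then have xX: "xstar \<in> basin \<psi> xstar" by (simp add: basin_def)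
    have "\<exists>j\<in>{1..CARD('n)}. ev j \<in> \<real> \<and> Re (ev j) = Re (ev 1)"
    proof (rule invariant_cone_imp_real_leading_eigenvalue[OF ind, where K = "K xstar" and Y = "\<lambda>t. D\<psi> t xstar"])
      show "Re (ev j) \<le> Re (ev 1)" if "1 \<le> j" "j \<le> CARD('n)" for j using decreasing that by simp
      show "((\<lambda>t. D\<psi> t xstar u) has_vector_derivative M *v D\<psi> t xstar u) (at t)" if "0 < t" for t u
        using D\<psi>_ode[OF that, of xstar u] eq that by (simp add: MF)
      show "D\<psi> t xstar u \<in> K xstar" if "0 < t" "u \<in> K xstar" for t u
        using K(2) xX that eq unfolding diff_pos_wrt_def flow_diff_def D\<psi>_def by fastforce
    qed (use K(1) xX D\<psi>_0 D\<psi>_continuous_time in \<open>auto simp: cone_field_on_def\<close>)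
    then show ?thesis using ties by (auto simp: real_first_among_leading_def)
  qed
  moreover have "ev 1 \<in> \<real> \<and> strictly_differentially_positive_in \<psi> (basin \<psi> xstar) g"
    if strict: "CARD('n) \<ge> 2 \<longrightarrow> Re (ev 1) > Re (ev 2)"
  proof
    \<comment> \<open>In dimension one there is nothing to separate from and any positive gap will do.\<close>
    define gap where "gap = (if CARD('n) \<ge> 2 then Re (ev 1) - Re (ev 2) else 1)"
    have gap: "gap > 0" using strict by (simp add: gap_def)
    have le: "Re (ev j) \<le> Re (ev 1) - gap" if "2 \<le> j" "j \<le> CARD('n)" for j
      using decreasing[of 2 j] that by (simp add: gap_def)
    show real: "ev 1 \<in> \<real>"
      by (rule strictly_leading_eigenvalue_real[OF ind]) (use le gap in fastforce)
    show "strictly_differentially_positive_in \<psi> (basin \<psi> xstar) g"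
      using sink[OF real less_imp_le[OF gap] le] strictly_differentially_positive_of_splitting[OF _ gap metric] by blast
  qed
  ultimately show ?thesis by blast
qed

end
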